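(* There is a deterministic algorithm for Constrained Correlation Clustering which computes a $16$-approximation in time $\widetilde O(n^3)$, where $n=|V|$.
   Context: A clustering of a finite set $V$ is a partition $C=\{C_1,\dots,C_k\}$ of $V$; its edge set is $E_C=\bigcup_{i=1}^k\binom{C_i}{2}$. Constrained Correlation Clustering: given a graph $G=(V,E)$, a set of friendly pairs $F\subseteq\binom V2$ and a set of hostile pairs $H\subseteq\binom V2$, compute a clustering $C$ of $V$ such that no pair $uv\in F$ has $u,v$ in different clusters and no pair $uv\in H$ has $u,v$ in the same cluster (a valid clustering), minimizing the cost $|E\triangle E_C|$ ($\triangle$ is symmetric difference). A $\rho$-approximation is a valid clustering of cost at most $\rho$ times the minimum cost of a valid clustering. $\widetilde O(T)$ denotes $T(\log T)^{O(1)}$. *)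

theory Defs
  imports
    Complex_Main
    "HOL-Library.Disjoint_Sets"
    "HOL-Library.Ramsey"
    "HOL-Library.Log_Nat"
    "HOL-Library.Landau_Symbols"
begin

section \<open>Constrained Correlation Clustering\<close>

definition cluster_edges :: "'a set set \<Rightarrow> 'a set set" where
  "cluster_edges C = (\<Union>c\<in>C. [c]\<^bsup>2\<^esup>)"

definition valid_clustering :: "'a set \<Rightarrow> 'a set set \<Rightarrow> 'a set set \<Rightarrow> 'a set set \<Rightarrow> bool" where
  "valid_clustering V F H C \<longleftrightarrow>
     partition_on V C \<and>
     (\<forall>u v. {u, v} \<in> F \<longrightarrow> \<not> (\<exists>c\<in>C. \<exists>d\<in>C. c \<noteq> d \<and> u \<in> c \<and> v \<in> d)) \<and>
     (\<forall>u v. {u, v} \<in> H \<longrightarrow> \<not> (\<exists>c\<in>C. u \<in> c \<and> v \<in> c))"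

definition clustering_cost :: "'a set set \<Rightarrow> 'a set set \<Rightarrow> nat" where
  "clustering_cost E C = card (sym_diff E (cluster_edges C))"

definition opt_cost :: "'a set \<Rightarrow> 'a set set \<Rightarrow> 'a set set \<Rightarrow> 'a set set \<Rightarrow> nat" where
  "opt_cost V E F H = Min (clustering_cost E ` {C. valid_clustering V F H C})"

definition is_approximation ::
    "real \<Rightarrow> 'a set \<Rightarrow> 'a set set \<Rightarrow> 'a set set \<Rightarrow> 'a set set \<Rightarrow> 'a set set \<Rightarrow> bool" where
  "is_approximation \<rho> V E F H C \<longleftrightarrow>
     valid_clustering V F H C \<and>
     real (clustering_cost E C) \<le> \<rho> * real (opt_cost V E F H)"

section \<open>Random access machine with logarithmic cost\<close>

text \<open>
  Algorithms are structured programs over finitely many named, zero-initialised arrays of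
  natural numbers. The cell with index 0 of an array serves as a scalar variable, and an array
  access with a computed index is indirect addressing. Every value that is computed, read or
  used as an address is charged its bit length, so arithmetic on large numbers is not free.
\<close>

datatype binop = Add | Sub | Mul | Div | Less | Equal

fun apply_op :: "binop \<Rightarrow> nat \<Rightarrow> nat \<Rightarrow> nat" where
  "apply_op Add a b = a + b"
| "apply_op Sub a b = a - b"
| "apply_op Mul a b = a * b"
| "apply_op Div a b = a div b"
| "apply_op Less a b = of_bool (a < b)"
| "apply_op Equal a b = of_bool (a = b)"

datatype expr =
    Const nat
  | Read string expr
  | Op binop expr expr

type_synonym state = "string \<Rightarrow> nat \<Rightarrow> nat"

fun val :: "state \<Rightarrow> expr \<Rightarrow> nat" where
  "val s (Const k) = k"
| "val s (Read x e) = s x (val s e)"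
| "val s (Op f e1 e2) = apply_op f (val s e1) (val s e2)"

definition len :: "nat \<Rightarrow> nat" where
  "len k = max 1 (floorlog 2 k)"

text \<open>
  Each subexpression pays for its own value. Operands and addresses are themselves
  subexpressions, so they are paid for as well.
\<close>

fun cost :: "state \<Rightarrow> expr \<Rightarrow> nat" where
  "cost s (Const k) = len k"
| "cost s (Read x e) = cost s e + len (val s (Read x e))"
| "cost s (Op f e1 e2) = cost s e1 + cost s e2 + len (val s (Op f e1 e2))"

datatype com =
    Skip
  | Write string expr expr
  | Seq com com
  | If expr com com
  | While expr com

definition update :: "state \<Rightarrow> string \<Rightarrow> nat \<Rightarrow> nat \<Rightarrow> state" where
  "update s x i k = s(x := (s x)(i := k))"

text \<open>
  \<open>exec c s t s'\<close>: started in state \<open>s\<close>, the program \<open>c\<close> halts in state \<open>s'\<close> after time \<open>t\<close>.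
\<close>

inductive exec :: "com \<Rightarrow> state \<Rightarrow> nat \<Rightarrow> state \<Rightarrow> bool" where
  Skip: "exec Skip s 1 s"
| Write: "exec (Write x e1 e2) s (1 + cost s e1 + cost s e2) (update s x (val s e1) (val s e2))"
| Seq: "exec c1 s t1 s1 \<Longrightarrow> exec c2 s1 t2 s2 \<Longrightarrow> exec (Seq c1 c2) s (t1 + t2) s2"
| IfTrue: "val s e \<noteq> 0 \<Longrightarrow> exec c1 s t s' \<Longrightarrow> exec (If e c1 c2) s (1 + cost s e + t) s'"
| IfFalse: "val s e = 0 \<Longrightarrow> exec c2 s t s' \<Longrightarrow> exec (If e c1 c2) s (1 + cost s e + t) s'"
| WhileFalse: "val s e = 0 \<Longrightarrow> exec (While e c) s (1 + cost s e) s"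
| WhileTrue: "val s e \<noteq> 0 \<Longrightarrow> exec c s t1 s1 \<Longrightarrow> exec (While e c) s1 t2 s2 \<Longrightarrow>
    exec (While e c) s (1 + cost s e + t1 + t2) s2"

inductive_cases exec_SkipE: "exec Skip s t s'"
inductive_cases exec_WriteE: "exec (Write x e1 e2) s t s'"
inductive_cases exec_SeqE: "exec (Seq c1 c2) s t s'"
inductive_cases exec_IfE: "exec (If e c1 c2) s t s'"
inductive_cases exec_WhileE: "exec (While e c) s t s'"

lemma exec_deterministic:
  assumes "exec c s t1 s1" and "exec c s t2 s2"
  shows "t1 = t2 \<and> s1 = s2"
  using assms
proof (induction arbitrary: t2 s2 rule: exec.induct)
  case Skip
  then show ?case by (rule exec_SkipE) simp
next
  case Write
  then show ?case by (rule exec_WriteE) simp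
next
  case (Seq c1 s t1 s1 c2 t1' s1')
  from Seq.prems obtain u1 r u2 where t2: "t2 = u1 + u2"
    and r: "exec c1 s u1 r" "exec c2 r u2 s2"
    by (rule exec_SeqE)
  have eq: "t1 = u1" "s1 = r"
    using Seq.IH(1)[OF r(1)] by simp_all
  from eq t2 Seq.IH(2)[OF r(2)[folded eq(2)]] show ?case
    by simp
next
  case IfTrue
  from IfTrue.prems show ?case
    by (rule exec_IfE) (use IfTrue.hyps in \<open>auto dest: IfTrue.IH\<close>)
next
  case IfFalse
  from IfFalse.prems show ?case
    by (rule exec_IfE) (use IfFalse.hyps in \<open>auto dest: IfFalse.IH\<close>)
next
  case WhileFalse
  from WhileFalse.prems show ?case
    by (rule exec_WhileE) (use WhileFalse.hyps in simp_all)
next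
  case (WhileTrue s e c t1 s1 t1' s1')
  from WhileTrue.prems show ?case
  proof (rule exec_WhileE)
    fix u1 r u2
    assume t2: "t2 = Suc (cost s e + u1 + u2)"
      and r: "exec c s u1 r" "exec (While e c) r u2 s2"
    have eq: "t1 = u1" "s1 = r"
      using WhileTrue.IH(1)[OF r(1)] by simp_all
    from eq t2 WhileTrue.IH(2)[OF r(2)[folded eq(2)]] show ?thesis
      by simp
  qed (use WhileTrue.hyps in simp)
qed

section \<open>Input, output and running time\<close>

text \<open>The vertex set is \<open>{..<n}\<close>; sets of pairs are given as row-major adjacency matrices.\<close>

definition adjacency :: "nat \<Rightarrow> nat set set \<Rightarrow> nat \<Rightarrow> nat" where
  "adjacency n S i = of_bool ({i div n, i mod n} \<in> S)"

definition input_state :: "nat \<Rightarrow> nat set set \<Rightarrow> nat set set \<Rightarrow> nat set set \<Rightarrow> state" where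
  "input_state n E F H =
     (\<lambda>x i. 0)
       (''n'' := (\<lambda>i. 0)(0 := n),
        ''E'' := adjacency n E,
        ''F'' := adjacency n F,
        ''H'' := adjacency n H)"

text \<open>The output array holds a cluster label for every vertex.\<close>

definition output_clustering :: "nat \<Rightarrow> state \<Rightarrow> nat set set" where
  "output_clustering n s = (\<lambda>u. {v. v < n \<and> s ''out'' v = s ''out'' u}) ` {..<n}"

definition soft_O :: "(nat \<Rightarrow> real) \<Rightarrow> (nat \<Rightarrow> real) set" where
  "soft_O f = {g. \<exists>k::nat. g \<in> O(\<lambda>n. f n * ln (f n) ^ k)}"

end

theory Submission
  imports Defs
begin

text \<open>
  Contract the connected components of the friendly pairs. Between two components \<open>x\<close> and \<open>y\<close> count
  the edges. Whenever \<open>x\<close> and \<open>z\<close> are hostile, remove equally many edges between \<open>x\<close> and \<open>y\<close> and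
  between \<open>y\<close> and \<open>z\<close> until one side has none left; then round every block to all or nothing by
  majority. In the resulting graph the neighbours of a vertex contain no hostile pair, so a pivot
  clustering (a vertex together with its remaining neighbours, repeatedly) is valid.

  A bad triple has exactly two adjacent pairs, and each contains a violated pair of every clustering. A
  pivot \<open>p\<close> violates exactly the pairs \<open>(v, w)\<close> that form a bad triple with it. Given a fractional
  cover \<open>A\<close> of the bad triples by pairs, averaging yields a pivot whose violated pairs number at most three
  times their total weight. Multiplicative weights in constantly many phases provide a cover within
  \<open>13 / 6\<close> of every integral one. Charging removals, rounding and violations together against the
  pairs violated by a given valid clustering gives the factor \<open>3 + 6 * 13 / 6 = 16\<close>.

  Pairs and triples are ordered throughout: the two orientations of a pair are separate items, which
  doubles all costs and avoids maintaining symmetric arrays.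
\<close>

section \<open>Time-bounded execution\<close>

text \<open>Cubic time shapes every stage. There are n^3 ordered triples, so only a constant number
  of passes over them is affordable. The cover from j phases has ratio 2 (j + 1) / (j - 3), which
  stays above 2, hence a factor above 15. Nor can all pivots be rescored after each cluster: every
  vertex carries two running totals that decide whether it is a good pivot, and removing one vertex
  corrects all of them in quadratic time.

  The form 3 + 6 c of the factor, with c the cover ratio: pivoting costs 3 c per pair on which the
  rounded graph and the given clustering differ. Consider a block inside a cluster all of whose
  pairs are edges. Rounding empties it only after its two orientations have together lost at least
  as many edges as it has pairs, and then each pair costs 1 + 3 c; so each loss must be worth 1 + 3
  c. Removals come in equal amounts, so losses inside clusters are paid by losses between clusters.
  There a block may lose everything in both orientations, and each of its edges bears 1 for itself
  and 1 + 3 c for each of two losses.\<close>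

text \<open>For a state with all cells at most \<open>N\<close>, \<open>dg\<close> bounds the length of the value and \<open>ec\<close> the
  cost of an expression, both in multiples of \<open>len N\<close>.\<close>

fun dg :: "expr \<Rightarrow> nat" where
  "dg (Const k) = Suc k"
| "dg (Read x e) = 1"
| "dg (Op f e1 e2) = dg e1 + dg e2"

fun ec :: "expr \<Rightarrow> nat" where
  "ec (Const k) = Suc k"
| "ec (Read x e) = Suc (ec e)"
| "ec (Op f e1 e2) = ec e1 + ec e2 + dg e1 + dg e2"

lemma len_pos: "1 \<le> len k"
  by (simp add: len_def)

lemma less_two_power_len: "k < 2 ^ len k"
proof (cases "k = 0")
  case False
  then have "k < 2 ^ floorlog 2 k"
    using floorlog_bounds[of k 2] by auto
  also have "\<dots> \<le> 2 ^ len k"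
    by (rule power_increasing) (auto simp: len_def)
  finally show ?thesis .
qed simp

lemma len_le:
  assumes "k < 2 ^ b" and "1 \<le> b"
  shows "len k \<le> b"
proof (cases "k = 0")
  case False
  then have "2 ^ (floorlog 2 k - 1) \<le> k"
    using floorlog_bounds[of k 2] by auto
  then have "(2::nat) ^ (floorlog 2 k - 1) < 2 ^ b"
    using assms(1) by (rule le_less_trans)
  then have "floorlog 2 k - 1 < b"
    by (rule power_less_imp_less_exp[rotated]) simp
  then show ?thesis
    using assms(2) by (auto simp: len_def)
qed (use assms in \<open>auto simp: len_def floorlog_def\<close>)

lemma len_mono: "j \<le> k \<Longrightarrow> len j \<le> len k"
  by (rule len_le) (use less_two_power_len[of k] len_pos in auto)

lemma len_le_Suc: "len k \<le> Suc k"
  by (rule len_le) (auto intro: less_trans[OF less_exp] simp: less_Suc_eq)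

text \<open>Multiplication is the worst case: both powers of two are at least 2, as
  \<open>len\<close> is never 0, so their sum is at most their product, and truth values are below
  2. One additive rule thus serves all operations in \<open>dg\<close> and
  \<open>ec\<close>.\<close>

lemma len_apply_op: "len (apply_op f a b) \<le> len a + len b"
proof -
  have a: "a < 2 ^ len a" and b: "b < 2 ^ len b"
    by (rule less_two_power_len)+
  have mul: "a * b < 2 ^ (len a + len b)"
    unfolding power_add by (rule mult_strict_mono) (use a b in auto)
  have mono: "c < 2 ^ len a \<Longrightarrow> c < 2 ^ (len a + len b)" for c :: nat
    by (erule less_le_trans) (auto intro: power_increasing)
  have one: "of_bool Q < (2::nat) ^ (len a + len b)" for Q
    by (rule less_le_trans[of _ "2 ^ 1"], simp, rule power_increasing)
      (use len_pos[of a] in auto)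
  have add: "a + b < 2 ^ (len a + len b)"
  proof -
    have prod: "x + y \<le> x * y" if "2 \<le> x" "2 \<le> y" for x y :: nat
      using that by (auto simp: algebra_simps dest!: le_Suc_ex)
    have "2 \<le> (2::nat) ^ len a" "2 \<le> (2::nat) ^ len b"
      using len_pos[of a] len_pos[of b] self_le_power[of "2::nat"] by auto
    from prod[OF this] a b show ?thesis by (simp add: power_add)
  qed
  have div: "a div b < 2 ^ (len a + len b)"
    by (rule mono) (use a div_le_dividend[of a b] in linarith)
  show ?thesis
    by (cases f; simp only: apply_op.simps; rule len_le)
      (use len_pos[of a] add mul one div mono[of "a - b"] a in auto)
qed

definition bounded_by :: "nat \<Rightarrow> state \<Rightarrow> bool" where
  "bounded_by N s \<longleftrightarrow> (\<forall>x i. s x i \<le> N)"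

lemma len_val:
  assumes "bounded_by N s"
  shows "len (val s e) \<le> dg e * len N"
proof (induction e)
  case (Const k)
  have "len k \<le> Suc k * 1" using len_le_Suc by simp
  also have "\<dots> \<le> Suc k * len N" by (rule mult_le_mono2) (rule len_pos)
  finally show ?case by simp
next
  case (Read x e)
  then show ?case using assms by (auto simp: bounded_by_def intro!: len_mono)
next
  case (Op f e1 e2)
  then show ?case
    using len_apply_op[of f "val s e1" "val s e2"] by (simp add: algebra_simps)
qed

lemma cost_le:
  assumes "bounded_by N s"
  shows "cost s e \<le> ec e * len N"
proof (induction e)
  case (Const k)
  then show ?case using len_val[OF assms, of "Const k"] by simp
next
  case (Read x e)
  then show ?case using len_val[OF assms, of "Read x e"] by simp
next
  case (Op f e1 e2)
  then show ?case using len_val[OF assms, of "Op f e1 e2"] by (simp add: algebra_simps)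
qed

fun wvars :: "com \<Rightarrow> string set" where
  "wvars Skip = {}"
| "wvars (Write x e1 e2) = {x}"
| "wvars (Seq c1 c2) = wvars c1 \<union> wvars c2"
| "wvars (If e c1 c2) = wvars c1 \<union> wvars c2"
| "wvars (While e c) = wvars c"

lemma exec_frame: "exec c s t s' \<Longrightarrow> x \<notin> wvars c \<Longrightarrow> s' x = s x"
  by (induction rule: exec.induct) (auto simp: update_def)

text \<open>Every loop is charged for \<open>n\<close> iterations; all loops below have the form \<open>For\<close>.\<close>

fun steps :: "nat \<Rightarrow> com \<Rightarrow> nat" where
  "steps n Skip = 1"
| "steps n (Write x e1 e2) = 1"
| "steps n (Seq c1 c2) = steps n c1 + steps n c2"
| "steps n (If e c1 c2) = 1 + steps n c1 + steps n c2"
| "steps n (While e c) = n * (1 + steps n c) + 1"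

abbreviation Var :: "string \<Rightarrow> expr" where
  "Var x \<equiv> Read x (Const 0)"

abbreviation At :: "string \<Rightarrow> expr \<Rightarrow> expr \<Rightarrow> expr" where
  "At x e1 e2 \<equiv> Read x (Op Add (Op Mul e1 (Var ''n'')) e2)"

abbreviation Assign :: "string \<Rightarrow> expr \<Rightarrow> com" where
  "Assign x e \<equiv> Write x (Const 0) e"

abbreviation Put :: "string \<Rightarrow> expr \<Rightarrow> expr \<Rightarrow> expr \<Rightarrow> com" where
  "Put x e1 e2 e \<equiv> Write x (Op Add (Op Mul e1 (Var ''n'')) e2) e"

definition For :: "string \<Rightarrow> com \<Rightarrow> com" where
  "For i c = Seq (Assign i (Const 0))
     (While (Op Less (Var i) (Var ''n'')) (Seq c (Assign i (Op Add (Var i) (Const 1)))))"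

lemma wvars_For [simp]: "wvars (For i c) = insert i (wvars c)"
  by (auto simp: For_def)

lemma update_apply [simp]:
  "update s x i k y = (if y = x then (s x)(i := k) else s y)"
  by (simp add: update_def)

text \<open>Exceeds \<open>ec\<close> of every guard and of every assignment below, so that one unit
  of \<open>steps\<close> is worth \<open>max_weight * len N\<close>.\<close>

definition max_weight :: nat where "max_weight = 500"

section \<open>Total correctness with a time budget\<close>

locale ram =
  fixes n N :: nat
  assumes n_le: "n \<le> N"
begin

definition ok :: "state \<Rightarrow> bool" where
  "ok s \<longleftrightarrow> bounded_by N s \<and> s ''n'' 0 = n"

text \<open>The time bound depends on the syntax of \<open>c\<close> alone. Preservation of
  \<open>ok\<close> is part of the claim because the price of a step rests on the value bound
  \<open>N\<close>.\<close>

definition runs :: "state \<Rightarrow> com \<Rightarrow> (state \<Rightarrow> bool) \<Rightarrow> bool" where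
  "runs s c Q \<longleftrightarrow> (\<exists>t s'. exec c s t s' \<and> t \<le> steps n c * (max_weight * len N) \<and> ok s' \<and> Q s')"

lemma okD: "ok s \<Longrightarrow> s ''n'' 0 = n" "ok s \<Longrightarrow> s x i \<le> N"
  by (auto simp: ok_def bounded_by_def)

lemma cost_Suc_le:
  assumes "ok s" and "ec e < max_weight"
  shows "1 + cost s e \<le> max_weight * len N"
proof -
  have "1 + cost s e \<le> len N + ec e * len N"
    using cost_le[of N s e] len_pos[of N] assms by (intro add_mono) (auto simp: ok_def)
  also have "\<dots> = Suc (ec e) * len N" by simp
  also have "\<dots> \<le> max_weight * len N" using assms by (intro mult_le_mono1) simp
  finally show ?thesis .
qed

lemma cost_Suc_le2:
  assumes "ok s" and "ec e1 + ec e2 < max_weight"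
  shows "1 + cost s e1 + cost s e2 \<le> max_weight * len N"
proof -
  have "1 + cost s e1 + cost s e2 \<le> len N + ec e1 * len N + ec e2 * len N"
    using cost_le[of N s e1] cost_le[of N s e2] len_pos[of N] assms
    by (intro add_mono) (auto simp: ok_def)
  also have "\<dots> = Suc (ec e1 + ec e2) * len N" by (simp add: algebra_simps)
  also have "\<dots> \<le> max_weight * len N" using assms by (intro mult_le_mono1) simp
  finally show ?thesis .
qed

lemma runs_conseq:
  assumes "runs s c Q"
    and "\<And>s'. ok s' \<Longrightarrow> (\<And>x. x \<notin> wvars c \<Longrightarrow> s' x = s x) \<Longrightarrow> Q s' \<Longrightarrow> Q' s'"
  shows "runs s c Q'"
  using assms exec_frame unfolding runs_def by blast

lemma runs_Skip: "ok s \<Longrightarrow> Q s \<Longrightarrow> runs s Skip Q"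
  using len_pos[of N] unfolding runs_def max_weight_def
  by (intro exI[of _ 1] exI[of _ s]) (auto intro: exec.Skip[simplified])

lemma runs_Write:
  assumes "ok s" and "ec e1 + ec e2 < max_weight" and "val s e2 \<le> N" and "x \<noteq> ''n''"
    and Q: "ok (update s x (val s e1) (val s e2)) \<Longrightarrow> Q (update s x (val s e1) (val s e2))"
  shows "runs s (Write x e1 e2) Q"
proof -
  have "ok (update s x (val s e1) (val s e2))"
    using assms(1,3,4) by (auto simp: ok_def bounded_by_def)
  then show ?thesis
    unfolding runs_def
    using Q cost_Suc_le2[OF assms(1,2)] exec.Write[of x e1 e2 s]
    by (intro exI[of _ "1 + cost s e1 + cost s e2"] exI[of _ "update s x (val s e1) (val s e2)"])
      auto
qed

lemma runs_Seq:
  assumes "runs s c1 (\<lambda>s1. runs s1 c2 Q)"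
  shows "runs s (Seq c1 c2) Q"
proof -
  from assms obtain t1 s1 t2 s2 where
    "exec c1 s t1 s1" "t1 \<le> steps n c1 * (max_weight * len N)"
    "exec c2 s1 t2 s2" "t2 \<le> steps n c2 * (max_weight * len N)" "ok s2" "Q s2"
    unfolding runs_def by blast
  then show ?thesis
    unfolding runs_def
    by (intro exI[of _ "t1 + t2"] exI[of _ s2]) (auto intro: exec.Seq simp: add_mult_distrib)
qed

lemma runs_If:
  assumes "ok s" and w: "ec e < max_weight"
    and 1: "val s e \<noteq> 0 \<Longrightarrow> runs s c1 Q" and 0: "val s e = 0 \<Longrightarrow> runs s c2 Q"
  shows "runs s (If e c1 c2) Q"
proof (cases "val s e = 0")
  case True
  from 0[OF True] obtain t s' where
    "exec c2 s t s'" "t \<le> steps n c2 * (max_weight * len N)" "ok s'" "Q s'"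
    unfolding runs_def by blast
  then show ?thesis
    unfolding runs_def
    using exec.IfFalse[OF True, of c2 t s' c1] cost_Suc_le[OF assms(1,2)]
    by (intro exI[of _ "1 + cost s e + t"] exI[of _ s']) (auto simp: add_mult_distrib)
next
  case False
  from 1[OF False] obtain t s' where
    "exec c1 s t s'" "t \<le> steps n c1 * (max_weight * len N)" "ok s'" "Q s'"
    unfolding runs_def by blast
  then show ?thesis
    unfolding runs_def
    using exec.IfTrue[OF False, of c1 t s' c2] cost_Suc_le[OF assms(1,2)]
    by (intro exI[of _ "1 + cost s e + t"] exI[of _ s']) (auto simp: add_mult_distrib)
qed

text \<open>The frame premise of \<open>step\<close> compares with the state before the whole loop,
  so \<open>I\<close> only has to speak about what the body writes. The invariant is re-established
  after the counter has moved, since that update follows the body.\<close>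

lemma runs_For:
  assumes ok: "ok s" and i: "i \<notin> wvars c" "i \<noteq> ''n''" and n: "''n'' \<notin> wvars c"
    and init: "I 0 (update s i 0 0)"
    and step: "\<And>k s'. k < n \<Longrightarrow> ok s' \<Longrightarrow> s' i 0 = k \<Longrightarrow>
      (\<And>x. x \<notin> insert i (wvars c) \<Longrightarrow> s' x = s x) \<Longrightarrow> I k s' \<Longrightarrow>
      runs s' c (\<lambda>s''. I (Suc k) (update s'' i 0 (Suc k)))"
  shows "runs s (For i c) (I n)"
proof -
  let ?W = "max_weight * len N"
  let ?t = "Op Less (Var i) (Var ''n'')"
  let ?inc = "Assign i (Op Add (Var i) (Const 1))"
  \<comment> \<open>Induction on the remaining iterations: 2 units per iteration pay for the test
    and the increment, the final 1 for the failing test.\<close>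
  have loop: "\<exists>t s''. exec (While ?t (Seq c ?inc)) s' t s'' \<and>
      t \<le> ((n - k) * (2 + steps n c) + 1) * ?W \<and> ok s'' \<and> I n s''"
    if "k \<le> n" "ok s'" "s' i 0 = k" "\<And>x. x \<notin> insert i (wvars c) \<Longrightarrow> s' x = s x" "I k s'" for k s'
    using that
  proof (induction "n - k" arbitrary: k s')
    case 0
    then have "val s' ?t = 0" by (simp add: okD)
    moreover have "1 + cost s' ?t \<le> ?W"
      by (rule cost_Suc_le) (use 0 in \<open>auto simp: max_weight_def\<close>)
    ultimately show ?case
      using exec.WhileFalse[of s' ?t "Seq c ?inc"] 0
      by (intro exI[of _ "1 + cost s' ?t"] exI[of _ s']) auto
  next
    case (Suc d)
    then have k: "k < n" by simp
    have t: "val s' ?t \<noteq> 0" using Suc k by (simp add: okD)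
    have w: "1 + cost s' ?t \<le> ?W"
      by (rule cost_Suc_le) (use Suc in \<open>auto simp: max_weight_def\<close>)
    from step[OF k Suc.prems(2-5)] obtain t1 s1 where
      1: "exec c s' t1 s1" "t1 \<le> steps n c * ?W" "ok s1" "I (Suc k) (update s1 i 0 (Suc k))"
      unfolding runs_def by blast
    have s1: "s1 i 0 = k" using exec_frame[OF 1(1) i(1)] Suc by simp
    let ?s2 = "update s1 i 0 (Suc k)"
    have "exec ?inc s1 (1 + cost s1 (Const 0) + cost s1 (Op Add (Var i) (Const 1))) ?s2"
      using exec.Write[of i "Const 0" "Op Add (Var i) (Const 1)" s1] s1 by simp
    moreover have w2: "1 + cost s1 (Const 0) + cost s1 (Op Add (Var i) (Const 1)) \<le> ?W"
      by (rule cost_Suc_le2) (use 1 in \<open>auto simp: max_weight_def\<close>)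
    ultimately obtain t2 where 2: "exec ?inc s1 t2 ?s2" "t2 \<le> ?W" by blast
    have ok2: "ok ?s2" using 1(3) k n_le i by (auto simp: ok_def bounded_by_def)
    have "x \<notin> insert i (wvars c) \<Longrightarrow> ?s2 x = s x" for x
      using exec_frame[OF 1(1)] Suc.prems(4) by auto
    then have "\<exists>t s''. exec (While ?t (Seq c ?inc)) ?s2 t s'' \<and>
        t \<le> ((n - Suc k) * (2 + steps n c) + 1) * ?W \<and> ok s'' \<and> I n s''"
      by (intro Suc.hyps(1) ok2 1(4)) (use Suc.hyps(2) k in auto)
    then obtain t3 s3 where 3: "exec (While ?t (Seq c ?inc)) ?s2 t3 s3"
      "t3 \<le> ((n - Suc k) * (2 + steps n c) + 1) * ?W" "ok s3" "I n s3"
      by blast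
    have e: "exec (While ?t (Seq c ?inc)) s' (1 + cost s' ?t + (t1 + t2) + t3) s3"
      by (rule exec.WhileTrue[OF t exec.Seq[OF 1(1) 2(1)] 3(1)])
    have "1 + cost s' ?t + (t1 + t2) + t3 \<le>
        ?W + (steps n c * ?W + ?W) + ((n - Suc k) * (2 + steps n c) + 1) * ?W"
      by (intro add_mono w 1 2 3)
    also have "\<dots> = ((Suc (n - Suc k)) * (2 + steps n c) + 1) * ?W"
      by (simp add: algebra_simps)
    also have "Suc (n - Suc k) = n - k" using k by simp
    finally show ?case using e 3 by blast
  qed
  let ?s0 = "update s i 0 0"
  have e0: "exec (Assign i (Const 0)) s (1 + cost s (Const 0) + cost s (Const 0)) ?s0"
    using exec.Write[of i "Const 0" "Const 0" s] by simp
  have w0: "1 + cost s (Const 0) + cost s (Const 0) \<le> ?W"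
    by (rule cost_Suc_le2) (use ok in \<open>auto simp: max_weight_def\<close>)
  have "ok ?s0" using ok i by (auto simp: ok_def bounded_by_def)
  from loop[OF _ this _ _ init] obtain t s'' where
    L: "exec (While ?t (Seq c ?inc)) ?s0 t s''"
      "t \<le> (n * (2 + steps n c) + 1) * ?W" "ok s''" "I n s''"
    by auto
  have "1 + cost s (Const 0) + cost s (Const 0) + t \<le> ?W + (n * (2 + steps n c) + 1) * ?W"
    by (rule add_mono[OF w0 L(2)])
  also have "\<dots> = steps n (For i c) * ?W"
    by (simp add: For_def algebra_simps)
  finally show ?thesis
    unfolding runs_def For_def using exec.Seq[OF e0 L(1)] L(3,4) by blast
qed

text \<open>The invariant is indexed by the set of processed pairs instead of two counters. The
  freshness of \<open>(i, j)\<close> is what counting loops rely on, and \<open>loopvar\<close>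
  keeps the invariant independent of the counters.\<close>

lemma runs_For2:
  assumes "ok s" and "u \<notin> wvars c" "v \<notin> wvars c" "''n'' \<notin> wvars c" "u \<noteq> ''n''" "v \<noteq> ''n''" "u \<noteq> v"
    and init: "I {} s"
    and loopvar: "\<And>D s' x i. x \<in> {u, v} \<Longrightarrow> I D s' \<Longrightarrow> I D (update s' x 0 i)"
    and step: "\<And>D i j s'. i < n \<Longrightarrow> j < n \<Longrightarrow> (i, j) \<notin> D \<Longrightarrow> D \<subseteq> {..<n} \<times> {..<n} \<Longrightarrow>
      ok s' \<Longrightarrow> s' u 0 = i \<Longrightarrow> s' v 0 = j \<Longrightarrow>
      (\<And>x. x \<notin> {u, v} \<union> wvars c \<Longrightarrow> s' x = s x) \<Longrightarrow> I D s' \<Longrightarrow>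
      runs s' c (I (insert (i, j) D))"
  shows "runs s (For u (For v c)) (I ({..<n} \<times> {..<n}))"
proof (rule runs_For[where I = "\<lambda>k. I ({..<k} \<times> {..<n})"])
  fix k s1
  assume k: "k < n" "ok s1" "s1 u 0 = k"
    and fr1: "\<And>x. x \<notin> insert u (wvars (For v c)) \<Longrightarrow> s1 x = s x"
    and I1: "I ({..<k} \<times> {..<n}) s1"
  show "runs s1 (For v c) (\<lambda>s2. I ({..<Suc k} \<times> {..<n}) (update s2 u 0 (Suc k)))"
  proof (rule runs_conseq)
    show "runs s1 (For v c) (I ({..<k} \<times> {..<n} \<union> {k} \<times> {..<n}))"
    proof (rule runs_For[where I = "\<lambda>l. I ({..<k} \<times> {..<n} \<union> {k} \<times> {..<l})"])
      fix l s2
      assume l: "l < n" "ok s2" "s2 v 0 = l"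
        and fr2: "\<And>x. x \<notin> insert v (wvars c) \<Longrightarrow> s2 x = s1 x"
        and I2: "I ({..<k} \<times> {..<n} \<union> {k} \<times> {..<l}) s2"
      show "runs s2 c (\<lambda>s3. I ({..<k} \<times> {..<n} \<union> {k} \<times> {..<Suc l}) (update s3 v 0 (Suc l)))"
      proof (rule runs_conseq)
        show "runs s2 c (I (insert (k, l) ({..<k} \<times> {..<n} \<union> {k} \<times> {..<l})))"
          by (rule step) (use k l fr1 fr2 I2 assms in auto)
      next
        fix s3
        assume "I (insert (k, l) ({..<k} \<times> {..<n} \<union> {k} \<times> {..<l})) s3"
        moreover have "insert (k, l) ({..<k} \<times> {..<n} \<union> {k} \<times> {..<l}) =
            {..<k} \<times> {..<n} \<union> {k} \<times> {..<Suc l}"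
          by auto
        ultimately show "I ({..<k} \<times> {..<n} \<union> {k} \<times> {..<Suc l}) (update s3 v 0 (Suc l))"
          using loopvar by simp
      qed
    qed (use k assms I1 loopvar in auto)
  next
    fix s2
    assume "I ({..<k} \<times> {..<n} \<union> {k} \<times> {..<n}) s2"
    moreover have "{..<k} \<times> {..<n} \<union> {k} \<times> {..<n} = {..<Suc k} \<times> {..<n}"
      by auto
    ultimately show "I ({..<Suc k} \<times> {..<n}) (update s2 u 0 (Suc k))"
      using loopvar by simp
  qed
qed (use assms loopvar in auto)

lemma runs_For3:
  assumes "ok s" and "u \<notin> wvars c" "v \<notin> wvars c" "w \<notin> wvars c" "''n'' \<notin> wvars c"
    and "u \<noteq> ''n''" "v \<noteq> ''n''" "w \<noteq> ''n''" "u \<noteq> v" "u \<noteq> w" "v \<noteq> w"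
    and init: "I {} s"
    and loopvar: "\<And>D s' x i. x \<in> {u, v, w} \<Longrightarrow> I D s' \<Longrightarrow> I D (update s' x 0 i)"
    and step: "\<And>D i j k s'. i < n \<Longrightarrow> j < n \<Longrightarrow> k < n \<Longrightarrow> (i, j, k) \<notin> D \<Longrightarrow>
      D \<subseteq> {..<n} \<times> {..<n} \<times> {..<n} \<Longrightarrow>
      ok s' \<Longrightarrow> s' u 0 = i \<Longrightarrow> s' v 0 = j \<Longrightarrow> s' w 0 = k \<Longrightarrow>
      (\<And>x. x \<notin> {u, v, w} \<union> wvars c \<Longrightarrow> s' x = s x) \<Longrightarrow> I D s' \<Longrightarrow>
      runs s' c (I (insert (i, j, k) D))"
  shows "runs s (For u (For v (For w c))) (I ({..<n} \<times> {..<n} \<times> {..<n}))"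
proof (rule runs_For[where I = "\<lambda>k. I ({..<k} \<times> {..<n} \<times> {..<n})"])
  fix i s1
  assume k: "i < n" "ok s1" "s1 u 0 = i"
    and fr1: "\<And>x. x \<notin> insert u (wvars (For v (For w c))) \<Longrightarrow> s1 x = s x"
    and I1: "I ({..<i} \<times> {..<n} \<times> {..<n}) s1"
  let ?J = "\<lambda>D. I ({..<i} \<times> {..<n} \<times> {..<n} \<union> {i} \<times> D)"
  show "runs s1 (For v (For w c)) (\<lambda>s2. I ({..<Suc i} \<times> {..<n} \<times> {..<n}) (update s2 u 0 (Suc i)))"
  proof (rule runs_conseq)
    show "runs s1 (For v (For w c)) (?J ({..<n} \<times> {..<n}))"
    proof (rule runs_For2[where I = ?J])
      fix D j k s2
      assume j: "j < n" "k < n" "(j, k) \<notin> D" "D \<subseteq> {..<n} \<times> {..<n}" "ok s2" "s2 v 0 = j" "s2 w 0 = k"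
        and fr2: "\<And>x. x \<notin> {v, w} \<union> wvars c \<Longrightarrow> s2 x = s1 x"
        and J: "?J D s2"
      have *: "insert (i, j, k) ({..<i} \<times> {..<n} \<times> {..<n} \<union> {i} \<times> D) =
          {..<i} \<times> {..<n} \<times> {..<n} \<union> {i} \<times> insert (j, k) D"
        by auto
      have "runs s2 c (I (insert (i, j, k) ({..<i} \<times> {..<n} \<times> {..<n} \<union> {i} \<times> D)))"
        by (rule step) (use k j fr1 fr2 J assms in auto)
      then show "runs s2 c (?J (insert (j, k) D))"
        unfolding * .
    qed (use k assms I1 loopvar in auto)
  next
    fix s2
    assume "?J ({..<n} \<times> {..<n}) s2"
    moreover have "{..<i} \<times> {..<n} \<times> {..<n} \<union> {i} \<times> {..<n} \<times> {..<n} = {..<Suc i} \<times> {..<n} \<times> {..<n}"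
      by auto
    ultimately show "I ({..<Suc i} \<times> {..<n} \<times> {..<n}) (update s2 u 0 (Suc i))"
      using loopvar by simp
  qed
qed (use assms loopvar in auto)

text \<open>Entries outside the \<open>n\<close> by \<open>n\<close> square read as 0. This makes
  \<open>mat\<close> of an updated array equal, as a function, to the update of \<open>mat\<close>,
  and lets invariants quantify over all index pairs.\<close>

definition mat :: "(nat \<Rightarrow> nat) \<Rightarrow> nat \<times> nat \<Rightarrow> nat" where
  "mat f = (\<lambda>(u, v). if u < n \<and> v < n then f (u * n + v) else 0)"

lemma index_eq_iff:
  assumes "v < n" "v' < n"
  shows "u * n + v = u' * n + v' \<longleftrightarrow> u = u' \<and> v = v'"
proof
  assume eq: "u * n + v = u' * n + v'"
  have "u = (u * n + v) div n" using assms by simp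
  also have "\<dots> = u'" unfolding eq using assms by simp
  finally show "u = u' \<and> v = v'" using eq by simp
qed simp

lemma mat_read: "u < n \<Longrightarrow> v < n \<Longrightarrow> f (u * n + v) = mat f (u, v)"
  by (simp add: mat_def)

lemma mat_update: "u < n \<Longrightarrow> v < n \<Longrightarrow> mat (f(u * n + v := k)) = (mat f)((u, v) := k)"
  by (auto simp: mat_def fun_eq_iff index_eq_iff)

lemma mat_zero: "mat (\<lambda>i. 0) = (\<lambda>q. 0)"
  by (auto simp: mat_def)

end

section \<open>Fractional covers by multiplicative weights\<close>

text \<open>The third pair is \<open>(w, p)\<close> rather than \<open>(p, w)\<close>: reading a
  triple cyclically makes the set invariant under rotation for any relation. \<open>covers\<close>
  inspects the same three ordered pairs.\<close>

definition bad_triples :: "nat \<Rightarrow> (nat \<Rightarrow> nat \<Rightarrow> bool) \<Rightarrow> (nat \<times> nat \<times> nat) set" where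
  "bad_triples n a = {(p, v, w). p < n \<and> v < n \<and> w < n \<and>
     of_bool (a p v) + of_bool (a v w) + of_bool (a w p) = (2 :: nat)}"

definition covers :: "(nat \<times> nat) set \<Rightarrow> (nat \<times> nat \<times> nat) set \<Rightarrow> bool" where
  "covers M T \<longleftrightarrow> (\<forall>p v w. (p, v, w) \<in> T \<longrightarrow> (p, v) \<in> M \<or> (v, w) \<in> M \<or> (w, p) \<in> M)"

abbreviation pairs :: "nat \<Rightarrow> (nat \<times> nat) set" where
  "pairs n \<equiv> {..<n} \<times> {..<n}"

text \<open>The weights are \<open>X = 2 ^ k - 1\<close>, and \<open>A\<close> accumulates the weights of the past phases, scaled by
  \<open>2\<close> per phase. Phase \<open>j\<close> doubles the triples with \<open>X (p, v) + X (v, w) + X (w, p) + 3 < 2 ^ Suc j\<close>;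
  \<open>D\<close> is the set of triples it has processed. A doubling adds less than \<open>2 ^ Suc j\<close> to the total
  weight and raises the exponent of some pair of every integral cover \<open>M\<close>; hence \<open>pot\<close>.\<close>

locale mw_inv =
  fixes n :: nat and T :: "(nat \<times> nat \<times> nat) set" and j :: nat and D :: "(nat \<times> nat \<times> nat) set"
    and X A k :: "nat \<times> nat \<Rightarrow> nat"
  assumes low: "(p, v, w) \<in> T \<Longrightarrow> 2 ^ j \<le> X (p, v) + X (v, w) + X (w, p) + 3"
    and acc: "(p, v, w) \<in> T \<Longrightarrow> j * 2 ^ j + 3 \<le> A (p, v) + A (v, w) + A (w, p) + 3 * 2 ^ j"
    and high: "(p, v, w) \<in> T \<inter> D \<Longrightarrow> 2 ^ Suc j \<le> X (p, v) + X (v, w) + X (w, p) + 3"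
    and A_le: "A q \<le> j * 2 ^ j"
    and X_eq: "X q + 1 = 2 ^ k q"
    and k_le: "k q \<le> Suc j"
    and pot: "M \<subseteq> pairs n \<Longrightarrow> covers M T \<Longrightarrow>
      sum A (pairs n) + sum X (pairs n) \<le> 2 ^ Suc j * sum k M"
begin

lemma X_less: "X q < 2 ^ Suc j"
proof -
  have "(2::nat) ^ k q \<le> 2 ^ Suc j" by (intro power_increasing k_le) simp
  with X_eq[of q] show ?thesis by linarith
qed

lemma skip:
  assumes "(p, v, w) \<in> T \<Longrightarrow> 2 ^ Suc j \<le> X (p, v) + X (v, w) + X (w, p) + 3"
  shows "mw_inv n T j (insert (p, v, w) D) X A k"
proof
  show "2 ^ Suc j \<le> X (p', v') + X (v', w') + X (w', p') + 3"
    if "(p', v', w') \<in> T \<inter> insert (p, v, w) D" for p' v' w'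
    using that assms high by blast
qed (fact low acc A_le X_eq k_le pot)+

text \<open>The potential exactly doubles, since \<open>2 * A + X\<close> and \<open>X\<close> add
  up to twice \<open>A + X\<close>, and so does the factor \<open>2 ^ Suc j\<close>. The deficit in
  \<open>acc\<close> obeys d' = 2 d + 3, because each of the three weights is a power of two minus
  1; its solution is 3 (2 ^ j - 1).\<close>

lemma phase:
  assumes D: "T \<subseteq> D"
  shows "mw_inv n T (Suc j) {} X (\<lambda>q. 2 * A q + X q) k"
proof
  show low': "2 ^ Suc j \<le> X (p, v) + X (v, w) + X (w, p) + 3" if "(p, v, w) \<in> T" for p v w
    using high that D by blast
  show "Suc j * 2 ^ Suc j + 3 \<le> 2 * A (p, v) + X (p, v) + (2 * A (v, w) + X (v, w)) +
      (2 * A (w, p) + X (w, p)) + 3 * 2 ^ Suc j" if T: "(p, v, w) \<in> T" for p v w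
    using low'[OF T] acc[OF T] by (simp add: algebra_simps)
  show "2 * A q + X q \<le> Suc j * 2 ^ Suc j" for q
    using X_less[of q] A_le[of q] by simp
  have s: "(\<Sum>q\<in>pairs n. 2 * A q + X q) = 2 * sum A (pairs n) + sum X (pairs n)"
    by (simp add: sum.distrib sum_distrib_left)
  show "(\<Sum>q\<in>pairs n. 2 * A q + X q) + sum X (pairs n) \<le> 2 ^ Suc (Suc j) * sum k M"
    if "M \<subseteq> pairs n" "covers M T" for M
    using pot[OF that] unfolding s by simp
  show "k q \<le> Suc (Suc j)" for q using k_le[of q] by simp
qed (use X_eq in auto)

lemma final:
  assumes "M \<subseteq> pairs n" "covers M T"
  shows "sum A (pairs n) \<le> 2 ^ Suc j * (Suc j * card M)"
proof -
  have "sum k M \<le> Suc j * card M"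
    using sum_bounded_above[of M k "Suc j"] k_le by (simp add: mult.commute)
  then have "2 ^ Suc j * sum k M \<le> 2 ^ Suc j * (Suc j * card M)" by (rule mult_le_mono2)
  with pot[OF assms] show ?thesis by linarith
qed

lemma fractional_cover: "(p, v, w) \<in> T \<Longrightarrow> (j - 3) * 2 ^ j \<le> A (p, v) + A (v, w) + A (w, p)"
  using acc[of p v w] by (simp add: diff_mult_distrib)

end

lemma mw_inv_0: "mw_inv n T 0 {} (\<lambda>q. 0) (\<lambda>q. 0) (\<lambda>q. 0)"
  by unfold_locales auto

text \<open>If two of the vertices coincide, one pair is a loop and the other two are one pair in
  both orientations, so the number of adjacent pairs is odd.\<close>

lemma bad_triples_distinct:
  assumes "(p, v, w) \<in> bad_triples n a" and "\<And>u v. u < n \<Longrightarrow> v < n \<Longrightarrow> a u v = a v u" "\<And>u. u < n \<Longrightarrow> a u u"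
  shows "p \<noteq> v" "v \<noteq> w" "p \<noteq> w"
  using assms by (auto simp: bad_triples_def of_bool_def split: if_splits)

lemma sum_fun_upd:
  assumes "finite I" "i \<in> I"
  shows "sum (f(i := y)) I + f i = sum f I + (y :: nat)"
proof -
  have "sum (f(i := y)) I = y + sum f (I - {i})"
    using assms by (simp add: sum.remove)
  moreover have "sum f I = f i + sum f (I - {i})"
    using assms by (simp add: sum.remove)
  ultimately show ?thesis by simp
qed

text \<open>By \<open>low\<close>, a single doubling lifts the sum of the three powers to at least
  \<open>2 ^ Suc j\<close>. Weights never decrease, so triples processed earlier stay above the
  threshold and a phase is one pass. Distinct vertices make the three pairs separate
  entries.\<close>

lemma mw_inv_step:
  assumes "mw_inv n T j D X A k" and T: "(p, v, w) \<in> T"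
    and lt: "p < n" "v < n" "w < n" and dist: "p \<noteq> v" "v \<noteq> w" "p \<noteq> w"
    and small: "X (p, v) + X (v, w) + X (w, p) + 3 < 2 ^ Suc j"
  shows "\<exists>k'. mw_inv n T j (insert (p, v, w) D)
    (X((p, v) := 2 * X (p, v) + 1, (v, w) := 2 * X (v, w) + 1, (w, p) := 2 * X (w, p) + 1)) A k'"
    (is "\<exists>k'. mw_inv n T j _ ?X A k'")
proof -
  interpret mw_inv n T j D X A k by fact
  let ?Q = "{(p, v), (v, w), (w, p)}"
  have X: "?X q = (if q \<in> ?Q then 2 * X q + 1 else X q)" for q
    using dist by auto
  have mono: "X q \<le> ?X q" for q
    unfolding X by (simp split: if_split)
  have mono3: "X q1 + X q2 + X q3 + 3 \<le> ?X q1 + ?X q2 + ?X q3 + 3" for q1 q2 q3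
    by (intro add_mono mono order_refl)
  define k' where "k' = (\<lambda>q. if q \<in> ?Q then Suc (k q) else k q)"
  \<comment> \<open>Each power in a light triple is below \<open>2 ^ Suc j\<close> on its own, which
    leaves room for one more increment within \<open>k_le\<close>.\<close>
  have kQ: "k q < Suc j" if "q \<in> ?Q" for q
  proof -
    have "X q \<le> X (p, v) + X (v, w) + X (w, p)" using that by auto
    then have "2 ^ k q < (2::nat) ^ Suc j" using small unfolding X_eq[symmetric] by linarith
    then show ?thesis by (rule power_less_imp_less_exp[rotated]) simp
  qed
  have k'1: "?X q + 1 = 2 ^ k' q" "k' q \<le> Suc j" for q
  proof -
    have "2 * X q + 1 + 1 = 2 * (X q + 1)" by simp
    also have "\<dots> = 2 ^ Suc (k q)" unfolding X_eq by simp
    finally show "?X q + 1 = 2 ^ k' q" unfolding X k'_def using X_eq[of q]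
      by (cases "q \<in> ?Q") simp_all
    show "k' q \<le> Suc j" using k_le[of q] kQ[of q] unfolding k'_def by (simp add: Suc_le_eq)
  qed
  have sumX: "sum ?X (pairs n) = sum X (pairs n) + (X (p, v) + X (v, w) + X (w, p) + 3)"
  proof -
    let ?X1 = "X((p, v) := 2 * X (p, v) + 1)"
    let ?X2 = "?X1((v, w) := 2 * X (v, w) + 1)"
    have arith: "s3 = s0 + (x + y + z + 3)"
      if "s1 + x = s0 + (2 * x + 1)" "s2 + y = s1 + (2 * y + 1)" "s3 + z = s2 + (2 * z + 1)"
      for s0 s1 s2 s3 x y z :: nat
      using that by linarith
    have 1: "sum ?X1 (pairs n) + X (p, v) = sum X (pairs n) + (2 * X (p, v) + 1)"
      by (rule sum_fun_upd) (use lt in auto)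
    have 2: "sum ?X2 (pairs n) + ?X1 (v, w) = sum ?X1 (pairs n) + (2 * X (v, w) + 1)"
      by (rule sum_fun_upd) (use lt in auto)
    have 3: "sum ?X (pairs n) + ?X2 (w, p) = sum ?X2 (pairs n) + (2 * X (w, p) + 1)"
      by (rule sum_fun_upd) (use lt in auto)
    have 4: "?X1 (v, w) = X (v, w)" "?X2 (w, p) = X (w, p)"
      using dist by auto
    show ?thesis by (rule arith[OF 1 2[unfolded 4] 3[unfolded 4]])
  qed
  have pot': "sum A (pairs n) + sum ?X (pairs n) \<le> 2 ^ Suc j * sum k' M"
    if M: "M \<subseteq> pairs n" "covers M T" for M
  proof -
    have fin: "finite M" using M(1) by (rule finite_subset) simp
    obtain q where q: "q \<in> ?Q" "q \<in> M" using M(2) T unfolding covers_def by blast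
    have "sum k M + 1 \<le> sum k' M"
    proof -
      have "sum k M = k q + sum k (M - {q})" using fin q(2) by (rule sum.remove)
      moreover have "sum k' M = k' q + sum k' (M - {q})" using fin q(2) by (rule sum.remove)
      moreover have "sum k (M - {q}) \<le> sum k' (M - {q})" by (rule sum_mono) (auto simp: k'_def)
      moreover have "k' q = Suc (k q)" using q by (simp add: k'_def)
      ultimately show ?thesis by simp
    qed
    then have "2 ^ Suc j * (sum k M + 1) \<le> 2 ^ Suc j * sum k' M" by (rule mult_le_mono2)
    then show ?thesis using pot[OF M] sumX small by (simp add: algebra_simps)
  qed
  have new: "2 ^ Suc j \<le> ?X (p, v) + ?X (v, w) + ?X (w, p) + 3"
  proof -
    have "?X (p, v) = 2 * X (p, v) + 1" "?X (v, w) = 2 * X (v, w) + 1" "?X (w, p) = 2 * X (w, p) + 1"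
      unfolding X by simp_all
    then show ?thesis using low[OF T] by (simp only: power_Suc)
  qed
  have high': "2 ^ Suc j \<le> ?X (p', v') + ?X (v', w') + ?X (w', p') + 3"
    if "(p', v', w') \<in> T \<inter> insert (p, v, w) D" for p' v' w'
  proof (cases "(p', v', w') = (p, v, w)")
    case True
    then have "p' = p" "v' = v" "w' = w" by simp_all
    then show ?thesis using new by (simp only:)
  next
    case False
    then have "(p', v', w') \<in> T \<inter> D" using that by blast
    show ?thesis by (rule order_trans[OF high[OF \<open>(p', v', w') \<in> T \<inter> D\<close>] mono3])
  qed
  have low': "2 ^ j \<le> ?X (p', v') + ?X (v', w') + ?X (w', p') + 3"
    if "(p', v', w') \<in> T" for p' v' w'
    by (rule order_trans[OF low[OF that] mono3])
  have "mw_inv n T j (insert (p, v, w) D) ?X A k'"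
    proof (rule mw_inv.intro)
  qed (fact low' acc high' A_le k'1 pot')+
  then show ?thesis by (rule exI[of _ k'])
qed

section \<open>Pivoting\<close>

definition bad_at :: "nat \<Rightarrow> (nat \<Rightarrow> nat \<Rightarrow> bool) \<Rightarrow> nat set \<Rightarrow> nat \<Rightarrow> (nat \<times> nat) set" where
  "bad_at n a R p = {(v, w). v \<in> R \<and> w \<in> R \<and> (p, v, w) \<in> bad_triples n a}"

lemma bad_at_subset: "bad_at n a R p \<subseteq> pairs n"
  by (auto simp: bad_at_def bad_triples_def)

lemma finite_bad_at [simp]: "finite (bad_at n a R p)"
  by (rule finite_subset[OF bad_at_subset]) simp

text \<open>Bad triples are closed under rotation, so averaging over all pivots charges every triple
  with the total weight of its three pairs.\<close>

lemma good_pivot_exists: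
  assumes R: "R \<subseteq> {..<n}" "R \<noteq> {}"
    and S: "\<And>p v w. (p, v, w) \<in> bad_triples n a \<Longrightarrow> S \<le> A (p, v) + A (v, w) + A (w, p)"
  shows "\<exists>p\<in>R. S * card (bad_at n a R p) \<le> (\<Sum>q\<in>bad_at n a R p. 3 * A q)"
proof (rule ccontr)
  assume "\<not> ?thesis"
  then have less: "(\<Sum>q\<in>bad_at n a R p. 3 * A q) < S * card (bad_at n a R p)" if "p \<in> R" for p
    using that by auto
  have fin: "finite R" using R(1) by (rule finite_subset) simp
  let ?B = "Sigma R (bad_at n a R)"
  let ?rot = "\<lambda>(p, v, w). (v, w, p)"
  have bij: "bij_betw ?rot ?B ?B"
    by (rule bij_betw_byWitness[where f' = "\<lambda>(v, w, p). (p, v, w)"])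
      (auto simp: bad_at_def bad_triples_def add_ac)
  have 1: "(\<Sum>(p, v, w)\<in>?B. A (v, w)) = (\<Sum>(p, v, w)\<in>?B. A (w, p))"
    using sum.reindex_bij_betw[OF bij, of "\<lambda>(p, v, w). A (v, w)"] by (simp add: case_prod_unfold)
  have 2: "(\<Sum>(p, v, w)\<in>?B. A (w, p)) = (\<Sum>(p, v, w)\<in>?B. A (p, v))"
    using sum.reindex_bij_betw[OF bij, of "\<lambda>(p, v, w). A (w, p)"] by (simp add: case_prod_unfold)
  have "(\<Sum>p\<in>R. \<Sum>q\<in>bad_at n a R p. 3 * A q) < (\<Sum>p\<in>R. S * card (bad_at n a R p))"
    by (rule sum_strict_mono) (use fin R less in auto)
  also have "\<dots> = S * card ?B"
    using fin by (simp add: sum_distrib_left)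
  also have "\<dots> = (\<Sum>t\<in>?B. S)" by simp
  also have "\<dots> \<le> (\<Sum>(p, v, w)\<in>?B. A (p, v) + A (v, w) + A (w, p))"
    by (rule sum_mono) (use S in \<open>auto simp: bad_at_def\<close>)
  also have "\<dots> = (\<Sum>(p, v, w)\<in>?B. A (p, v)) + (\<Sum>(p, v, w)\<in>?B. A (v, w)) + (\<Sum>(p, v, w)\<in>?B. A (w, p))"
    by (simp add: sum.distrib case_prod_unfold)
  also have "\<dots> = (\<Sum>(p, v, w)\<in>?B. 3 * A (v, w))"
    using 1 2 by (simp add: sum_distrib_left[symmetric] case_prod_unfold)
  also have "\<dots> = (\<Sum>p\<in>R. \<Sum>q\<in>bad_at n a R p. 3 * A q)"
    using fin by (simp add: sum.Sigma case_prod_unfold)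
  finally show False by simp
qed

text \<open>A pair with a single assigned endpoint is settled too: later clusters get new labels, so
  its ends stay apart.\<close>

definition decided :: "nat \<Rightarrow> (nat \<Rightarrow> nat) \<Rightarrow> (nat \<times> nat) set" where
  "decided n l = {(u, v). u < n \<and> v < n \<and> (l u \<noteq> 0 \<or> l v \<noteq> 0)}"

text \<open>The label \<open>Suc p\<close> marks the cluster of the pivot \<open>p\<close>, and \<open>0\<close> an unassigned vertex.\<close>

definition pivot_inv :: "nat \<Rightarrow> (nat \<Rightarrow> nat \<Rightarrow> bool) \<Rightarrow> nat \<Rightarrow> (nat \<times> nat \<Rightarrow> nat) \<Rightarrow> (nat \<Rightarrow> nat) \<Rightarrow> bool" where
  "pivot_inv n a S A l \<longleftrightarrow>
    (\<forall>u<n. \<forall>p. l u = Suc p \<longrightarrow> p < n \<and> a p u \<and> l p = Suc p) \<and>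
    (\<forall>u<n. \<forall>v<n. (\<forall>p<n. a p u = a p v) \<longrightarrow> l u = l v) \<and>
    S * card {(u, v) \<in> decided n l. a u v \<noteq> (l u = l v)} \<le> (\<Sum>q\<in>decided n l. 3 * A q)"

lemma pivot_inv_0: "pivot_inv n a S A (\<lambda>u. 0)"
  by (simp add: pivot_inv_def decided_def)

lemma decided_subset: "decided n l \<subseteq> pairs n"
  by (auto simp: decided_def)

text \<open>A pair that becomes violated forms a bad triple with the pivot, and all pairs of
  \<open>bad_at\<close> become decided at this moment, so both sides of the budget grow by the two
  sides of \<open>good\<close>. Vertices with equal neighbourhoods are taken or left together; this
  clause later serves the friendly pairs.\<close>

lemma pivot_inv_step:
  assumes inv: "pivot_inv n a S A l"
    and sym: "\<And>u v. u < n \<Longrightarrow> v < n \<Longrightarrow> a u v = a v u" and refl: "\<And>u. u < n \<Longrightarrow> a u u"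
    and p: "p < n" "l p = 0"
    and good: "S * card (bad_at n a {u. u < n \<and> l u = 0} p) \<le>
      (\<Sum>q\<in>bad_at n a {u. u < n \<and> l u = 0} p. 3 * A q)"
  shows "pivot_inv n a S A (\<lambda>u. if l u = 0 \<and> a p u then Suc p else l u)" (is "pivot_inv n a S A ?l")
proof -
  let ?T = "bad_at n a {u. u < n \<and> l u = 0} p"
  let ?W = "\<lambda>l. {(u, v) \<in> decided n l. a u v \<noteq> (l u = l v)}"
  have old: "p' < n \<and> a p' u \<and> l p' = Suc p'" if "u < n" "l u = Suc p'" for u p'
    using inv that unfolding pivot_inv_def by blast
  \<comment> \<open>This is why the invariant records \<open>l p = Suc p\<close>: a vertex without
    label cannot be the pivot of an existing cluster.\<close>
  have fresh: "l u \<noteq> Suc p" if "u < n" for u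
    using old[OF that] p by auto
  have fin: "finite (decided n l)" for l
    by (rule finite_subset[OF decided_subset]) simp
  have W: "?W ?l \<subseteq> ?W l \<union> ?T"
  proof
    fix q assume q: "q \<in> ?W ?l"
    obtain u v where uv: "q = (u, v)" by (cases q)
    have lt: "u < n" "v < n" and d: "?l u \<noteq> 0 \<or> ?l v \<noteq> 0" and w: "a u v \<noteq> (?l u = ?l v)"
      using q uv by (auto simp: decided_def)
    show "q \<in> ?W l \<union> ?T"
    proof (cases "l u = 0 \<and> l v = 0")
      case True
      then have "q \<in> ?T"
        using w lt p sym[OF lt(2) p(1)] d unfolding uv
        by (auto simp: bad_at_def bad_triples_def split: if_splits)
      then show ?thesis ..
    next
      case False
      have "(?l u = ?l v) = (l u = l v)"
        using False fresh[OF lt(1)] fresh[OF lt(2)] by auto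
      then show ?thesis using False w lt uv by (auto simp: decided_def)
    qed
  qed
  have disj: "decided n l \<inter> ?T = {}"
    by (auto simp: decided_def bad_at_def)
  have D: "decided n l \<union> ?T \<subseteq> decided n ?l"
  proof -
    have "?T \<subseteq> decided n ?l"
      using sym[OF _ p(1)]
      by (auto simp: decided_def bad_at_def bad_triples_def of_bool_def split: if_splits)
    then show ?thesis by (auto simp: decided_def)
  qed
  have "S * card (?W ?l) \<le> S * (card (?W l) + card ?T)"
  proof (rule mult_le_mono2)
    have "finite (?W l)" by (rule finite_subset[OF _ fin[of l]]) blast
    then have "finite (?W l \<union> ?T)" by simp
    then have "card (?W ?l) \<le> card (?W l \<union> ?T)" using W by (rule card_mono)
    also have "\<dots> \<le> card (?W l) + card ?T" by (rule card_Un_le)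
    finally show "card (?W ?l) \<le> card (?W l) + card ?T" .
  qed
  also have "\<dots> \<le> (\<Sum>q\<in>decided n l. 3 * A q) + (\<Sum>q\<in>?T. 3 * A q)"
    using inv good unfolding pivot_inv_def by (simp add: add_mult_distrib2)
  also have "\<dots> = (\<Sum>q\<in>decided n l \<union> ?T. 3 * A q)"
    using disj fin by (simp add: sum.union_disjoint)
  also have "\<dots> \<le> (\<Sum>q\<in>decided n ?l. 3 * A q)"
    by (rule sum_mono2) (use D fin in auto)
  finally have 3: "S * card (?W ?l) \<le> (\<Sum>q\<in>decided n ?l. 3 * A q)" .
  have 2: "?l u = ?l v" if "u < n" "v < n" "\<forall>p<n. a p u = a p v" for u v
  proof -
    have "l u = l v" using inv that unfolding pivot_inv_def by blast
    moreover have "a p u = a p v" using that p by blast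
    ultimately show ?thesis by simp
  qed
  have 1: "p' < n \<and> a p' u \<and> ?l p' = Suc p'" if "u < n" "?l u = Suc p'" for u p'
  proof (cases "l u = 0 \<and> a p u")
    case True
    then show ?thesis using that p refl by simp
  next
    case False
    then have "l u = Suc p'" using that by (simp split: if_splits)
    then show ?thesis using old[OF that(1)] by simp
  qed
  show ?thesis
    unfolding pivot_inv_def using 1 2 3 by blast
qed

lemma pivot_inv_final:
  assumes inv: "pivot_inv n a S A l" and "\<And>u. u < n \<Longrightarrow> l u \<noteq> 0"
  shows "S * card {(u, v) \<in> pairs n. a u v \<noteq> (l u = l v)} \<le> 3 * sum A (pairs n)"
proof -
  have "decided n l = pairs n" using assms(2) by (auto simp: decided_def)
  then show ?thesis
    using inv unfolding pivot_inv_def by (simp add: sum_distrib_left)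
qed

section \<open>Rounding to blocks\<close>

definition same :: "nat set set \<Rightarrow> nat \<Rightarrow> nat \<Rightarrow> bool" where
  "same C u v \<longleftrightarrow> (\<exists>X\<in>C. u \<in> X \<and> v \<in> X)"

definition mismatch :: "nat \<Rightarrow> (nat \<Rightarrow> nat \<Rightarrow> bool) \<Rightarrow> (nat \<Rightarrow> nat \<Rightarrow> bool) \<Rightarrow> nat" where
  "mismatch n r r' = card {(u, v) \<in> pairs n. r u v \<noteq> r' u v}"

lemma finite_Collect_pairs [simp]: "finite {(u, v). u < (n::nat) \<and> v < (n::nat) \<and> P u v}"
  by (rule finite_subset[of _ "pairs n"]) auto

lemma mismatch_triangle: "mismatch n r r'' \<le> mismatch n r r' + mismatch n r' r''"
proof -
  have "mismatch n r r'' \<le> card ({(u, v) \<in> pairs n. r u v \<noteq> r' u v} \<union> {(u, v) \<in> pairs n. r' u v \<noteq> r'' u v})"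
    unfolding mismatch_def by (rule card_mono) auto
  also have "\<dots> \<le> mismatch n r r' + mismatch n r' r''"
    unfolding mismatch_def by (rule card_Un_le)
  finally show ?thesis .
qed

lemma card_ordered_pairs:
  assumes "S \<subseteq> [{..<n::nat}]\<^bsup>2\<^esup>"
  shows "card {(u, v) \<in> pairs n. {u, v} \<in> S} = 2 * card S"
proof -
  have fin: "finite S"
    by (rule finite_subset[OF assms]) (simp add: finite_imp_finite_nsets)
  let ?o = "\<lambda>e. {(u, v). {u, v} = e}"
  have o: "card (?o e) = 2 \<and> finite (?o e) \<and> ?o e \<subseteq> pairs n" if "e \<in> S" for e
  proof -
    have "e \<subseteq> {..<n}" "card e = 2" using that assms by (auto simp: nsets_def)
    then obtain x y where e: "e = {x, y}" "x \<noteq> y" "x < n" "y < n"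
      by (auto simp: card_2_iff)
    then have "?o e = {(x, y), (y, x)}" by (auto simp: doubleton_eq_iff)
    then show ?thesis using e by auto
  qed
  have "{(u, v) \<in> pairs n. {u, v} \<in> S} = (\<Union>e\<in>S. ?o e)"
    using o by fastforce
  also have "card \<dots> = (\<Sum>e\<in>S. card (?o e))"
    by (rule card_UN_disjoint) (use fin o in auto)
  also have "\<dots> = 2 * card S"
    using o by simp
  finally show ?thesis .
qed

text \<open>Adding the diagonal to the edges makes them agree with the reflexive relation
  \<open>same C\<close> there, so only proper pairs are counted, each in both orientations.\<close>

lemma clustering_cost_eq:
  assumes E: "E \<subseteq> [{..<n}]\<^bsup>2\<^esup>" and C: "partition_on {..<n} C"
  shows "2 * clustering_cost E C = mismatch n (\<lambda>u v. u = v \<or> {u, v} \<in> E) (same C)"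
proof -
  have sub: "X \<subseteq> {..<n}" if "X \<in> C" for X
    using C that by (auto simp: partition_on_def)
  have S: "sym_diff E (cluster_edges C) \<subseteq> [{..<n}]\<^bsup>2\<^esup>"
  proof -
    have "cluster_edges C \<subseteq> [{..<n}]\<^bsup>2\<^esup>"
      unfolding cluster_edges_def using sub nsets_mono by blast
    then show ?thesis using E by blast
  qed
  have edge: "{u, v} \<in> cluster_edges C \<longleftrightarrow> u \<noteq> v \<and> same C u v" for u v
  proof -
    have "{u, v} \<in> [X]\<^bsup>2\<^esup> \<longleftrightarrow> u \<noteq> v \<and> u \<in> X \<and> v \<in> X" for X
      by (auto simp: nsets_def card_insert_if split: if_splits)
    then show ?thesis unfolding cluster_edges_def same_def by blast
  qed
  have loop: "same C u u" if "u < n" for u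
    using C that unfolding partition_on_def same_def by blast
  have noloop: "{u, u} \<notin> E" for u
    using E by (auto simp: nsets_def)
  have "{(u, v) \<in> pairs n. {u, v} \<in> sym_diff E (cluster_edges C)} =
      {(u, v) \<in> pairs n. (u = v \<or> {u, v} \<in> E) \<noteq> same C u v}" (is "?A = ?B")
  proof (intro set_eqI)
    fix q :: "nat \<times> nat"
    obtain u v where q: "q = (u, v)" by (cases q)
    show "q \<in> ?A \<longleftrightarrow> q \<in> ?B"
      unfolding q using edge[of u v] loop[of u] noloop[of u] by (cases "u = v") auto
  qed
  then show ?thesis
    using card_ordered_pairs[OF S] by (simp add: clustering_cost_def mismatch_def)
qed

definition block :: "nat \<Rightarrow> (nat \<Rightarrow> nat) \<Rightarrow> nat \<Rightarrow> nat \<Rightarrow> (nat \<times> nat) set" where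
  "block n l x y = {(u, v) \<in> pairs n. l u = x \<and> l v = y}"

lemma finite_block [simp]: "finite (block n l x y)"
  by (simp add: block_def)

lemma mismatch_blocks:
  assumes l: "\<And>u. u < n \<Longrightarrow> l u < n"
  shows "mismatch n r r' = (\<Sum>(x, y)\<in>pairs n. card {(u, v) \<in> block n l x y. r u v \<noteq> r' u v})"
proof -
  have "{(u, v) \<in> pairs n. r u v \<noteq> r' u v} =
      (\<Union>q\<in>pairs n. {(u, v) \<in> block n l (fst q) (snd q). r u v \<noteq> r' u v})"
    using l by (auto simp: block_def)
  moreover have "card \<dots> = (\<Sum>q\<in>pairs n. card {(u, v) \<in> block n l (fst q) (snd q). r u v \<noteq> r' u v})"
  proof (rule card_UN_disjoint)
    show "\<forall>q\<in>pairs n. finite {(u, v). (u, v) \<in> block n l (fst q) (snd q) \<and> r u v \<noteq> r' u v}"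
      by (auto intro: finite_subset[OF _ finite_block])
  qed (auto simp: block_def)
  ultimately show ?thesis
    by (simp add: mismatch_def case_prod_unfold)
qed

text \<open>Here \<open>g\<close> counts the edges that survive the removal of hostile paths, \<open>k\<close> holds the given
  clustering on labels, and \<open>pot\<close> says that each removed edge inside a cluster is paid for by one
  between clusters.\<close>

lemma rounding_cost:
  fixes n :: nat and g :: "nat \<times> nat \<Rightarrow> nat" and l :: "nat \<Rightarrow> nat" and E :: "nat \<Rightarrow> nat \<Rightarrow> bool"
  defines "e \<equiv> \<lambda>(x, y). card {(u, v) \<in> block n l x y. E u v}"
  assumes l: "\<And>u. u < n \<Longrightarrow> l u < n"
    and E: "\<And>u v. E u v = E v u"
    and r: "\<And>u v. u < n \<Longrightarrow> v < n \<Longrightarrow> r u v \<longleftrightarrow> l u = l v \<or>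
      \<not> h (l u) (l v) \<and> card (block n l (l u) (l v)) < g (l u, l v) + g (l v, l u)"
    and c: "\<And>u v. u < n \<Longrightarrow> v < n \<Longrightarrow> c u v \<longleftrightarrow> k (l u) (l v)"
    and k: "\<And>x. k x x" "\<And>x y. k x y = k y x"
    and h: "\<And>u v. u < n \<Longrightarrow> v < n \<Longrightarrow> h (l u) (l v) \<Longrightarrow> \<not> c u v"
    and g: "\<And>q. q \<in> pairs n \<Longrightarrow> g q \<le> e q"
    and pot: "(\<Sum>q\<in>pairs n. (if k (fst q) (snd q) then 1 else - 1) * (int (e q) - int (g q))) \<le> 0"
  shows "2 * mismatch n (\<lambda>u v. u = v \<or> E u v) r + 13 * mismatch n r c
    \<le> 32 * mismatch n (\<lambda>u v. u = v \<or> E u v) c"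
proof -
  let ?E = "\<lambda>u v. u = v \<or> E u v"
  let ?s = "\<lambda>x y. (if k x y then 1 else - 1 :: int)"
  let ?d = "\<lambda>q. int (e q) - int (g q)"
  let ?m = "\<lambda>r r' x y. card {(u, v) \<in> block n l x y. r u v \<noteq> r' u v}"
  have e_swap: "e (x, y) = e (y, x)" for x y
  proof -
    have "bij_betw prod.swap {(u, v) \<in> block n l x y. E u v} {(u, v) \<in> block n l y x. E u v}"
      by (rule bij_betw_byWitness[where f' = prod.swap]) (auto simp: block_def E)
    then show ?thesis unfolding e_def by (simp add: bij_betw_same_card)
  qed
  \<comment> \<open>Two cases fix the constants. Let P be the number of pairs, F that of edges and G
    the survivors of both orientations. If the clustering keeps the block and rounding empties it, F
    = G = P requires weight 15 = 2 + 13 per removal. If both separate it, G = 0 requires 32 = 2 + 2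
    * 15.\<close>
  have local: "2 * int (?m ?E r x y) + 13 * int (?m r c x y) \<le>
      32 * int (?m ?E c x y) + 15 * (?s x y * (?d (x, y) + ?d (y, x)))"
    if q: "(x, y) \<in> pairs n" for x y
  proof (cases "block n l x y = {}")
    case True
    then have "e (x, y) = 0" "e (y, x) = 0"
      using e_swap[of x y] by (auto simp: e_def)
    then show ?thesis using True g[of "(x, y)"] g[of "(y, x)"] q by simp
  next
    case False
    then obtain u0 v0 where uv0: "u0 < n" "v0 < n" "l u0 = x" "l v0 = y"
      by (auto simp: block_def)
    have fin: "finite {(u, v). (u, v) \<in> block n l x y \<and> P u v}" for P
      by (rule finite_subset[OF _ finite_block[of n l x y]]) auto
    define P where "P = card (block n l x y)"
    have gs: "g (x, y) \<le> e (x, y)" "g (y, x) \<le> e (x, y)"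
      using g[of "(x, y)"] g[of "(y, x)"] q e_swap[of y x] by auto
    define R where "R = (x = y \<or> \<not> h x y \<and> P < g (x, y) + g (y, x))"
    have rR: "r u v = R" if "(u, v) \<in> block n l x y" for u v
      using r[of u v] that by (auto simp: R_def P_def block_def)
    have ck: "c u v = k x y" if "(u, v) \<in> block n l x y" for u v
      using c[of u v] that by (auto simp: block_def)
    have hk: "h x y \<Longrightarrow> \<not> k x y"
      using h[of u0 v0] c[of u0 v0] uv0 by auto
    have mrc: "?m r c x y = (if R = k x y then 0 else P)"
    proof -
      have "{(u, v) \<in> block n l x y. r u v \<noteq> c u v} = (if R = k x y then {} else block n l x y)"
        using rR ck by auto
      then show ?thesis by (simp add: P_def)
    qed
    have meq: "?m ?E f x y = (if b then P - F else F)"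
      if f: "\<And>u v. (u, v) \<in> block n l x y \<Longrightarrow> f u v = b" and F: "F = card {(u, v) \<in> block n l x y. ?E u v}"
      for f b F
    proof (cases b)
      case True
      have "{(u, v) \<in> block n l x y. ?E u v \<noteq> f u v} = block n l x y - {(u, v) \<in> block n l x y. ?E u v}"
        using f True by auto
      then show ?thesis
        using True by (simp add: P_def F card_Diff_subset[OF fin] subset_iff)
    next
      case False
      then have "{(u, v) \<in> block n l x y. ?E u v \<noteq> f u v} = {(u, v) \<in> block n l x y. ?E u v}"
        using f by auto
      then show ?thesis using False by (simp add: F)
    qed
    define F where "F = card {(u, v) \<in> block n l x y. ?E u v}"
    have FP: "F \<le> P" unfolding F_def P_def by (rule card_mono) auto
    have mEr: "?m ?E r x y = (if R then P - F else F)"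
      by (rule meq[OF rR F_def])
    have mEc: "?m ?E c x y = (if k x y then P - F else F)"
      by (rule meq[OF ck F_def])
    show ?thesis
    proof (cases "x = y")
      case True
      then show ?thesis
        unfolding mEr mEc mrc using k(1)[of x] gs FP by (simp add: R_def)
    next
      case False
      have "{(u, v) \<in> block n l x y. ?E u v} = {(u, v) \<in> block n l x y. E u v}"
        using False by (auto simp: block_def)
      then have F: "e (x, y) = F" by (simp add: e_def F_def)
      have "R \<longleftrightarrow> \<not> h x y \<and> P < g (x, y) + g (y, x)"
        using False by (simp add: R_def)
      then have "R \<Longrightarrow> int P < int (g (x, y)) + int (g (y, x))"
        and "k x y \<Longrightarrow> \<not> R \<Longrightarrow> int (g (x, y)) + int (g (y, x)) \<le> int P"
        using hk by linarith+
      then show ?thesis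
        unfolding mEr mEc mrc using gs FP F e_swap[of y x]
        by (cases "k x y"; cases R) (simp_all add: of_nat_diff)
    qed
  qed
  \<comment> \<open>The signs are symmetric, so the losses of the reversed orientation have the same
    signed total, and \<open>pot\<close> bounds both sums at once.\<close>
  have swap: "(\<Sum>(x, y)\<in>pairs n. ?s x y * ?d (y, x)) = (\<Sum>(x, y)\<in>pairs n. ?s x y * ?d (x, y))"
  proof -
    have "bij_betw prod.swap (pairs n) (pairs n)"
      by (rule bij_betw_byWitness[where f' = prod.swap]) auto
    from sum.reindex_bij_betw[OF this, of "\<lambda>(x, y). ?s x y * ?d (x, y)"]
    show ?thesis by (simp add: case_prod_unfold k(2) prod.swap_def)
  qed
  have blocks: "mismatch n r r' = (\<Sum>(x, y)\<in>pairs n. ?m r r' x y)" for r r'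
    by (rule mismatch_blocks) (rule l)
  have "int (2 * mismatch n ?E r + 13 * mismatch n r c) =
      (\<Sum>(x, y)\<in>pairs n. 2 * int (?m ?E r x y) + 13 * int (?m r c x y))"
    unfolding blocks by (simp add: sum.distrib sum_distrib_left case_prod_unfold)
  also have "\<dots> \<le> (\<Sum>(x, y)\<in>pairs n. 32 * int (?m ?E c x y) + 15 * (?s x y * (?d (x, y) + ?d (y, x))))"
    by (rule sum_mono) (use local in \<open>auto simp only: prod.case split: prod.split\<close>)
  also have "\<dots> = 32 * (\<Sum>(x, y)\<in>pairs n. int (?m ?E c x y)) +
      15 * ((\<Sum>(x, y)\<in>pairs n. ?s x y * ?d (x, y)) + (\<Sum>(x, y)\<in>pairs n. ?s x y * ?d (y, x)))"
    by (simp add: sum.distrib sum_distrib_left case_prod_unfold distrib_left)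
  also have "\<dots> \<le> 32 * (\<Sum>(x, y)\<in>pairs n. int (?m ?E c x y))"
    using pot unfolding swap by (simp add: case_prod_unfold)
  also have "\<dots> = int (32 * mismatch n ?E c)"
    unfolding blocks by (simp add: case_prod_unfold)
  finally show ?thesis by linarith
qed

section \<open>Reduction to unconstrained clustering\<close>

abbreviation plus_e (infixl "\<oplus>" 65) where "e1 \<oplus> e2 \<equiv> Op Add e1 e2"
abbreviation minus_e (infixl "\<ominus>" 65) where "e1 \<ominus> e2 \<equiv> Op Sub e1 e2"
abbreviation times_e (infixl "\<otimes>" 70) where "e1 \<otimes> e2 \<equiv> Op Mul e1 e2"
abbreviation less_e (infix "\<sqsubset>" 50) where "e1 \<sqsubset> e2 \<equiv> Op Less e1 e2"
abbreviation equal_e (infix "\<doteq>" 50) where "e1 \<doteq> e2 \<equiv> Op Equal e1 e2"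
abbreviation seq_c (infixr ";;" 40) where "c1 ;; c2 \<equiv> Seq c1 c2"
abbreviation When :: "expr \<Rightarrow> com \<Rightarrow> com" where "When e c \<equiv> If e c Skip"

definition init_labels :: com where
  "init_labels = For ''u'' (Write ''l'' (Var ''u'') (Var ''u''))"

definition relabel :: com where
  "relabel = For ''w'' (When (Read ''l'' (Var ''w'') \<doteq> Var ''x'') (Write ''l'' (Var ''w'') (Var ''y'')))"

text \<open>Every friendly pair triggers a linear relabelling of a whole class, which the cubic
  budget allows. The two labels are copied to \<open>x\<close> and \<open>y\<close> first, since the
  relabelling overwrites the entry of \<open>u\<close> itself.\<close>

definition merge_friends :: com where
  "merge_friends = For ''u'' (For ''v'' (When (At ''F'' (Var ''u'') (Var ''v''))
     (Assign ''x'' (Read ''l'' (Var ''u'')) ;; Assign ''y'' (Read ''l'' (Var ''v'')) ;; relabel)))"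

definition count_blocks :: com where
  "count_blocks = For ''u'' (For ''v''
     (Assign ''x'' (Read ''l'' (Var ''u'')) ;; Assign ''y'' (Read ''l'' (Var ''v'')) ;;
      Put ''c'' (Var ''x'') (Var ''y'') (At ''c'' (Var ''x'') (Var ''y'') \<oplus> Const 1) ;;
      Put ''g'' (Var ''x'') (Var ''y'') (At ''g'' (Var ''x'') (Var ''y'') \<oplus> At ''E'' (Var ''u'') (Var ''v'')) ;;
      When (At ''H'' (Var ''u'') (Var ''v'')) (Put ''h'' (Var ''x'') (Var ''y'') (Const 1))))"

text \<open>With truncated subtraction, \<open>a - (a - b)\<close> is the minimum of \<open>a\<close> and \<open>b\<close>.\<close>

definition cut_hostile :: com where
  "cut_hostile = For ''u'' (For ''v'' (For ''w'' (When (At ''h'' (Var ''u'') (Var ''w''))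
     (Assign ''m'' (At ''g'' (Var ''u'') (Var ''v'') \<ominus>
        (At ''g'' (Var ''u'') (Var ''v'') \<ominus> At ''g'' (Var ''v'') (Var ''w''))) ;;
      Put ''g'' (Var ''u'') (Var ''v'') (At ''g'' (Var ''u'') (Var ''v'') \<ominus> Var ''m'') ;;
      Put ''g'' (Var ''v'') (Var ''w'') (At ''g'' (Var ''v'') (Var ''w'') \<ominus> Var ''m'')))))"

text \<open>A sum stands for disjunction, a product for conjunction, and the outer comparison with 0
  normalises the result to 0 or 1. Majority is taken over both orientations together: a block with
  no survivor in one orientation can never pass.\<close>

definition round_blocks :: com where
  "round_blocks = For ''u'' (For ''v''
     (Assign ''x'' (Read ''l'' (Var ''u'')) ;; Assign ''y'' (Read ''l'' (Var ''v'')) ;;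
      Put ''a'' (Var ''u'') (Var ''v'') (Const 0 \<sqsubset> ((Var ''x'' \<doteq> Var ''y'') \<oplus>
        (At ''h'' (Var ''x'') (Var ''y'') \<doteq> Const 0) \<otimes>
        (At ''c'' (Var ''x'') (Var ''y'') \<sqsubset>
          At ''g'' (Var ''x'') (Var ''y'') \<oplus> At ''g'' (Var ''y'') (Var ''x''))))))"

definition friendly :: "nat \<Rightarrow> nat set set \<Rightarrow> (nat \<Rightarrow> nat \<Rightarrow> bool) \<Rightarrow> bool" where
  "friendly n F c \<longleftrightarrow> (\<forall>u<n. c u u) \<and> (\<forall>u<n. \<forall>v<n. c u v \<longrightarrow> c v u) \<and>
     (\<forall>u<n. \<forall>v<n. \<forall>w<n. c u v \<longrightarrow> c v w \<longrightarrow> c u w) \<and> (\<forall>u<n. \<forall>v<n. {u, v} \<in> F \<longrightarrow> c u v)"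

text \<open>Components without paths: processed friendly pairs share a label, and equal labels imply
  every equivalence relation that contains \<open>F\<close>, which is later applied to
  \<open>same C\<close>. Labels stay below \<open>n\<close> because they index matrices.\<close>

definition merged :: "nat \<Rightarrow> nat set set \<Rightarrow> (nat \<times> nat) set \<Rightarrow> (nat \<Rightarrow> nat) \<Rightarrow> bool" where
  "merged n F D l \<longleftrightarrow> (\<forall>u<n. l u < n) \<and> (\<forall>u v. (u, v) \<in> D \<longrightarrow> {u, v} \<in> F \<longrightarrow> l u = l v) \<and>
     (\<forall>c. friendly n F c \<longrightarrow> (\<forall>u<n. \<forall>v<n. l u = l v \<longrightarrow> c u v))"

lemma merged_step:
  assumes "merged n F D l" "u < n" "v < n" "{u, v} \<in> F" "D \<subseteq> pairs n"
    and l': "\<And>i. i < n \<Longrightarrow> l' i = (if l i = l u then l v else l i)"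
  shows "merged n F (insert (u, v) D) l'"
  unfolding merged_def
proof (intro conjI allI impI)
  show "l' i < n" if "i < n" for i
    using assms that by (auto simp: merged_def)
  show "l' i = l' j" if ij: "(i, j) \<in> insert (u, v) D" "{i, j} \<in> F" for i j
  proof (cases "(i, j) = (u, v)")
    case True
    then show ?thesis using l'[of u] l'[of v] assms(2,3) by auto
  next
    case False
    then have "(i, j) \<in> D" using ij(1) by blast
    moreover from this have "i < n" "j < n" using assms(5) by auto
    ultimately show ?thesis using assms(1) ij(2) l'[of i] l'[of j] by (simp add: merged_def)
  qed
  fix c i j assume c: "friendly n F c" and ij: "i < n" "j < n" "l' i = l' j"
  have old: "l i = l j \<Longrightarrow> i < n \<Longrightarrow> j < n \<Longrightarrow> c i j" for i j
    using assms(1) c unfolding merged_def by blast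
  have trans: "c i j \<Longrightarrow> c j k \<Longrightarrow> i < n \<Longrightarrow> j < n \<Longrightarrow> k < n \<Longrightarrow> c i k" for i j k
    using c unfolding friendly_def by blast
  have sym: "c i j \<Longrightarrow> i < n \<Longrightarrow> j < n \<Longrightarrow> c j i" for i j
    using c unfolding friendly_def by blast
  have uv: "c u v" using c assms(2-4) unfolding friendly_def by blast
  have near: "c i v" if "l i = l u" "i < n" for i
    using trans[OF old[OF that(1)] uv] that assms(2,3) by blast
  consider "l i = l j" | "l i = l u" "l j = l v" | "l i = l v" "l j = l u"
    using ij l' by (auto split: if_splits)
  then show "c i j"
  proof cases
    case 1
    then show ?thesis using old ij by blast
  next
    case 2
    show ?thesis
      using trans[OF near[OF 2(1) ij(1)] sym[OF old[OF 2(2)]]] ij assms(2,3) by blast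
  next
    case 3
    show ?thesis
      using trans[OF old[OF 3(1)] sym[OF near[OF 3(2) ij(2)]]] ij assms(2,3) by blast
  qed
qed

definition count_if :: "'a set \<Rightarrow> ('a \<Rightarrow> bool) \<Rightarrow> nat" where
  "count_if D P = card {q \<in> D. P q}"

lemma count_if_insert:
  assumes "finite D" "d \<notin> D"
  shows "count_if (insert d D) P = count_if D P + of_bool (P d)"
proof -
  have "{q \<in> insert d D. P q} = (if P d then insert d {q \<in> D. P q} else {q \<in> D. P q})" by auto
  then show ?thesis using assms by (simp add: count_if_def)
qed

text \<open>For a hostile pair \<open>(x, z)\<close> every valid clustering separates \<open>(x, y)\<close> or \<open>(y, z)\<close>, and the
  edges removed from that block pay for those removed from the other one.\<close>

definition cut_inv :: "nat \<Rightarrow> (nat \<times> nat \<Rightarrow> nat) \<Rightarrow> (nat \<times> nat \<Rightarrow> nat) \<Rightarrow> (nat \<times> nat \<times> nat) set \<Rightarrow>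
    (nat \<times> nat \<Rightarrow> nat) \<Rightarrow> bool" where
  "cut_inv n h e D g \<longleftrightarrow> (\<forall>q. g q \<le> e q) \<and>
     (\<forall>x y z. (x, y, z) \<in> D \<longrightarrow> h (x, z) \<noteq> 0 \<longrightarrow> g (x, y) = 0 \<or> g (y, z) = 0) \<and>
     (\<forall>k. (\<forall>x<n. \<forall>y<n. \<forall>z<n. h (x, z) \<noteq> 0 \<longrightarrow> \<not> (k x y \<and> k y z)) \<longrightarrow>
        (\<Sum>q\<in>pairs n. (if k (fst q) (snd q) then 1 else - 1) * (int (e q) - int (g q))) \<le> 0)"

text \<open>Subtracting the minimum empties one of the two entries, and an empty entry stays empty,
  so one pass in any order suffices. The signed sum changes by \<open>m\<close> times the sum of two
  signs, at least one of which is negative.\<close>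

lemma cut_inv_step:
  assumes inv: "cut_inv n h e D g" and x: "x < n" "y < n" "z < n" and h: "h (x, z) \<noteq> 0"
    and m: "m = min (g (x, y)) (g (y, z))"
    and g': "g' = g((x, y) := g (x, y) - m)"
    and g'': "g'' = g'((y, z) := g' (y, z) - m)"
  shows "cut_inv n h e (insert (x, y, z) D) g''"
  unfolding cut_inv_def
proof (intro conjI allI impI)
  have le: "g'' q \<le> g q" for q
    unfolding g'' g' by auto
  show "g'' q \<le> e q" for q
  proof -
    have "g q \<le> e q" by (rule inv[unfolded cut_inv_def, THEN conjunct1, THEN spec])
    with le[of q] show ?thesis by (rule le_trans)
  qed
  have new: "g'' (x, y) = 0 \<or> g'' (y, z) = 0"
    unfolding g'' g' m by (auto simp: min_def)
  have zero: "g'' q = 0" if "g q = 0" for q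
    using le[of q] that by simp
  show "g'' (x', y') = 0 \<or> g'' (y', z') = 0"
    if D: "(x', y', z') \<in> insert (x, y, z) D" and h': "h (x', z') \<noteq> 0" for x' y' z'
  proof (cases "(x', y', z') = (x, y, z)")
    case True
    then show ?thesis using new by simp
  next
    case False
    then have "(x', y', z') \<in> D" using D by blast
    then have "g (x', y') = 0 \<or> g (y', z') = 0" using inv[unfolded cut_inv_def, THEN conjunct2, THEN conjunct1, THEN spec, THEN spec, THEN spec] h'
      by simp
    then show ?thesis using zero[of "(x', y')"] zero[of "(y', z')"] by metis
  qed
  fix k :: "nat \<Rightarrow> nat \<Rightarrow> bool"
  let ?s = "\<lambda>q. if k (fst q) (snd q) then 1 else - 1 :: int"
  assume k: "\<forall>x<n. \<forall>y<n. \<forall>z<n. h (x, z) \<noteq> 0 \<longrightarrow> \<not> (k x y \<and> k y z)"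
  have change: "(\<Sum>q\<in>pairs n. ?s q * (int (e q) - int ((f(r := f r - d)) q))) =
      (\<Sum>q\<in>pairs n. ?s q * (int (e q) - int (f q))) + ?s r * int d"
    if "r \<in> pairs n" "d \<le> f r" for f :: "nat \<times> nat \<Rightarrow> nat" and r d
  proof -
    let ?f = "f(r := f r - d)"
    have arith: "a1 = a2 + d" if "a1 = b1 + c1" "a2 = b2 + c2" "c1 = c2" "b1 = b2 + d"
      for a1 a2 b1 b2 c1 c2 d :: int
      using that by simp
    show ?thesis
    proof (rule arith)
      show "(\<Sum>q\<in>pairs n. ?s q * (int (e q) - int (?f q))) =
          ?s r * (int (e r) - int (?f r)) + (\<Sum>q\<in>pairs n - {r}. ?s q * (int (e q) - int (?f q)))"
        by (rule sum.remove) (use that(1) in auto)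
      show "(\<Sum>q\<in>pairs n. ?s q * (int (e q) - int (f q))) =
          ?s r * (int (e r) - int (f r)) + (\<Sum>q\<in>pairs n - {r}. ?s q * (int (e q) - int (f q)))"
        by (rule sum.remove) (use that(1) in auto)
      show "(\<Sum>q\<in>pairs n - {r}. ?s q * (int (e q) - int (?f q))) =
          (\<Sum>q\<in>pairs n - {r}. ?s q * (int (e q) - int (f q)))"
        by (rule sum.cong) auto
      show "?s r * (int (e r) - int (?f r)) = ?s r * (int (e r) - int (f r)) + ?s r * int d"
        using that(2) by (simp add: of_nat_diff algebra_simps)
    qed
  qed
  have old: "(\<Sum>q\<in>pairs n. ?s q * (int (e q) - int (g q))) \<le> 0"
    by (rule inv[unfolded cut_inv_def, THEN conjunct2, THEN conjunct2, THEN spec, THEN mp, OF k])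
  have 1: "(\<Sum>q\<in>pairs n. ?s q * (int (e q) - int (g' q))) =
      (\<Sum>q\<in>pairs n. ?s q * (int (e q) - int (g q))) + ?s (x, y) * int m"
    unfolding g' by (rule change[of "(x, y)" m g]) (use x m in auto)
  have nk: "\<not> (k x y \<and> k y z)" using k x h by blast
  show "(\<Sum>q\<in>pairs n. ?s q * (int (e q) - int (g'' q))) \<le> 0"
  proof (cases "(y, z) = (x, y)")
    case True
    \<comment> \<open>Here all three labels coincide, so both updates hit the same entry, which the
      first has emptied. A hostile pair inside one component means an infeasible instance, but the
      program has to run on those as well.\<close>
    have "g'' = g'" using True unfolding g'' g' m by (auto simp: fun_eq_iff)
    then show ?thesis using 1 old nk True by auto
  next
    case False
    then have "m \<le> g' (y, z)" unfolding g' m by auto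
    then have "(\<Sum>q\<in>pairs n. ?s q * (int (e q) - int (g'' q))) =
        (\<Sum>q\<in>pairs n. ?s q * (int (e q) - int (g' q))) + ?s (y, z) * int m"
      unfolding g'' by (intro change[of "(y, z)" m g']) (use x in auto)
    then show ?thesis using 1 old nk by (auto split: if_splits)
  qed
qed

section \<open>Correctness of the reduction programs\<close>

locale instance_ram = ram +
  fixes E F H :: "nat set set"
  assumes N_ge: "2 ^ 70 * (n + 1) ^ 2 \<le> N"
begin

text \<open>All stored values are at most a constant or a constant times \<open>n * n\<close>. The
  largest such constant is \<open>153 * 2 ^ 51\<close>, with 153 = 3 * 51, in the weight totals of
  the pivots.\<close>

lemma square_le: "n * n \<le> N" "k \<le> 2 ^ 70 \<Longrightarrow> k \<le> N" "k \<le> 2 ^ 70 \<Longrightarrow> n * n * k \<le> N"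
proof -
  have *: "n * n * k \<le> N" if "k \<le> 2 ^ 70" for k
  proof -
    have "n * n * k \<le> (n + 1) ^ 2 * 2 ^ 70"
      by (rule mult_le_mono) (use that in \<open>auto simp: power2_eq_square\<close>)
    then show ?thesis using N_ge by (simp add: mult.commute)
  qed
  then show "k \<le> 2 ^ 70 \<Longrightarrow> n * n * k \<le> N" .
  show "n * n \<le> N" using *[of 1] by simp
  have "k * 1 \<le> 2 ^ 70 * (n + 1) ^ 2" if "k \<le> 2 ^ 70"
    by (rule mult_le_mono) (use that in auto)
  then show "k \<le> 2 ^ 70 \<Longrightarrow> k \<le> N" using N_ge by simp
qed

lemma runs_init_labels:
  assumes "ok s"
  shows "runs s init_labels (\<lambda>s'. \<forall>i<n. s' ''l'' i = i)"
  unfolding init_labels_def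
proof (rule runs_For[where I = "\<lambda>k s'. \<forall>i<k. s' ''l'' i = i"])
  fix k s'
  assume k: "k < n" "ok s'" "s' ''u'' 0 = k" "\<forall>i<k. s' ''l'' i = i"
  show "runs s' (Write ''l'' (Var ''u'') (Var ''u''))
    (\<lambda>s''. \<forall>i<Suc k. update s'' ''u'' 0 (Suc k) ''l'' i = i)"
    by (rule runs_Write) (use k okD[OF k(2)] in \<open>auto simp: max_weight_def less_Suc_eq\<close>)
qed (use assms in auto)

lemma runs_relabel:
  assumes "ok s"
  shows "runs s relabel (\<lambda>s'. \<forall>i<n. s' ''l'' i = (if s ''l'' i = s ''x'' 0 then s ''y'' 0 else s ''l'' i))"
  unfolding relabel_def
proof (rule runs_conseq)
  let ?I = "\<lambda>k s'. \<forall>i. s' ''l'' i = (if i < k \<and> s ''l'' i = s ''x'' 0 then s ''y'' 0 else s ''l'' i)"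
  show "runs s (For ''w'' (When (Read ''l'' (Var ''w'') \<doteq> Var ''x'') (Write ''l'' (Var ''w'') (Var ''y'')))) (?I n)"
  proof (rule runs_For[where I = ?I])
    fix k s'
    assume k: "k < n" "ok s'" "s' ''w'' 0 = k" "?I k s'"
      and fr: "\<And>x. x \<notin> insert ''w'' (wvars (When (Read ''l'' (Var ''w'') \<doteq> Var ''x'')
        (Write ''l'' (Var ''w'') (Var ''y'')))) \<Longrightarrow> s' x = s x"
    have xy: "s' ''x'' = s ''x''" "s' ''y'' = s ''y''" using fr by auto
    show "runs s' (When (Read ''l'' (Var ''w'') \<doteq> Var ''x'') (Write ''l'' (Var ''w'') (Var ''y'')))
      (\<lambda>s''. ?I (Suc k) (update s'' ''w'' 0 (Suc k)))"
      by (intro runs_If runs_Write runs_Skip)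
        (use k xy okD[OF k(2)] okD[OF assms] in \<open>auto simp: max_weight_def less_Suc_eq\<close>)
  qed (use assms in auto)
qed auto

lemma runs_merge_friends:
  assumes "ok s" and "\<forall>i<n. s ''l'' i = i" and "s ''F'' = adjacency n F"
  shows "runs s merge_friends (\<lambda>s'. merged n F (pairs n) (s' ''l''))"
  unfolding merge_friends_def
proof (rule runs_For2[where I = "\<lambda>D s'. merged n F D (s' ''l'')"])
  show "merged n F {} (s ''l'')"
    using assms(2) by (auto simp: merged_def friendly_def)
  let ?c = "When (At ''F'' (Var ''u'') (Var ''v''))
    (Assign ''x'' (Read ''l'' (Var ''u'')) ;; Assign ''y'' (Read ''l'' (Var ''v'')) ;; relabel)"
  fix D i j s'
  assume ij: "i < n" "j < n" "D \<subseteq> pairs n" and s': "ok s'" "s' ''u'' 0 = i" "s' ''v'' 0 = j"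
    and fr: "\<And>x. x \<notin> {''u'', ''v''} \<union> wvars ?c \<Longrightarrow> s' x = s x"
    and I: "merged n F D (s' ''l'')"
  have F: "s' ''F'' = adjacency n F" using fr assms(3) by (auto simp: relabel_def)
  show "runs s' ?c (\<lambda>s''. merged n F (insert (i, j) D) (s'' ''l''))"
  proof (rule runs_If[OF s'(1)])
    show "ec (At ''F'' (Var ''u'') (Var ''v'')) < max_weight" by (simp add: max_weight_def)
    assume "val s' (At ''F'' (Var ''u'') (Var ''v'')) = 0"
    then have "{i, j} \<notin> F" using s' ij F by (simp add: okD adjacency_def split: if_splits)
    then show "runs s' Skip (\<lambda>s''. merged n F (insert (i, j) D) (s'' ''l''))"
      using I s' by (auto intro!: runs_Skip simp: merged_def)
  next
    assume "val s' (At ''F'' (Var ''u'') (Var ''v'')) \<noteq> 0"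
    then have F: "{i, j} \<in> F" using s' ij F by (simp add: okD adjacency_def split: if_splits)
    show "runs s' (Assign ''x'' (Read ''l'' (Var ''u'')) ;; Assign ''y'' (Read ''l'' (Var ''v'')) ;; relabel)
      (\<lambda>s''. merged n F (insert (i, j) D) (s'' ''l''))"
    proof (intro runs_Seq runs_Write)
      let ?s = "update (update s' ''x'' (val s' (Const 0)) (val s' (Read ''l'' (Var ''u'')))) ''y''
        (val (update s' ''x'' (val s' (Const 0)) (val s' (Read ''l'' (Var ''u'')))) (Const 0))
        (val (update s' ''x'' (val s' (Const 0)) (val s' (Read ''l'' (Var ''u''))))
          (Read ''l'' (Var ''v'')))"
      assume ok: "ok ?s"
      show "runs ?s relabel (\<lambda>s''. merged n F (insert (i, j) D) (s'' ''l''))"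
        by (rule runs_conseq[OF runs_relabel[OF ok]], rule merged_step[OF I ij(1,2) F ij(3)])
          (use s' in auto)
    qed (use s' okD[OF s'(1)] in \<open>auto simp: max_weight_def\<close>)
  qed
qed (use assms in \<open>auto simp: relabel_def\<close>)

end

context instance_ram
begin

lemma count_pairs_le: "D \<subseteq> pairs n \<Longrightarrow> count_if D P \<le> n * n"
proof -
  assume "D \<subseteq> pairs n"
  then have "{q \<in> D. P q} \<subseteq> pairs n" by blast
  then have "count_if D P \<le> card (pairs n)" unfolding count_if_def by (intro card_mono) simp_all
  then show ?thesis by simp
qed

definition counted :: "(nat \<Rightarrow> nat) \<Rightarrow> (nat \<times> nat) set \<Rightarrow> state \<Rightarrow> bool" where
  "counted l D s \<longleftrightarrow> (\<forall>x y.
     mat (s ''c'') (x, y) = count_if D (\<lambda>q. l (fst q) = x \<and> l (snd q) = y) \<and>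
     mat (s ''g'') (x, y) = count_if D (\<lambda>q. l (fst q) = x \<and> l (snd q) = y \<and> {fst q, snd q} \<in> E) \<and>
     mat (s ''h'') (x, y) = of_bool (\<exists>q \<in> D. l (fst q) = x \<and> l (snd q) = y \<and> {fst q, snd q} \<in> H))"

lemma runs_count_blocks:
  assumes "ok s" and l: "\<And>u. u < n \<Longrightarrow> s ''l'' u < n"
    and "s ''E'' = adjacency n E" "s ''H'' = adjacency n H"
    and "s ''c'' = (\<lambda>i. 0)" "s ''g'' = (\<lambda>i. 0)" "s ''h'' = (\<lambda>i. 0)"
  shows "runs s count_blocks (counted (s ''l'') (pairs n))"
  unfolding count_blocks_def
proof (rule runs_For2[where I = "counted (s ''l'')"])
  show "counted (s ''l'') {} s"
    using assms by (simp add: counted_def mat_zero count_if_def)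
  fix D i j s1
  let ?c = "Assign ''x'' (Read ''l'' (Var ''u'')) ;; Assign ''y'' (Read ''l'' (Var ''v'')) ;;
      Put ''c'' (Var ''x'') (Var ''y'') (At ''c'' (Var ''x'') (Var ''y'') \<oplus> Const 1) ;;
      Put ''g'' (Var ''x'') (Var ''y'') (At ''g'' (Var ''x'') (Var ''y'') \<oplus> At ''E'' (Var ''u'') (Var ''v'')) ;;
      When (At ''H'' (Var ''u'') (Var ''v'')) (Put ''h'' (Var ''x'') (Var ''y'') (Const 1))"
  assume ij: "i < n" "j < n" "(i, j) \<notin> D" "D \<subseteq> pairs n" and s1: "ok s1" "s1 ''u'' 0 = i" "s1 ''v'' 0 = j"
    and fr: "\<And>x. x \<notin> {''u'', ''v''} \<union> wvars ?c \<Longrightarrow> s1 x = s x"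
    and I: "counted (s ''l'') D s1"
  define l where "l = s ''l''"
  have s1l: "s1 ''l'' = l" "s1 ''E'' = adjacency n E" "s1 ''H'' = adjacency n H"
    using fr assms by (auto simp: l_def)
  have lij: "l i < n" "l j < n" using l ij by (auto simp: l_def)
  have fin: "finite D" using ij(4) by (rule finite_subset) simp
  note n = okD(1)[OF s1(1)]
  have c: "s1 ''c'' (l i * n + l j) = count_if D (\<lambda>q. l (fst q) = l i \<and> l (snd q) = l j)"
    and g: "s1 ''g'' (l i * n + l j) = count_if D (\<lambda>q. l (fst q) = l i \<and> l (snd q) = l j \<and> {fst q, snd q} \<in> E)"
    using I lij by (auto simp: mat_read counted_def l_def)
  have N: "n * n + 1 \<le> N"
    using square_le(3)[of 2] square_le(2)[of 2] by (cases n) auto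
  have "count_if D (\<lambda>q. l (fst q) = l i \<and> l (snd q) = l j) + 1 \<le> N"
    using count_pairs_le[OF ij(4)] N order_trans by (meson add_le_mono1)
  moreover have "count_if D (\<lambda>q. l (fst q) = l i \<and> l (snd q) = l j \<and> {fst q, snd q} \<in> E) + of_bool b \<le> N" for b
  proof -
    have "count_if D (\<lambda>q. l (fst q) = l i \<and> l (snd q) = l j \<and> {fst q, snd q} \<in> E) + of_bool b \<le> n * n + 1"
      by (intro add_mono count_pairs_le[OF ij(4)]) simp
    then show ?thesis using N by (rule order_trans)
  qed
  moreover have "1 \<le> N" using square_le(2)[of 1] by simp
  moreover have E: "adjacency n E (i * n + j) = of_bool ({i, j} \<in> E)"
    and H: "adjacency n H (i * n + j) = of_bool ({i, j} \<in> H)"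
    using ij by (auto simp: adjacency_def)
  ultimately have bounds: "s1 ''c'' (l i * n + l j) + 1 \<le> N"
    "s1 ''g'' (l i * n + l j) + adjacency n E (i * n + j) \<le> N" "1 \<le> N"
    unfolding c g E by blast+
  have post: "counted l (insert (i, j) D) s2"
    if "mat (s2 ''c'') = (mat (s1 ''c''))((l i, l j) := s1 ''c'' (l i * n + l j) + 1)"
      "mat (s2 ''g'') = (mat (s1 ''g''))((l i, l j) := s1 ''g'' (l i * n + l j) + of_bool ({i, j} \<in> E))"
      "mat (s2 ''h'') = (if {i, j} \<in> H then (mat (s1 ''h''))((l i, l j) := 1) else mat (s1 ''h''))" for s2
  proof -
    have "mat (s1 ''c'') (x, y) = count_if D (\<lambda>q. l (fst q) = x \<and> l (snd q) = y)"
      "mat (s1 ''g'') (x, y) = count_if D (\<lambda>q. l (fst q) = x \<and> l (snd q) = y \<and> {fst q, snd q} \<in> E)"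
      "mat (s1 ''h'') (x, y) = of_bool (\<exists>q \<in> D. l (fst q) = x \<and> l (snd q) = y \<and> {fst q, snd q} \<in> H)"
      for x y
      using I unfolding counted_def l_def[symmetric] by blast+
    then show ?thesis
      unfolding counted_def that c g by (auto simp: count_if_insert[OF fin ij(3)])
  qed
  have "runs s1 ?c (counted l (insert (i, j) D))"
    by (intro runs_Seq runs_Write runs_If runs_Skip post)
      (use s1 s1l n okD(2)[OF s1(1)] bounds lij E H in
        \<open>auto simp: max_weight_def mat_update fun_upd_def[symmetric]\<close>)
  then show "runs s1 ?c (counted (s ''l'') (insert (i, j) D))"
    unfolding l_def .
qed (use assms in \<open>auto simp: counted_def\<close>)


abbreviation triples :: "(nat \<times> nat \<times> nat) set" where
  "triples \<equiv> {..<n} \<times> {..<n} \<times> {..<n}"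

lemma runs_cut_hostile:
  assumes "ok s"
  shows "runs s cut_hostile (\<lambda>s'. cut_inv n (mat (s ''h'')) (mat (s ''g'')) triples (mat (s' ''g'')))"
  unfolding cut_hostile_def
proof (rule runs_For3[where I = "\<lambda>D s'. cut_inv n (mat (s ''h'')) (mat (s ''g'')) D (mat (s' ''g''))"])
  show "cut_inv n (mat (s ''h'')) (mat (s ''g'')) {} (mat (s ''g''))"
    by (simp add: cut_inv_def)
  let ?b = "Assign ''m'' (At ''g'' (Var ''u'') (Var ''v'') \<ominus>
        (At ''g'' (Var ''u'') (Var ''v'') \<ominus> At ''g'' (Var ''v'') (Var ''w''))) ;;
      Put ''g'' (Var ''u'') (Var ''v'') (At ''g'' (Var ''u'') (Var ''v'') \<ominus> Var ''m'') ;;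
      Put ''g'' (Var ''v'') (Var ''w'') (At ''g'' (Var ''v'') (Var ''w'') \<ominus> Var ''m'')"
  let ?c = "When (At ''h'' (Var ''u'') (Var ''w'')) (?b)"
  fix D i j k s1
  assume ijk: "i < n" "j < n" "k < n" and s1: "ok s1" "s1 ''u'' 0 = i" "s1 ''v'' 0 = j" "s1 ''w'' 0 = k"
    and fr: "\<And>x. x \<notin> {''u'', ''v'', ''w''} \<union> wvars ?c \<Longrightarrow> s1 x = s x"
    and I: "cut_inv n (mat (s ''h'')) (mat (s ''g'')) D (mat (s1 ''g''))"
  let ?I = "\<lambda>s2. cut_inv n (mat (s ''h'')) (mat (s ''g'')) (insert (i, j, k) D) (mat (s2 ''g''))"
  have h: "s1 ''h'' = s ''h''" using fr by auto
  have le: "s1 ''g'' q \<le> N" for q using okD(2)[OF s1(1)] .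
  note n = okD(1)[OF s1(1)]
  show "runs s1 ?c ?I"
  proof (rule runs_If[OF s1(1)])
    show "ec (At ''h'' (Var ''u'') (Var ''w'')) < max_weight" by (simp add: max_weight_def)
    assume "val s1 (At ''h'' (Var ''u'') (Var ''w'')) = 0"
    then have "mat (s ''h'') (i, k) = 0" using s1 n h ijk by (simp add: mat_read)
    then have "?I s1" using I by (auto simp: cut_inv_def)
    then show "runs s1 Skip ?I" by (rule runs_Skip[OF s1(1)])
  next
    assume "val s1 (At ''h'' (Var ''u'') (Var ''w'')) \<noteq> 0"
    then have h0: "mat (s ''h'') (i, k) \<noteq> 0" using s1 n h ijk by (simp add: mat_read)
    define m where "m = min (mat (s1 ''g'') (i, j)) (mat (s1 ''g'') (j, k))"
    define g' where "g' = (s1 ''g'')(i * n + j := s1 ''g'' (i * n + j) - m)"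
    define g'' where "g'' = g'(j * n + k := g' (j * n + k) - m)"
    have m: "s1 ''g'' (i * n + j) - (s1 ''g'' (i * n + j) - s1 ''g'' (j * n + k)) = m"
      using ijk by (auto simp: m_def mat_read)
    have "cut_inv n (mat (s ''h'')) (mat (s ''g'')) (insert (i, j, k) D) (mat g'')"
    proof (rule cut_inv_step[OF I ijk h0 m_def])
      show "mat g' = (mat (s1 ''g''))((i, j) := mat (s1 ''g'') (i, j) - m)"
        using ijk by (simp add: g'_def mat_update mat_read)
      show "mat g'' = (mat g')((j, k) := mat g' (j, k) - m)"
        using ijk by (simp add: g''_def mat_update mat_read)
    qed
    moreover have "m \<le> N" "g' q \<le> N" for q
      using le[of q] le[of "i * n + j"] m unfolding g'_def by (auto simp: le_diff_conv)
    ultimately show "runs s1 (?b) ?I"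
      using s1 n m le
      by (intro runs_Seq runs_Write)
        (auto simp: max_weight_def g''_def[symmetric] g'_def[symmetric] le_diff_conv trans_le_add1)
  qed
qed (use assms in auto)

definition rounded :: "state \<Rightarrow> nat \<Rightarrow> nat \<Rightarrow> bool" where
  "rounded s u v \<longleftrightarrow> s ''l'' u = s ''l'' v \<or> mat (s ''h'') (s ''l'' u, s ''l'' v) = 0 \<and>
     mat (s ''c'') (s ''l'' u, s ''l'' v) <
       mat (s ''g'') (s ''l'' u, s ''l'' v) + mat (s ''g'') (s ''l'' v, s ''l'' u)"

lemma runs_round_blocks:
  assumes "ok s" and l: "\<And>u. u < n \<Longrightarrow> s ''l'' u < n"
  shows "runs s round_blocks (\<lambda>s'. \<forall>u<n. \<forall>v<n. mat (s' ''a'') (u, v) = of_bool (rounded s u v))"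
  unfolding round_blocks_def
proof (rule runs_conseq)
  let ?I = "\<lambda>D s'. \<forall>u v. (u, v) \<in> D \<longrightarrow> mat (s' ''a'') (u, v) = of_bool (rounded s u v)"
  let ?c = "Assign ''x'' (Read ''l'' (Var ''u'')) ;; Assign ''y'' (Read ''l'' (Var ''v'')) ;;
      Put ''a'' (Var ''u'') (Var ''v'') (Const 0 \<sqsubset> ((Var ''x'' \<doteq> Var ''y'') \<oplus>
        (At ''h'' (Var ''x'') (Var ''y'') \<doteq> Const 0) \<otimes>
        (At ''c'' (Var ''x'') (Var ''y'') \<sqsubset>
          At ''g'' (Var ''x'') (Var ''y'') \<oplus> At ''g'' (Var ''y'') (Var ''x''))))"
  show "runs s (For ''u'' (For ''v'' (?c))) (?I (pairs n))"
  proof (rule runs_For2[where I = ?I])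
    fix D i j s1
    assume ij: "i < n" "j < n" and s1: "ok s1" "s1 ''u'' 0 = i" "s1 ''v'' 0 = j"
      and fr: "\<And>x. x \<notin> {''u'', ''v''} \<union> wvars ?c \<Longrightarrow> s1 x = s x" and I: "?I D s1"
    have s1s: "s1 ''l'' = s ''l''" "s1 ''h'' = s ''h''" "s1 ''c'' = s ''c''" "s1 ''g'' = s ''g''"
      using fr by auto
    note n = okD(1)[OF s1(1)]
    have "1 \<le> N" using square_le(2)[of 1] by simp
    moreover have "\<And>x i. s x i \<le> N" using okD(2)[OF assms(1)] .
    ultimately show "runs s1 ?c (?I (insert (i, j) D))"
      using s1 s1s n l[OF ij(1)] l[OF ij(2)] ij I
      by (intro runs_Seq runs_Write)
        (auto simp: max_weight_def mat_update mat_read rounded_def)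
  qed (use assms in auto)
qed auto

end

section \<open>Computing the fractional cover\<close>

abbreviation Bad :: "string \<Rightarrow> string \<Rightarrow> string \<Rightarrow> expr" where
  "Bad u v w \<equiv> At ''a'' (Var u) (Var v) \<oplus> At ''a'' (Var v) (Var w) \<oplus> At ''a'' (Var w) (Var u) \<doteq> Const 2"

definition raise_weights :: com where
  "raise_weights = For ''u'' (For ''v'' (For ''w''
     (When (Bad ''u'' ''v'' ''w'' \<otimes> (At ''X'' (Var ''u'') (Var ''v'') \<oplus> At ''X'' (Var ''v'') (Var ''w'') \<oplus>
          At ''X'' (Var ''w'') (Var ''u'') \<oplus> Const 3 \<sqsubset> Var ''t''))
       (Put ''X'' (Var ''u'') (Var ''v'') (Const 2 \<otimes> At ''X'' (Var ''u'') (Var ''v'') \<oplus> Const 1) ;;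
        Put ''X'' (Var ''v'') (Var ''w'') (Const 2 \<otimes> At ''X'' (Var ''v'') (Var ''w'') \<oplus> Const 1) ;;
        Put ''X'' (Var ''w'') (Var ''u'') (Const 2 \<otimes> At ''X'' (Var ''w'') (Var ''u'') \<oplus> Const 1)))))"

definition add_weights :: com where
  "add_weights = For ''u'' (For ''v'' (Put ''A'' (Var ''u'') (Var ''v'')
     (Const 2 \<otimes> At ''A'' (Var ''u'') (Var ''v'') \<oplus> At ''X'' (Var ''u'') (Var ''v''))))"

text \<open>Doubling \<open>t\<close> at the start turns the scale \<open>2 ^ d\<close> of the
  finished phases into the threshold \<open>2 ^ Suc d\<close> of the current one.\<close>

definition phase :: com where
  "phase = (Assign ''t'' (Const 2 \<otimes> Var ''t'') ;; raise_weights ;; add_weights)"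

primrec repeat :: "nat \<Rightarrow> com \<Rightarrow> com" where
  "repeat 0 c = Skip"
| "repeat (Suc k) c = (c ;; repeat k c)"

text \<open>After \<open>j\<close> phases the accumulated weight of a bad triple is at least \<open>(j - 3) * 2 ^ j\<close>, and the
  total is at most \<open>2 ^ (j + 1) * (j + 1)\<close> times the size of an integral cover. For \<open>j = 51\<close> the
  ratio is \<open>2 * 52 / 48 = 13 / 6\<close>, exactly what the factor \<open>16 = 3 + 6 * 13 / 6\<close> allows.\<close>

definition cover_weights :: com where
  "cover_weights = (Assign ''t'' (Const 1) ;; repeat 51 phase)"

text \<open>At this point \<open>t\<close> is \<open>2 ^ 51\<close>, so \<open>S\<close> is the
  weight (51 - 3) * 2 ^ 51 that the cover guarantees for every bad triple. \<open>P\<close> and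
  \<open>Q\<close> hold the two sides of the averaging inequality, scaled so that comparing integers
  decides whether a pivot is good.\<close>

definition score_pivots :: com where
  "score_pivots = (Assign ''S'' (Const 48 \<otimes> Var ''t'') ;;
     For ''u'' (For ''v'' (For ''w'' (When (Bad ''u'' ''v'' ''w'')
       (Write ''P'' (Var ''u'') (Read ''P'' (Var ''u'') \<oplus> Const 3 \<otimes> At ''A'' (Var ''v'') (Var ''w'')) ;;
        Write ''Q'' (Var ''u'') (Read ''Q'' (Var ''u'') \<oplus> Var ''S''))))))"

lemma wvars_repeat: "wvars (repeat k c) \<subseteq> wvars c"
  by (induction k) auto

section \<open>Correctness of the cover and of the initial scores\<close>

context instance_ram
begin

definition relation_at :: "(nat \<Rightarrow> nat \<Rightarrow> bool) \<Rightarrow> state \<Rightarrow> bool" where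
  "relation_at r s \<longleftrightarrow> (\<forall>u<n. \<forall>v<n. mat (s ''a'') (u, v) = of_bool (r u v))"

lemma val_Bad:
  assumes "relation_at r s" "s ''n'' 0 = n" "s x 0 = i" "s y 0 = j" "s z 0 = k" "i < n" "j < n" "k < n"
  shows "val s (Bad x y z) = of_bool ((i, j, k) \<in> bad_triples n r)"
  using assms by (simp add: relation_at_def mat_read bad_triples_def)

lemma runs_raise_weights:
  assumes "ok s" and r: "relation_at r s"
    and sym: "\<And>u v. u < n \<Longrightarrow> v < n \<Longrightarrow> r u v = r v u" and refl: "\<And>u. u < n \<Longrightarrow> r u u"
    and t: "s ''t'' 0 = 2 ^ Suc d" "d \<le> 50"
    and inv: "mw_inv n (bad_triples n r) d {} (mat (s ''X'')) A k0"
  shows "runs s raise_weights (\<lambda>s'. \<exists>k. mw_inv n (bad_triples n r) d triples (mat (s' ''X'')) A k)"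
  unfolding raise_weights_def
proof (rule runs_For3[where I = "\<lambda>D s'. \<exists>k. mw_inv n (bad_triples n r) d D (mat (s' ''X'')) A k"])
  show "\<exists>k. mw_inv n (bad_triples n r) d {} (mat (s ''X'')) A k"
    by (rule exI[of _ k0]) (rule inv)
  let ?b = "Put ''X'' (Var ''u'') (Var ''v'') (Const 2 \<otimes> At ''X'' (Var ''u'') (Var ''v'') \<oplus> Const 1) ;;
        Put ''X'' (Var ''v'') (Var ''w'') (Const 2 \<otimes> At ''X'' (Var ''v'') (Var ''w'') \<oplus> Const 1) ;;
        Put ''X'' (Var ''w'') (Var ''u'') (Const 2 \<otimes> At ''X'' (Var ''w'') (Var ''u'') \<oplus> Const 1)"
  let ?x = "At ''X'' (Var ''u'') (Var ''v'') \<oplus> At ''X'' (Var ''v'') (Var ''w'') \<oplus>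
          At ''X'' (Var ''w'') (Var ''u'') \<oplus> Const 3 \<sqsubset> Var ''t''"
  let ?e = "Bad ''u'' ''v'' ''w'' \<otimes> (?x)"
  let ?c = "When (?e) (?b)"
  fix D i j k s1
  assume ijk: "i < n" "j < n" "k < n" and s1: "ok s1" "s1 ''u'' 0 = i" "s1 ''v'' 0 = j" "s1 ''w'' 0 = k"
    and fr: "\<And>x. x \<notin> {''u'', ''v'', ''w''} \<union> wvars ?c \<Longrightarrow> s1 x = s x"
    and I: "\<exists>k. mw_inv n (bad_triples n r) d D (mat (s1 ''X'')) A k"
  let ?I = "\<lambda>s2. \<exists>k'. mw_inv n (bad_triples n r) d (insert (i, j, k) D) (mat (s2 ''X'')) A k'"
  from I obtain k1 where k1: "mw_inv n (bad_triples n r) d D (mat (s1 ''X'')) A k1" ..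
  have s1s: "s1 ''a'' = s ''a''" "s1 ''t'' = s ''t''" using fr by auto
  have rel: "relation_at r s1" using r s1s by (simp add: relation_at_def)
  note n = okD(1)[OF s1(1)]
  let ?small = "mat (s1 ''X'') (i, j) + mat (s1 ''X'') (j, k) + mat (s1 ''X'') (k, i) + 3 < 2 ^ Suc d"
  have "val s1 (?x) = of_bool (?small)"
    using s1 n s1s t ijk by (simp add: mat_read)
  then have cond: "val s1 (?e) = of_bool ((i, j, k) \<in> bad_triples n r) * of_bool ?small"
    using val_Bad[OF rel n s1(2-4) ijk] by (simp only: val.simps apply_op.simps)
  show "runs s1 ?c ?I"
  proof (rule runs_If[OF s1(1)])
    show "ec (?e) < max_weight" by (simp add: max_weight_def)
    assume "val s1 (?e) = 0"
    then have "(i, j, k) \<in> bad_triples n r \<Longrightarrow> \<not> ?small" unfolding cond by simp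
    then have "mw_inv n (bad_triples n r) d (insert (i, j, k) D) (mat (s1 ''X'')) A k1"
      by (intro mw_inv.skip[OF k1]) (simp only: not_less)
    then have "?I s1" by (rule exI[of _ k1])
    then show "runs s1 Skip ?I" by (rule runs_Skip[OF s1(1)])
  next
    assume "val s1 (?e) \<noteq> 0"
    then have bad: "(i, j, k) \<in> bad_triples n r" and small: ?small unfolding cond by (auto split: if_splits)
    note dist = bad_triples_distinct[OF bad sym refl]
    define X where "X = mat (s1 ''X'')"
    have X: "2 * X q + 1 \<le> N" for q
    proof -
      have "X q < 2 ^ Suc d" using mw_inv.X_less[OF k1] by (simp add: X_def)
      moreover have "(2::nat) ^ Suc d \<le> 2 ^ 51" using t(2) by (intro power_increasing) auto
      ultimately have "2 * X q + 1 \<le> 2 ^ 70" by simp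
      then show ?thesis by (rule square_le(2))
    qed
    define f1 where "f1 = (s1 ''X'')(i * n + j := 2 * s1 ''X'' (i * n + j) + 1)"
    define f2 where "f2 = f1(j * n + k := 2 * f1 (j * n + k) + 1)"
    define f3 where "f3 = f2(k * n + i := 2 * f2 (k * n + i) + 1)"
    have f1: "mat f1 = X((i, j) := 2 * X (i, j) + 1)"
      using ijk by (simp add: f1_def mat_update mat_read X_def)
    have f2: "mat f2 = X((i, j) := 2 * X (i, j) + 1, (j, k) := 2 * X (j, k) + 1)"
      using ijk dist by (simp add: f2_def mat_update mat_read f1)
    have f3: "mat f3 = X((i, j) := 2 * X (i, j) + 1, (j, k) := 2 * X (j, k) + 1, (k, i) := 2 * X (k, i) + 1)"
      using ijk dist by (simp add: f3_def mat_update mat_read f2)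
    have step: "\<exists>k'. mw_inv n (bad_triples n r) d (insert (i, j, k) D) (mat f3) A k'"
      unfolding f3 X_def by (rule mw_inv_step[OF k1 bad ijk dist small])
    have b1: "2 * s1 ''X'' (i * n + j) + 1 \<le> N" "2 * f1 (j * n + k) + 1 \<le> N" "2 * f2 (k * n + i) + 1 \<le> N"
      using X ijk dist by (auto simp: mat_read f1 f2 X_def[symmetric])
    show "runs s1 (?b) ?I"
      by (intro runs_Seq runs_Write)
        (use s1 n b1 step in \<open>simp_all add: max_weight_def f3_def f2_def f1_def\<close>)
  qed
qed (use assms in auto)

lemma runs_add_weights:
  assumes "ok s" and bound: "\<And>q. 2 * mat (s ''A'') q + mat (s ''X'') q \<le> N"
  shows "runs s add_weights (\<lambda>s'. mat (s' ''A'') = (\<lambda>q. 2 * mat (s ''A'') q + mat (s ''X'') q))"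
  unfolding add_weights_def
proof (rule runs_conseq)
  let ?I = "\<lambda>D s'. \<forall>q. mat (s' ''A'') q = (if q \<in> D then 2 * mat (s ''A'') q + mat (s ''X'') q else mat (s ''A'') q)"
  let ?c = "Put ''A'' (Var ''u'') (Var ''v'')
     (Const 2 \<otimes> At ''A'' (Var ''u'') (Var ''v'') \<oplus> At ''X'' (Var ''u'') (Var ''v''))"
  show "runs s (For ''u'' (For ''v'' ?c)) (?I (pairs n))"
  proof (rule runs_For2[where I = ?I])
    fix D i j s1
    assume ij: "i < n" "j < n" "(i, j) \<notin> D" and s1: "ok s1" "s1 ''u'' 0 = i" "s1 ''v'' 0 = j"
      and fr: "\<And>x. x \<notin> {''u'', ''v''} \<union> wvars ?c \<Longrightarrow> s1 x = s x" and I: "?I D s1"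
    have X: "s1 ''X'' = s ''X''" using fr by auto
    have A: "mat (s1 ''A'') (i, j) = mat (s ''A'') (i, j)" using I ij(3) by simp
    note n = okD(1)[OF s1(1)]
    show "runs s1 ?c (?I (insert (i, j) D))"
      by (rule runs_Write)
        (use s1 n X A ij I bound in \<open>simp_all add: max_weight_def mat_read mat_update\<close>)
  qed (use assms in auto)
qed (auto simp: fun_eq_iff mat_def)

definition phase_inv :: "(nat \<Rightarrow> nat \<Rightarrow> bool) \<Rightarrow> nat \<Rightarrow> state \<Rightarrow> bool" where
  "phase_inv r d s \<longleftrightarrow> relation_at r s \<and> s ''t'' 0 = 2 ^ d \<and>
     (\<exists>k. mw_inv n (bad_triples n r) d {} (mat (s ''X'')) (mat (s ''A'')) k)"

lemma runs_phase:
  assumes ok: "ok s" and inv: "phase_inv r d s" and d: "d \<le> 50"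
    and sym: "\<And>u v. u < n \<Longrightarrow> v < n \<Longrightarrow> r u v = r v u" and refl: "\<And>u. u < n \<Longrightarrow> r u u"
  shows "runs s phase (phase_inv r (Suc d))"
  unfolding phase_def
proof (rule runs_Seq, rule runs_Write)
  let ?s = "update s ''t'' (val s (Const 0)) (val s (Const 2 \<otimes> Var ''t''))"
  let ?T = "bad_triples n r"
  from inv obtain k0 where k0: "mw_inv n ?T d {} (mat (s ''X'')) (mat (s ''A'')) k0"
    and r: "relation_at r s" and t: "s ''t'' 0 = 2 ^ d"
    unfolding phase_inv_def by blast
  have pow: "(2::nat) ^ Suc d \<le> 2 ^ 51" using d by (intro power_increasing) auto
  then have "(2::nat) ^ Suc d \<le> 2 ^ 70" by simp
  then have "2 ^ Suc d \<le> N" by (rule square_le(2))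
  then show "val s (Const 2 \<otimes> Var ''t'') \<le> N" by (simp add: t)
  assume ok1: "ok ?s"
  show "runs ?s (raise_weights ;; add_weights) (phase_inv r (Suc d))"
  proof (rule runs_Seq, rule runs_conseq)
    have k0': "mw_inv n ?T d {} (mat (?s ''X'')) (mat (s ''A'')) k0"
      using k0 by simp
    show "runs ?s raise_weights (\<lambda>s'. \<exists>k. mw_inv n ?T d triples (mat (s' ''X'')) (mat (s ''A'')) k)"
      by (rule runs_raise_weights[OF ok1 _ sym refl _ d k0'])
        (use r t in \<open>simp_all add: relation_at_def\<close>)
    fix s2
    assume ok2: "ok s2" and fr: "\<And>x. x \<notin> wvars raise_weights \<Longrightarrow> s2 x = ?s x"
      and "\<exists>k. mw_inv n ?T d triples (mat (s2 ''X'')) (mat (s ''A'')) k"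
    then obtain k where k: "mw_inv n ?T d triples (mat (s2 ''X'')) (mat (s ''A'')) k" by blast
    have s2: "s2 ''A'' = s ''A''" "s2 ''a'' = s ''a''" "s2 ''t'' 0 = 2 ^ Suc d"
      using fr t by (auto simp: raise_weights_def)
    have T: "?T \<subseteq> triples" by (auto simp: bad_triples_def)
    note next_inv = mw_inv.phase[OF k T, folded s2(1)]
    have bound: "2 * mat (s2 ''A'') q + mat (s2 ''X'') q \<le> N" for q
    proof -
      have "2 * mat (s2 ''A'') q + mat (s2 ''X'') q \<le> Suc d * 2 ^ Suc d"
        by (rule mw_inv.A_le[OF next_inv])
      also have "\<dots> \<le> 51 * 2 ^ 51" by (rule mult_le_mono[OF _ pow]) (use d in simp)
      also have "\<dots> \<le> N" by (rule square_le(2)) simp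
      finally show ?thesis .
    qed
    show "runs s2 add_weights (phase_inv r (Suc d))"
    proof (rule runs_conseq[OF runs_add_weights[OF ok2 bound]])
      fix s3
      assume fr3: "\<And>x. x \<notin> wvars add_weights \<Longrightarrow> s3 x = s2 x"
        and A: "mat (s3 ''A'') = (\<lambda>q. 2 * mat (s2 ''A'') q + mat (s2 ''X'') q)"
      have s3: "s3 ''X'' = s2 ''X''" "s3 ''a'' = s ''a''" "s3 ''t'' 0 = 2 ^ Suc d"
        using fr3 s2 by (auto simp: add_weights_def)
      have "\<exists>k. mw_inv n ?T (Suc d) {} (mat (s3 ''X'')) (mat (s3 ''A'')) k"
        unfolding A s3(1) by (rule exI[of _ k]) (rule next_inv)
      then show "phase_inv r (Suc d) s3"
        unfolding phase_inv_def using r s3 by (simp add: relation_at_def)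
    qed
  qed
qed (use ok in \<open>auto simp: max_weight_def\<close>)

lemma runs_repeat_phase:
  assumes sym: "\<And>u v. u < n \<Longrightarrow> v < n \<Longrightarrow> r u v = r v u" and refl: "\<And>u. u < n \<Longrightarrow> r u u"
  shows "ok s \<Longrightarrow> phase_inv r d s \<Longrightarrow> d + m \<le> 51 \<Longrightarrow> runs s (repeat m phase) (phase_inv r (d + m))"
proof (induction m arbitrary: s d)
  case 0
  then show ?case by (auto intro: runs_Skip)
next
  case (Suc m)
  have "runs s phase (phase_inv r (Suc d))"
    by (rule runs_phase[OF Suc.prems(1,2) _ sym refl]) (use Suc.prems in auto)
  then have "runs s (phase ;; repeat m phase) (phase_inv r (Suc d + m))"
    by (intro runs_Seq, elim runs_conseq) (rule Suc.IH, use Suc.prems in auto)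
  then show ?case by simp
qed

lemma runs_cover_weights:
  assumes ok: "ok s" and r: "relation_at r s" and X: "s ''X'' = (\<lambda>i. 0)" "s ''A'' = (\<lambda>i. 0)"
    and sym: "\<And>u v. u < n \<Longrightarrow> v < n \<Longrightarrow> r u v = r v u" and refl: "\<And>u. u < n \<Longrightarrow> r u u"
  shows "runs s cover_weights (phase_inv r 51)"
  unfolding cover_weights_def
proof (rule runs_Seq, rule runs_Write)
  show "val s (Const 1) \<le> N" using square_le(2)[of 1] by simp
  assume ok1: "ok (update s ''t'' (val s (Const 0)) (val s (Const 1)))"
  have "phase_inv r 0 (update s ''t'' (val s (Const 0)) (val s (Const 1)))"
    unfolding phase_inv_def
    using r X by (auto simp: relation_at_def mat_zero intro!: exI[of _ "\<lambda>q. 0"] mw_inv_0)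
  from runs_repeat_phase[OF sym refl ok1 this, of 51]
  show "runs (update s ''t'' (val s (Const 0)) (val s (Const 1))) (repeat 51 phase) (phase_inv r 51)"
    by simp
qed (use ok in \<open>auto simp: max_weight_def\<close>)


definition score :: "(nat \<Rightarrow> nat \<Rightarrow> bool) \<Rightarrow> nat \<Rightarrow> (nat \<times> nat \<Rightarrow> nat) \<Rightarrow> nat set \<Rightarrow> state \<Rightarrow> bool" where
  "score r S A R s \<longleftrightarrow> (\<forall>u<n. s ''P'' u = (\<Sum>q\<in>bad_at n r R u. 3 * A q) \<and>
     s ''Q'' u = S * card (bad_at n r R u))"

lemma runs_score_pivots:
  assumes ok: "ok s" and inv: "phase_inv r 51 s" and PQ: "s ''P'' = (\<lambda>i. 0)" "s ''Q'' = (\<lambda>i. 0)"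
  shows "runs s score_pivots (\<lambda>s'. s' ''S'' 0 = 48 * 2 ^ 51 \<and>
    score r (48 * 2 ^ 51) (mat (s ''A'')) {..<n} s')"
  unfolding score_pivots_def
proof (rule runs_Seq, rule runs_Write)
  define A where "A = mat (s ''A'')"
  define S where "S = (48 * 2 ^ 51 :: nat)"
  let ?s = "update s ''S'' (val s (Const 0)) (val s (Const 48 \<otimes> Var ''t''))"
  let ?T = "bad_triples n r"
  \<comment> \<open>The pairs counted so far for pivot \<open>u\<close>. For every \<open>D\<close>
    they form a subset of \<open>pairs n\<close>, so \<open>sum_le\<close> and \<open>S_le\<close>
    bound all intermediate totals of the loop.\<close>
  define B where "B = (\<lambda>D u. {q. (u, q) \<in> D \<and> (u, q) \<in> ?T})"
  have B_sub: "B D u \<subseteq> pairs n" for D u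
    by (auto simp: B_def bad_triples_def)
  have fin: "finite (B D u)" for D u
    by (rule finite_subset[OF B_sub]) simp
  have card_B: "card (B D u) \<le> n * n" for D u
    using card_mono[OF _ B_sub, of D u] by simp
  from inv obtain k0 where k0: "mw_inv n ?T 51 {} (mat (s ''X'')) A k0"
    and r: "relation_at r s" and t: "s ''t'' 0 = 2 ^ 51"
    unfolding phase_inv_def A_def by blast
  have A_le: "3 * A q \<le> 153 * 2 ^ 51" for q
    using mw_inv.A_le[OF k0, of q] by simp
  have sum_le: "(\<Sum>q\<in>B D u. 3 * A q) \<le> N" for D u
  proof -
    have "(\<Sum>q\<in>B D u. 3 * A q) \<le> of_nat (card (B D u)) * (153 * 2 ^ 51)"
      by (rule sum_bounded_above) (rule A_le)
    also have "\<dots> \<le> n * n * (153 * 2 ^ 51)"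
      using card_B[of D u] by simp
    also have "\<dots> \<le> N" by (rule square_le(3)) simp
    finally show ?thesis .
  qed
  have S_le: "S * card (B D u) \<le> N" for D u
  proof -
    have "S * card (B D u) \<le> n * n * S" using card_B[of D u] by (simp add: mult.commute)
    also have "\<dots> \<le> N" by (rule square_le(3)) (simp add: S_def)
    finally show ?thesis .
  qed
  show "val s (Const 48 \<otimes> Var ''t'') \<le> N"
    using square_le(2)[of "48 * 2 ^ 51"] t by simp
  assume ok1: "ok ?s"
  let ?b = "Write ''P'' (Var ''u'') (Read ''P'' (Var ''u'') \<oplus> Const 3 \<otimes> At ''A'' (Var ''v'') (Var ''w'')) ;;
        Write ''Q'' (Var ''u'') (Read ''Q'' (Var ''u'') \<oplus> Var ''S'')"
  let ?c = "When (Bad ''u'' ''v'' ''w'') (?b)"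
  let ?I = "\<lambda>D s'. \<forall>u<n. s' ''P'' u = (\<Sum>q\<in>B D u. 3 * A q) \<and> s' ''Q'' u = S * card (B D u)"
  show "runs ?s (For ''u'' (For ''v'' (For ''w'' ?c)))
    (\<lambda>s'. s' ''S'' 0 = 48 * 2 ^ 51 \<and> score r (48 * 2 ^ 51) (mat (s ''A'')) {..<n} s')"
  proof (rule runs_conseq)
    show "runs ?s (For ''u'' (For ''v'' (For ''w'' ?c))) (?I triples)"
    proof (rule runs_For3[where I = ?I])
      show "?I {} ?s" using PQ by (simp add: B_def)
      fix D i j k s1
      assume ijk: "i < n" "j < n" "k < n" "(i, j, k) \<notin> D"
        and s1: "ok s1" "s1 ''u'' 0 = i" "s1 ''v'' 0 = j" "s1 ''w'' 0 = k"
        and fr: "\<And>x. x \<notin> {''u'', ''v'', ''w''} \<union> wvars ?c \<Longrightarrow> s1 x = ?s x" and I: "?I D s1"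
      have s1s: "s1 ''a'' = s ''a''" "mat (s1 ''A'') = A" "s1 ''S'' 0 = S"
        using fr t by (auto simp: A_def S_def)
      have rel: "relation_at r s1" using r s1s by (simp add: relation_at_def)
      note n = okD(1)[OF s1(1)]
      have cond: "val s1 (Bad ''u'' ''v'' ''w'') = of_bool ((i, j, k) \<in> ?T)"
        by (rule val_Bad[OF rel n s1(2-4) ijk(1-3)])
      show "runs s1 ?c (?I (insert (i, j, k) D))"
      proof (rule runs_If[OF s1(1)])
        show "ec (Bad ''u'' ''v'' ''w'') < max_weight" by (simp add: max_weight_def)
        assume "val s1 (Bad ''u'' ''v'' ''w'') = 0"
        then have "(i, j, k) \<notin> ?T" unfolding cond by simp
        then have "B (insert (i, j, k) D) = B D" by (auto simp: B_def fun_eq_iff)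
        then show "runs s1 Skip (?I (insert (i, j, k) D))"
          using I by (intro runs_Skip s1(1)) simp
      next
        assume "val s1 (Bad ''u'' ''v'' ''w'') \<noteq> 0"
        then have bad: "(i, j, k) \<in> ?T" unfolding cond by (simp split: if_splits)
        have B': "B (insert (i, j, k) D) u = (if u = i then insert (j, k) (B D u) else B D u)" for u
          using bad by (auto simp: B_def)
        have new: "(j, k) \<notin> B D i" using ijk(4) by (simp add: B_def)
        have P: "(\<Sum>q\<in>B (insert (i, j, k) D) i. 3 * A q) = s1 ''P'' i + 3 * A (j, k)"
          and Q: "S * card (B (insert (i, j, k) D) i) = s1 ''Q'' i + S"
          using I ijk(1) new fin by (simp_all add: B')
        have "s1 ''P'' i + 3 * A (j, k) \<le> N" "s1 ''Q'' i + S \<le> N"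
          unfolding P[symmetric] Q[symmetric] by (rule sum_le S_le)+
        then show "runs s1 (?b) (?I (insert (i, j, k) D))"
          using s1 n s1s ijk P Q I
          by (intro runs_Seq runs_Write) (auto simp: max_weight_def mat_read B')
      qed
    qed (use ok1 in auto)
  next
    fix s' assume fr: "\<And>x. x \<notin> wvars (For ''u'' (For ''v'' (For ''w'' ?c))) \<Longrightarrow> s' x = ?s x"
      and I: "?I triples s'"
    have "B triples u = bad_at n r {..<n} u" for u
      by (auto simp: B_def bad_at_def bad_triples_def)
    moreover have "s' ''S'' 0 = 48 * 2 ^ 51" using fr t by auto
    ultimately show "s' ''S'' 0 = 48 * 2 ^ 51 \<and> score r (48 * 2 ^ 51) (mat (s ''A'')) {..<n} s'"
      using I by (simp add: score_def S_def A_def)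
  qed
qed (use ok in \<open>auto simp: max_weight_def\<close>)

end

section \<open>Computing the pivot clustering\<close>

lemma pivot_inv_cong:
  assumes "pivot_inv n a S A l" and eq: "\<And>u. u < n \<Longrightarrow> l' u = l u"
  shows "pivot_inv n a S A l'"
proof -
  have d: "decided n l' = decided n l" using eq by (auto simp: decided_def)
  have w: "{(u, v) \<in> decided n l'. a u v \<noteq> (l' u = l' v)} = {(u, v) \<in> decided n l. a u v \<noteq> (l u = l v)}"
    unfolding d using eq by (auto simp: decided_def)
  have 1: "p < n \<and> a p u \<and> l' p = Suc p" if "u < n" "l' u = Suc p" for u p
  proof -
    have "l u = Suc p" using eq[OF that(1)] that(2) by simp
    then have "p < n \<and> a p u \<and> l p = Suc p"
      using assms(1) that(1) unfolding pivot_inv_def by blast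
    then show ?thesis using eq[of p] by simp
  qed
  have 2: "l' u = l' v" if "u < n" "v < n" "\<forall>p<n. a p u = a p v" for u v
  proof -
    have "l u = l v" using assms(1) that unfolding pivot_inv_def by blast
    then show ?thesis using eq that(1,2) by simp
  qed
  have 3: "S * card {(u, v) \<in> decided n l'. a u v \<noteq> (l' u = l' v)} \<le> (\<Sum>q\<in>decided n l'. 3 * A q)"
    unfolding w unfolding d by (rule assms(1)[unfolded pivot_inv_def, THEN conjunct2, THEN conjunct2])
  show ?thesis
    unfolding pivot_inv_def using 1 2 3 by blast
qed

text \<open>By symmetry the pairs lost with \<open>v\<close> are \<open>(v, w)\<close> and
  \<open>(w, v)\<close> for the same \<open>w\<close>. The two families are disjoint because a bad
  triple never repeats a vertex.\<close>

lemma bad_at_remove: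
  fixes u :: nat
  assumes R: "R \<subseteq> {..<n}" "v \<in> R"
    and sym: "\<And>u v. u < n \<Longrightarrow> v < n \<Longrightarrow> r u v = r v u" and refl: "\<And>u. u < n \<Longrightarrow> r u u"
  defines "W \<equiv> {w \<in> R. (u, v, w) \<in> bad_triples n r}"
  shows "sum f (bad_at n r R u) = sum f (bad_at n r (R - {v}) u) + (\<Sum>w\<in>W. f (v, w) + f (w, v))"
    and "card (bad_at n r R u) = card (bad_at n r (R - {v}) u) + 2 * card W"
proof -
  have fin: "finite W" unfolding W_def using R(1) by (auto intro: finite_subset)
  have flip: "(u, v', w') \<in> bad_triples n r \<longleftrightarrow> (u, w', v') \<in> bad_triples n r" for v' w'
    unfolding bad_triples_def using sym[of u v'] sym[of v' w'] sym[of w' u] by auto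
  have vW: "v \<notin> W"
  proof
    assume "v \<in> W"
    then have "(u, v, v) \<in> bad_triples n r" by (simp add: W_def)
    from bad_triples_distinct(2)[OF this sym refl] show False by simp
  qed
  have eq: "bad_at n r R u = bad_at n r (R - {v}) u \<union> (Pair v ` W \<union> (\<lambda>w. (w, v)) ` W)"
    using R flip by (auto simp: bad_at_def W_def)
  have disj: "bad_at n r (R - {v}) u \<inter> (Pair v ` W \<union> (\<lambda>w. (w, v)) ` W) = {}"
    "Pair v ` W \<inter> (\<lambda>w. (w, v)) ` W = {}"
    using vW by (auto simp: bad_at_def)
  have sum: "sum g (bad_at n r R u) = sum g (bad_at n r (R - {v}) u) + (\<Sum>w\<in>W. g (v, w) + g (w, v))"
    for g :: "nat \<times> nat \<Rightarrow> 'b :: comm_monoid_add"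
  proof -
    have "sum g (Pair v ` W) = (\<Sum>w\<in>W. g (v, w))"
      by (subst sum.reindex) (auto simp: inj_on_def)
    moreover have "sum g ((\<lambda>w. (w, v)) ` W) = (\<Sum>w\<in>W. g (w, v))"
      by (subst sum.reindex) (auto simp: inj_on_def)
    ultimately show ?thesis
      unfolding eq using fin disj by (subst sum.union_disjoint; simp add: sum.union_disjoint sum.distrib)
  qed
  show "sum f (bad_at n r R u) = sum f (bad_at n r (R - {v}) u) + (\<Sum>w\<in>W. f (v, w) + f (w, v))"
    by (rule sum)
  show "card (bad_at n r R u) = card (bad_at n r (R - {v}) u) + 2 * card W"
    using sum[of "\<lambda>_. 1 :: nat"] by simp
qed

text \<open>A hit is stored as the vertex plus one, which leaves 0 for failure; the last hit
  wins.\<close>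

definition search :: "string \<Rightarrow> expr \<Rightarrow> com" where
  "search x e = For ''u'' (When e (Assign x (Var ''u'' \<oplus> Const 1)))"

text \<open>Withdraws the contributions of \<open>v\<close> from all totals in quadratic time, so
  \<open>n\<close> removals stay cubic. The loop runs while \<open>v\<close> itself is still
  unlabelled, which is harmless because the triple (u, v, v) is never bad.\<close>

definition retract :: com where
  "retract = For ''u'' (For ''w'' (When ((Read ''out'' (Var ''w'') \<doteq> Const 0) \<otimes> Bad ''u'' ''v'' ''w'')
     (Write ''P'' (Var ''u'') (Read ''P'' (Var ''u'') \<ominus>
        (Const 3 \<otimes> At ''A'' (Var ''v'') (Var ''w'') \<oplus> Const 3 \<otimes> At ''A'' (Var ''w'') (Var ''v''))) ;;
      Write ''Q'' (Var ''u'') (Read ''Q'' (Var ''u'') \<ominus> Const 2 \<otimes> Var ''S''))))"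

text \<open>\<open>p\<close> and \<open>q\<close> hold a vertex plus one, or 0 for none, so
  \<open>p\<close> doubles as the label of the current cluster. When no neighbour of the pivot is
  waiting, an unlabelled vertex with \<open>Q\<close> at most \<open>P\<close> becomes the new pivot
  and is itself the first vertex of its cluster.\<close>

definition choose_vertex :: com where
  "choose_vertex = (Assign ''q'' (Const 0) ;;
     When (Var ''p'') (search ''q''
       ((Read ''out'' (Var ''u'') \<doteq> Const 0) \<otimes> At ''a'' (Var ''p'' \<ominus> Const 1) (Var ''u''))) ;;
     If (Var ''q'') Skip
       (search ''q'' ((Read ''out'' (Var ''u'') \<doteq> Const 0) \<otimes>
          ((Read ''P'' (Var ''u'') \<sqsubset> Read ''Q'' (Var ''u'')) \<doteq> Const 0)) ;;
        Assign ''p'' (Var ''q'')))"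

definition pivot_clusters :: com where
  "pivot_clusters = For ''i'' (choose_vertex ;; Assign ''v'' (Var ''q'' \<ominus> Const 1) ;; retract ;;
     Write ''out'' (Var ''v'') (Var ''p''))"

section \<open>Correctness of the pivoting loop\<close>

context instance_ram
begin

lemma runs_search:
  assumes ok: "ok s" and x: "x \<noteq> ''u''" "x \<noteq> ''n''" "s x 0 = 0" and e: "ec e < max_weight"
    and C: "\<And>k s'. k < n \<Longrightarrow> ok s' \<Longrightarrow> s' ''u'' 0 = k \<Longrightarrow> (\<And>y. y \<notin> {''u'', x} \<Longrightarrow> s' y = s y) \<Longrightarrow>
      val s' e \<noteq> 0 \<longleftrightarrow> C k"
  shows "runs s (search x e) (\<lambda>s'. s' x 0 = 0 \<and> (\<forall>k<n. \<not> C k) \<or> (\<exists>k<n. C k \<and> s' x 0 = Suc k))"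
  unfolding search_def
proof (rule runs_For[where I = "\<lambda>m s'. s' x 0 = 0 \<and> (\<forall>k<m. \<not> C k) \<or> (\<exists>k<m. C k \<and> s' x 0 = Suc k)"])
  let ?c = "When e (Assign x (Var ''u'' \<oplus> Const 1))"
  let ?I = "\<lambda>m s'. s' x 0 = 0 \<and> (\<forall>k<m. \<not> C k) \<or> (\<exists>k<m. C k \<and> s' x 0 = Suc k)"
  fix k s1
  assume k: "k < n" "ok s1" "s1 ''u'' 0 = k"
    and fr: "\<And>y. y \<notin> insert ''u'' (wvars ?c) \<Longrightarrow> s1 y = s y" and I: "?I k s1"
  have Ck: "val s1 e \<noteq> 0 \<longleftrightarrow> C k" by (rule C[OF k]) (use fr in auto)
  have N: "Suc k \<le> N" using k(1) n_le by simp
  show "runs s1 ?c (\<lambda>s''. ?I (Suc k) (update s'' ''u'' 0 (Suc k)))"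
  proof (rule runs_If[OF k(2) e])
    assume "val s1 e \<noteq> 0"
    then show "runs s1 (Assign x (Var ''u'' \<oplus> Const 1)) (\<lambda>s''. ?I (Suc k) (update s'' ''u'' 0 (Suc k)))"
      using Ck N x k by (intro runs_Write) (auto simp: max_weight_def)
  next
    assume "val s1 e = 0"
    then show "runs s1 Skip (\<lambda>s''. ?I (Suc k) (update s'' ''u'' 0 (Suc k)))"
      using Ck I x k by (intro runs_Skip) (auto simp: less_Suc_eq)
  qed
qed (use ok x in auto)

definition alive :: "state \<Rightarrow> nat set" where
  "alive s = {u. u < n \<and> s ''out'' u = 0}"

lemma runs_retract:
  assumes ok: "ok s" and r: "relation_at r s" and v: "s ''v'' 0 = v" "v \<in> alive s"
    and score: "score r S (mat (s ''A'')) (alive s) s" and S: "s ''S'' 0 = S"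
    and sym: "\<And>u v. u < n \<Longrightarrow> v < n \<Longrightarrow> r u v = r v u" and refl: "\<And>u. u < n \<Longrightarrow> r u u"
  shows "runs s retract (score r S (mat (s ''A'')) (alive s - {v}))"
  unfolding retract_def
proof (rule runs_conseq)
  define A where "A = mat (s ''A'')"
  define R where "R = alive s"
  let ?T = "bad_triples n r"
  let ?R = "R - {v}"
  \<comment> \<open>The partners of \<open>v\<close> whose contributions are still to be subtracted.
    Each total contains them as summands, so truncated subtraction is exact.\<close>
  define W where "W = (\<lambda>D u. {w \<in> R. (u, v, w) \<in> ?T \<and> (u, w) \<notin> D})"
  have R: "R \<subseteq> {..<n}" "v \<in> R" using v by (auto simp: R_def alive_def)
  have fin: "finite (W D u)" for D u
    unfolding W_def using R(1) by (auto intro: finite_subset)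
  let ?w = "\<lambda>w. 3 * A (v, w) + 3 * A (w, v)"
  let ?I = "\<lambda>D s'. \<forall>u<n. s' ''P'' u = (\<Sum>q\<in>bad_at n r ?R u. 3 * A q) + sum ?w (W D u) \<and>
      s' ''Q'' u = S * card (bad_at n r ?R u) + 2 * S * card (W D u)"
  let ?b = "Write ''P'' (Var ''u'') (Read ''P'' (Var ''u'') \<ominus>
        (Const 3 \<otimes> At ''A'' (Var ''v'') (Var ''w'') \<oplus> Const 3 \<otimes> At ''A'' (Var ''w'') (Var ''v''))) ;;
      Write ''Q'' (Var ''u'') (Read ''Q'' (Var ''u'') \<ominus> Const 2 \<otimes> Var ''S'')"
  let ?e = "(Read ''out'' (Var ''w'') \<doteq> Const 0) \<otimes> Bad ''u'' ''v'' ''w''"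
  let ?c = "When (?e) (?b)"
  show "runs s (For ''u'' (For ''w'' ?c)) (?I (pairs n))"
  proof (rule runs_For2[where I = ?I])
    show "?I {} s"
    proof (intro allI impI)
      fix u assume u: "u < n"
      have W0: "W {} u = {w \<in> R. (u, v, w) \<in> ?T}" by (simp add: W_def)
      show "s ''P'' u = (\<Sum>q\<in>bad_at n r ?R u. 3 * A q) + sum ?w (W {} u) \<and>
          s ''Q'' u = S * card (bad_at n r ?R u) + 2 * S * card (W {} u)"
        using score u bad_at_remove(1)[OF R sym refl, where f = "\<lambda>q. 3 * A q" and u = u]
          bad_at_remove(2)[OF R sym refl, where u = u]
        unfolding score_def W0 R_def[symmetric] A_def[symmetric]
        by (simp add: add_mult_distrib2)
    qed
    fix D i k s1
    assume ik: "i < n" "k < n" "(i, k) \<notin> D"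
      and s1: "ok s1" "s1 ''u'' 0 = i" "s1 ''w'' 0 = k"
      and fr: "\<And>x. x \<notin> {''u'', ''w''} \<union> wvars ?c \<Longrightarrow> s1 x = s x" and I: "?I D s1"
    have s1s: "s1 ''a'' = s ''a''" "mat (s1 ''A'') = A" "s1 ''S'' 0 = S" "s1 ''out'' = s ''out''" "s1 ''v'' 0 = v"
      using fr S v by (auto simp: A_def)
    have rel: "relation_at r s1" using r s1s by (simp add: relation_at_def)
    note n = okD(1)[OF s1(1)]
    have vn: "v < n" using R by auto
    have "val s1 (Bad ''u'' ''v'' ''w'') = of_bool ((i, v, k) \<in> ?T)"
      by (rule val_Bad[OF rel n s1(2) s1s(5) s1(3) ik(1) vn ik(2)])
    then have cond: "val s1 (?e) = of_bool (k \<in> R) * of_bool ((i, v, k) \<in> ?T)"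
      using s1 s1s ik by (simp add: R_def alive_def)
    show "runs s1 ?c (?I (insert (i, k) D))"
    proof (rule runs_If[OF s1(1)])
      show "ec (?e) < max_weight" by (simp add: max_weight_def)
      assume "val s1 (?e) = 0"
      then have "\<not> (k \<in> R \<and> (i, v, k) \<in> ?T)" unfolding cond by auto
      then have "W (insert (i, k) D) = W D" by (auto simp: W_def fun_eq_iff)
      then show "runs s1 Skip (?I (insert (i, k) D))"
        using I by (intro runs_Skip s1(1)) simp
    next
      assume "val s1 (?e) \<noteq> 0"
      then have k: "k \<in> R" "(i, v, k) \<in> ?T" unfolding cond by (auto split: if_splits)
      have W': "W (insert (i, k) D) u = (if u = i then W D i - {k} else W D u)" for u
        by (auto simp: W_def)
      have kW: "k \<in> W D i" using k ik by (simp add: W_def)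
      have s: "sum ?w (W D i) = ?w k + sum ?w (W D i - {k})"
        by (rule sum.remove[OF fin kW])
      have c: "card (W D i) = Suc (card (W D i - {k}))"
        by (rule card.remove[OF fin kW])
      have P: "s1 ''P'' i - ?w k = (\<Sum>q\<in>bad_at n r ?R i. 3 * A q) + sum ?w (W D i - {k})"
        and Q: "s1 ''Q'' i - 2 * S = S * card (bad_at n r ?R i) + 2 * S * card (W D i - {k})"
        using I ik(1) s c by simp_all
      have "(\<Sum>q\<in>bad_at n r ?R i. 3 * A q) + sum ?w (W D i - {k}) \<le> N"
        "S * card (bad_at n r ?R i) + 2 * S * card (W D i - {k}) \<le> N"
        unfolding P[symmetric] Q[symmetric]
        using okD(2)[OF s1(1), of "''P''" i] okD(2)[OF s1(1), of "''Q''" i]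
        by (auto intro: order_trans[OF diff_le_self])
      then show "runs s1 (?b) (?I (insert (i, k) D))"
        using s1 n s1s ik vn P Q I
        by (intro runs_Seq runs_Write) (simp_all add: max_weight_def mat_read W')
    qed
  qed (use ok in auto)
  fix s' assume I: "?I (pairs n) s'"
  have "W (pairs n) u = {}" if "u < n" for u
    using R(1) that by (auto simp: W_def)
  then show "score r S (mat (s ''A'')) (alive s - {v}) s'"
    using I by (simp add: score_def A_def R_def)
qed

text \<open>A cluster is emptied one vertex per iteration, so that each iteration takes quadratic time.
  The vertices still waiting next to the current pivot count as labelled already.\<close>

definition consistent :: "(nat \<Rightarrow> nat \<Rightarrow> bool) \<Rightarrow> state \<Rightarrow> (nat \<Rightarrow> nat) \<Rightarrow> bool" where
  "consistent r s l \<longleftrightarrow> (\<forall>u<n. l u = (if s ''out'' u \<noteq> 0 then s ''out'' u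
     else if s ''p'' 0 \<noteq> 0 \<and> r (s ''p'' 0 - 1) u then s ''p'' 0 else 0))"

text \<open>If a neighbour of the pivot is waiting, the anticipated labelling \<open>l\<close> stays
  as it is. Otherwise \<open>l\<close> agrees with the real labels, so the scores over
  \<open>alive s\<close> speak about exactly the unlabelled vertices of \<open>l\<close>; averaging
  then guarantees a hit, and \<open>pivot_inv_step\<close> adds the whole new cluster at
  once.\<close>

lemma runs_choose_vertex:
  assumes ok: "ok s" and r: "relation_at r s" and A: "A = mat (s ''A'')"
    and sym: "\<And>u v. u < n \<Longrightarrow> v < n \<Longrightarrow> r u v = r v u" and refl: "\<And>u. u < n \<Longrightarrow> r u u"
    and score: "score r S A (alive s) s"
    and S: "\<And>p v w. (p, v, w) \<in> bad_triples n r \<Longrightarrow> S \<le> A (p, v) + A (v, w) + A (w, p)"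
    and l: "pivot_inv n r S A l" "consistent r s l" and p: "s ''p'' 0 \<le> n" and ne: "alive s \<noteq> {}"
  shows "runs s choose_vertex (\<lambda>s'. \<exists>v l'. v \<in> alive s \<and> s' ''q'' 0 = Suc v \<and>
    pivot_inv n r S A l' \<and> consistent r s' l' \<and> l' v = s' ''p'' 0 \<and> l' v \<noteq> 0 \<and> s' ''p'' 0 \<le> n)"
    (is "runs s _ ?Q")
  unfolding choose_vertex_def
proof (rule runs_Seq, rule runs_Write)
  let ?s = "update s ''q'' (val s (Const 0)) (val s (Const 0))"
  let ?e1 = "(Read ''out'' (Var ''u'') \<doteq> Const 0) \<otimes> At ''a'' (Var ''p'' \<ominus> Const 1) (Var ''u'')"
  let ?e2 = "(Read ''out'' (Var ''u'') \<doteq> Const 0) \<otimes> ((Read ''P'' (Var ''u'') \<sqsubset> Read ''Q'' (Var ''u'')) \<doteq> Const 0)"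
  let ?C = "\<lambda>k. k \<in> alive s \<and> r (s ''p'' 0 - 1) k"
  let ?c2 = "If (Var ''q'') Skip (search ''q'' (?e2) ;; Assign ''p'' (Var ''q''))"
  assume ok1: "ok ?s"
  let ?M = "\<lambda>s'. s' ''q'' 0 = 0 \<and> (s ''p'' 0 = 0 \<or> (\<forall>k<n. \<not> ?C k)) \<or> s ''p'' 0 \<noteq> 0 \<and> (\<exists>k<n. ?C k \<and> s' ''q'' 0 = Suc k)"
  show "runs ?s (When (Var ''p'') (search ''q'' (?e1)) ;; ?c2) ?Q"
  proof (rule runs_Seq, rule runs_conseq)
    show "runs ?s (When (Var ''p'') (search ''q'' (?e1))) ?M"
    proof (rule runs_If[OF ok1])
      assume "val ?s (Var ''p'') \<noteq> 0"
      then have p0: "s ''p'' 0 \<noteq> 0" by simp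
      have "runs ?s (search ''q'' (?e1)) (\<lambda>s'. s' ''q'' 0 = 0 \<and> (\<forall>k<n. \<not> ?C k) \<or> (\<exists>k<n. ?C k \<and> s' ''q'' 0 = Suc k))"
      proof (rule runs_search[OF ok1])
        fix k s1
        assume k: "k < n" "ok s1" "s1 ''u'' 0 = k" and fr: "\<And>y. y \<notin> {''u'', ''q''} \<Longrightarrow> s1 y = ?s y"
        have s1: "s1 ''out'' = s ''out''" "s1 ''a'' = s ''a''" "s1 ''p'' = s ''p''"
          using fr by auto
        have "s ''p'' 0 - 1 < n" using p p0 by simp
        then show "val s1 (?e1) \<noteq> 0 \<longleftrightarrow> ?C k"
          using k s1 r okD(1)[OF k(2)] by (simp add: relation_at_def mat_read alive_def)
      qed (auto simp: max_weight_def)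
      then show "runs ?s (search ''q'' (?e1)) ?M"
        by (rule runs_conseq) (use p0 in blast)
    next
      assume "val ?s (Var ''p'') = 0"
      then show "runs ?s Skip ?M" by (intro runs_Skip ok1) simp
    qed (simp add: max_weight_def)
  next
    fix s2
    assume ok2: "ok s2" and fr2: "\<And>x. x \<notin> wvars (When (Var ''p'') (search ''q'' (?e1))) \<Longrightarrow> s2 x = ?s x"
      and M: "?M s2"
    have s2: "s2 ''out'' = s ''out''" "s2 ''p'' = s ''p''" "s2 ''P'' = s ''P''" "s2 ''Q'' = s ''Q''"
      using fr2 by (auto simp: search_def)
    show "runs s2 (?c2) ?Q"
    proof (rule runs_If[OF ok2])
      assume "val s2 (Var ''q'') \<noteq> 0"
      then obtain k where k: "s ''p'' 0 \<noteq> 0" "k < n" "?C k" "s2 ''q'' 0 = Suc k" using M by auto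
      have "consistent r s2 l" using l(2) s2 by (simp add: consistent_def)
      moreover have "l k = s2 ''p'' 0" "l k \<noteq> 0"
        using l(2) k s2 by (auto simp: consistent_def alive_def)
      ultimately have "?Q s2" using l(1) k p s2 by auto
      then show "runs s2 Skip ?Q" by (rule runs_Skip[OF ok2])
    next
      assume "val s2 (Var ''q'') = 0"
      then have q0: "s2 ''q'' 0 = 0" and none: "s ''p'' 0 = 0 \<or> (\<forall>k<n. \<not> ?C k)" using M by auto
      have lR: "l u = s ''out'' u" if "u < n" for u
        using l(2) none that by (auto simp: consistent_def alive_def)
      then have R: "{u. u < n \<and> l u = 0} = alive s" by (auto simp: alive_def)
      let ?D = "\<lambda>k. k \<in> alive s \<and> S * card (bad_at n r (alive s) k) \<le> (\<Sum>q\<in>bad_at n r (alive s) k. 3 * A q)"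
      have "\<exists>k\<in>alive s. S * card (bad_at n r (alive s) k) \<le> (\<Sum>q\<in>bad_at n r (alive s) k. 3 * A q)"
        by (rule good_pivot_exists[where A = A and S = S and a = r and n = n and R = "alive s"])
          (use ne S in \<open>auto simp: alive_def\<close>)
      then have ex: "\<exists>k<n. ?D k" by (auto simp: alive_def)
      show "runs s2 (search ''q'' (?e2) ;; Assign ''p'' (Var ''q'')) ?Q"
      proof (rule runs_Seq, rule runs_conseq)
        show "runs s2 (search ''q'' (?e2)) (\<lambda>s'. s' ''q'' 0 = 0 \<and> (\<forall>k<n. \<not> ?D k) \<or> (\<exists>k<n. ?D k \<and> s' ''q'' 0 = Suc k))"
        proof (rule runs_search[OF ok2])
          fix k s3
          assume k: "k < n" "ok s3" "s3 ''u'' 0 = k" and fr: "\<And>y. y \<notin> {''u'', ''q''} \<Longrightarrow> s3 y = s2 y"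
          have s3: "s3 ''out'' = s ''out''" "s3 ''P'' = s ''P''" "s3 ''Q'' = s ''Q''"
            using fr s2 by auto
          show "val s3 (?e2) \<noteq> 0 \<longleftrightarrow> ?D k"
            using k s3 score by (auto simp: score_def alive_def)
        qed (use q0 in \<open>auto simp: max_weight_def\<close>)
        fix s3
        assume ok3: "ok s3" and fr3: "\<And>x. x \<notin> wvars (search ''q'' (?e2)) \<Longrightarrow> s3 x = s2 x"
          and "s3 ''q'' 0 = 0 \<and> (\<forall>k<n. \<not> ?D k) \<or> (\<exists>k<n. ?D k \<and> s3 ''q'' 0 = Suc k)"
        then obtain k where k: "k < n" "?D k" "s3 ''q'' 0 = Suc k" using ex by auto
        have s3: "s3 ''out'' = s ''out''" using fr3 s2 by (auto simp: search_def)
        define l' where "l' = (\<lambda>u. if l u = 0 \<and> r k u then Suc k else l u)"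
        have lk: "l k = 0" using k lR by (auto simp: alive_def)
        have l'_inv: "pivot_inv n r S A l'"
          unfolding l'_def
          by (rule pivot_inv_step[OF l(1) sym refl k(1) lk]) (use k(2) R in simp_all)
        have l'k: "l' k = Suc k" using refl[OF k(1)] lk by (simp add: l'_def)
        show "runs s3 (Assign ''p'' (Var ''q'')) ?Q"
        proof (rule runs_Write[OF ok3])
          let ?t = "update s3 ''p'' (val s3 (Const 0)) (val s3 (Var ''q''))"
          have "consistent r ?t l'"
            unfolding consistent_def l'_def using s3 k(3) lR by simp
          moreover have "k \<in> alive s" using k(2) by blast
          ultimately show "?Q ?t"
            using l'_inv l'k k(1,3) by (intro exI[of _ k] exI[of _ l']) simp
        qed (use okD(2)[OF ok3] in \<open>simp_all add: max_weight_def\<close>)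
      qed
    qed (simp add: max_weight_def)
  qed
qed (use ok in \<open>auto simp: max_weight_def\<close>)

lemma wvars_choose_vertex: "wvars choose_vertex = {''q'', ''u'', ''p''}"
  by (auto simp: choose_vertex_def search_def)

lemma runs_pivot_clusters:
  assumes ok: "ok s" and r: "relation_at r s" and A: "A = mat (s ''A'')"
    and sym: "\<And>u v. u < n \<Longrightarrow> v < n \<Longrightarrow> r u v = r v u" and refl: "\<And>u. u < n \<Longrightarrow> r u u"
    and score: "score r S A {..<n} s" and S0: "s ''S'' 0 = S"
    and S: "\<And>p v w. (p, v, w) \<in> bad_triples n r \<Longrightarrow> S \<le> A (p, v) + A (v, w) + A (w, p)"
    and out: "s ''out'' = (\<lambda>i. 0)" "s ''p'' = (\<lambda>i. 0)"
  shows "runs s pivot_clusters (\<lambda>s'. pivot_inv n r S A (s' ''out'') \<and> (\<forall>u<n. s' ''out'' u \<noteq> 0))"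
  unfolding pivot_clusters_def
proof (rule runs_conseq)
  let ?c = "choose_vertex ;; Assign ''v'' (Var ''q'' \<ominus> Const 1) ;; retract ;; Write ''out'' (Var ''v'') (Var ''p'')"
  \<comment> \<open>Each round labels exactly one vertex, so \<open>n\<close> rounds empty
    \<open>alive\<close>. The scores follow the real labels, the budget in \<open>pivot_inv\<close>
    the anticipated ones.\<close>
  let ?I = "\<lambda>k s'. score r S A (alive s') s' \<and> card (alive s') = n - k \<and> s' ''p'' 0 \<le> n \<and>
    (\<exists>l. pivot_inv n r S A l \<and> consistent r s' l)"
  show "runs s (For ''i'' (?c)) (?I n)"
  proof (rule runs_For[where I = ?I])
    have "alive s = {..<n}" using out by (auto simp: alive_def)
    then show "?I 0 (update s ''i'' 0 0)"
      using score out pivot_inv_0[of n r S A]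
      by (auto simp: score_def alive_def consistent_def intro!: exI[of _ "\<lambda>u. 0"])
    fix k s1
    assume k: "k < n" "ok s1" and fr: "\<And>x. x \<notin> insert ''i'' (wvars (?c)) \<Longrightarrow> s1 x = s x" and I: "?I k s1"
    have s1: "s1 ''A'' = s ''A''" "s1 ''a'' = s ''a''" "s1 ''S'' = s ''S''"
      using fr by (auto simp: wvars_choose_vertex retract_def)
    have rel: "relation_at r s1" using r s1 by (simp add: relation_at_def)
    have A1: "A = mat (s1 ''A'')" using A s1 by simp
    from I obtain l where l: "pivot_inv n r S A l" "consistent r s1 l"
      and sc: "score r S A (alive s1) s1" and p: "s1 ''p'' 0 \<le> n" and card: "card (alive s1) = n - k" by blast
    have ne: "alive s1 \<noteq> {}" using card k(1) by auto
    show "runs s1 (?c) (\<lambda>s''. ?I (Suc k) (update s'' ''i'' 0 (Suc k)))"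
    proof (rule runs_Seq, rule runs_conseq[OF runs_choose_vertex[OF k(2) rel A1 sym refl sc S l p ne]])
      fix s2
      assume ok2: "ok s2" and fr2: "\<And>x. x \<notin> wvars choose_vertex \<Longrightarrow> s2 x = s1 x"
        and "\<exists>v l'. v \<in> alive s1 \<and> s2 ''q'' 0 = Suc v \<and> pivot_inv n r S A l' \<and> consistent r s2 l' \<and>
          l' v = s2 ''p'' 0 \<and> l' v \<noteq> 0 \<and> s2 ''p'' 0 \<le> n"
      then obtain v l' where v: "v \<in> alive s1" "s2 ''q'' 0 = Suc v"
        and l': "pivot_inv n r S A l'" "consistent r s2 l'" "l' v = s2 ''p'' 0" "l' v \<noteq> 0" "s2 ''p'' 0 \<le> n"
        by blast
      have s2: "s2 ''A'' = s1 ''A''" "s2 ''a'' = s1 ''a''" "s2 ''S'' = s1 ''S''" "s2 ''out'' = s1 ''out''"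
          "s2 ''P'' = s1 ''P''" "s2 ''Q'' = s1 ''Q''"
        using fr2 by (auto simp: wvars_choose_vertex)
      have al2: "alive s2 = alive s1" using s2 by (simp add: alive_def)
      let ?t = "update s2 ''v'' (val s2 (Const 0)) (val s2 (Var ''q'' \<ominus> Const 1))"
      have tv: "?t ''v'' 0 = v" using v by simp
      have vn: "v < n" using v by (simp add: alive_def)
      have al: "alive ?t = alive s1" using al2 by (simp add: alive_def)
      show "runs s2 (Assign ''v'' (Var ''q'' \<ominus> Const 1) ;; retract ;; Write ''out'' (Var ''v'') (Var ''p''))
        (\<lambda>s''. ?I (Suc k) (update s'' ''i'' 0 (Suc k)))"
      proof (rule runs_Seq, rule runs_Write[OF ok2])
        show "val s2 (Var ''q'' \<ominus> Const 1) \<le> N" using v vn n_le by simp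
        assume okt: "ok ?t"
        have relt: "relation_at r ?t" using rel s2 by (simp add: relation_at_def)
        have sct: "score r S (mat (?t ''A'')) (alive ?t) ?t"
          using sc s2 A1 unfolding al by (simp add: score_def)
        have St: "?t ''S'' 0 = S" using S0 s1 s2 by simp
        have vt: "v \<in> alive ?t" unfolding al by (rule v(1))
        have "runs ?t retract (score r S (mat (?t ''A'')) (alive ?t - {v}))"
          by (rule runs_retract[OF okt relt tv vt sct St sym refl])
        then have ret: "runs ?t retract (score r S A (alive s1 - {v}))"
          unfolding al using A1 s2 by simp
        show "runs ?t (retract ;; Write ''out'' (Var ''v'') (Var ''p'')) (\<lambda>s''. ?I (Suc k) (update s'' ''i'' 0 (Suc k)))"
        proof (rule runs_Seq, rule runs_conseq[OF ret])
          fix s3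
          assume ok3: "ok s3" and fr3: "\<And>x. x \<notin> wvars retract \<Longrightarrow> s3 x = ?t x"
            and sc3: "score r S A (alive s1 - {v}) s3"
          have s3: "s3 ''out'' = s1 ''out''" "s3 ''p'' 0 = l' v" "s3 ''v'' 0 = v" "s2 ''p'' 0 = l' v"
            using fr3 s2 tv l' by (auto simp: retract_def)
          show "runs s3 (Write ''out'' (Var ''v'') (Var ''p'')) (\<lambda>s''. ?I (Suc k) (update s'' ''i'' 0 (Suc k)))"
          proof (rule runs_Write[OF ok3])
            show "val s3 (Var ''p'') \<le> N" using okD(2)[OF ok3] by simp
            let ?w = "update (update s3 ''out'' (val s3 (Var ''v'')) (val s3 (Var ''p''))) ''i'' 0 (Suc k)"
            have alw: "alive ?w = alive s1 - {v}"
              using s3 l'(4) by (auto simp: alive_def)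
            have "score r S A (alive ?w) ?w"
              using sc3 unfolding alw by (simp add: score_def)
            moreover have "card (alive ?w) = n - Suc k"
              unfolding alw using card v(1) by (simp add: card_Diff_singleton)
            moreover have "?w ''p'' 0 \<le> n" using s3 l'(5) by simp
            moreover have "consistent r ?w l'"
              using l'(2) s3 s2(4) vn v(1) by (auto simp: consistent_def)
            ultimately show "?I (Suc k) ?w" using l'(1) by blast
          qed (simp_all add: max_weight_def)
        qed
      qed (simp_all add: max_weight_def)
    qed
  qed (use ok in \<open>auto simp: wvars_choose_vertex retract_def\<close>)
  fix s' assume I: "?I n s'"
  then have "card (alive s') = 0" by simp
  then have "alive s' = {}" by (simp add: alive_def)
  then have ne: "\<forall>u<n. s' ''out'' u \<noteq> 0" by (auto simp: alive_def)
  from I obtain l where l: "pivot_inv n r S A l" "consistent r s' l" by blast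
  have "pivot_inv n r S A (s' ''out'')"
    by (rule pivot_inv_cong[OF l(1)]) (use l(2) ne in \<open>simp add: consistent_def\<close>)
  then show "pivot_inv n r S A (s' ''out'') \<and> (\<forall>u<n. s' ''out'' u \<noteq> 0)" using ne by blast
qed

end

section \<open>Approximation factor\<close>

lemma same_output:
  assumes "u < n" "v < n"
  shows "same (output_clustering n s) u v \<longleftrightarrow> s ''out'' u = s ''out'' v"
  using assms by (auto simp: same_def output_clustering_def)

lemma partition_output: "partition_on {..<n} (output_clustering n s)"
  unfolding partition_on_def disjoint_def
  by (auto simp: output_clustering_def)

lemma same_equiv:
  assumes C: "partition_on V C"
  shows "u \<in> V \<Longrightarrow> same C u u" and "same C u v \<Longrightarrow> same C v u"
    and "same C u v \<Longrightarrow> same C v w \<Longrightarrow> same C u w"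
proof -
  show "u \<in> V \<Longrightarrow> same C u u"
    using partition_onD1[OF C] by (auto simp: same_def)
  show "same C u v \<Longrightarrow> same C v u"
    by (auto simp: same_def)
  assume "same C u v" "same C v w"
  then obtain X Y where XY: "X \<in> C" "Y \<in> C" "u \<in> X" "v \<in> X" "v \<in> Y" "w \<in> Y"
    by (auto simp: same_def)
  then have "X = Y"
    using partition_onD2[OF C] by (meson disjointD disjoint_iff)
  then show "same C u w" using XY by (auto simp: same_def)
qed

lemma friendly_same:
  assumes F: "F \<subseteq> [{..<n}]\<^bsup>2\<^esup>" and C: "valid_clustering {..<n} F H C"
  shows "friendly n F (same C)"
proof -
  have part: "partition_on {..<n} C" using C by (simp add: valid_clustering_def)
  note eq = same_equiv[OF part]
  have "same C u v" if uv: "u < n" "v < n" "{u, v} \<in> F" for u v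
  proof -
    obtain X Y where XY: "X \<in> C" "u \<in> X" "Y \<in> C" "v \<in> Y"
      using eq(1)[of u] eq(1)[of v] uv by (auto simp: same_def)
    then have "X = Y" using C uv(3) unfolding valid_clustering_def by blast
    then show ?thesis using XY by (auto simp: same_def)
  qed
  then show ?thesis
    unfolding friendly_def using eq by blast
qed

lemma mergedD:
  assumes "merged n F D l"
  shows "u < n \<Longrightarrow> l u < n" and "(u, v) \<in> D \<Longrightarrow> {u, v} \<in> F \<Longrightarrow> l u = l v"
    and "friendly n F c \<Longrightarrow> u < n \<Longrightarrow> v < n \<Longrightarrow> l u = l v \<Longrightarrow> c u v"
proof -
  show "u < n \<Longrightarrow> l u < n" "(u, v) \<in> D \<Longrightarrow> {u, v} \<in> F \<Longrightarrow> l u = l v"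
    using assms by (simp_all add: merged_def)
  assume "friendly n F c"
  from assms[unfolded merged_def, THEN conjunct2, THEN conjunct2, THEN spec, THEN mp, OF this]
  show "u < n \<Longrightarrow> v < n \<Longrightarrow> l u = l v \<Longrightarrow> c u v" by simp
qed

lemma pivot_invD:
  assumes "pivot_inv n a S A l"
  shows "u < n \<Longrightarrow> l u = Suc p \<Longrightarrow> p < n \<and> a p u"
    and "u < n \<Longrightarrow> v < n \<Longrightarrow> (\<And>p. p < n \<Longrightarrow> a p u = a p v) \<Longrightarrow> l u = l v"
  using assms unfolding pivot_inv_def by blast+

text \<open>\<open>Min\<close> is meaningful only on a finite nonempty set: a finite set has
  finitely many partitions, and feasibility supplies an element.\<close>

lemma opt_cost_attained:
  assumes "finite V" and "valid_clustering V F H C0"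
  shows "\<exists>C. valid_clustering V F H C \<and> clustering_cost E C = opt_cost V E F H"
proof -
  have "finite {C. valid_clustering V F H C}"
    by (rule finite_subset[OF _ finitely_many_partition_on[OF assms(1)]]) (auto simp: valid_clustering_def)
  then have "opt_cost V E F H \<in> clustering_cost E ` {C. valid_clustering V F H C}"
    unfolding opt_cost_def using assms(2) by (intro Min_in) auto
  then show ?thesis by auto
qed

context instance_ram
begin

text \<open>The combinatorial half of the correctness proof: array contents enter only as functions
  with their defining equations, and the program has to supply these.\<close>

lemma output_approximates:
  fixes l h c e g r A s
  assumes sub: "E \<subseteq> [{..<n}]\<^bsup>2\<^esup>" "F \<subseteq> [{..<n}]\<^bsup>2\<^esup>" "H \<subseteq> [{..<n}]\<^bsup>2\<^esup>"
    and l: "merged n F (pairs n) l"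
    and h: "\<And>x y. h (x, y) = of_bool (\<exists>q\<in>pairs n. l (fst q) = x \<and> l (snd q) = y \<and> {fst q, snd q} \<in> H)"
    and e: "\<And>x y. e (x, y) = count_if (pairs n) (\<lambda>q. l (fst q) = x \<and> l (snd q) = y \<and> {fst q, snd q} \<in> E)"
    and c: "\<And>x y. c (x, y) = count_if (pairs n) (\<lambda>q. l (fst q) = x \<and> l (snd q) = y)"
    and cut: "cut_inv n h e triples g"
    and r: "\<And>u v. r u v \<longleftrightarrow> l u = l v \<or> h (l u, l v) = (0::nat) \<and> c (l u, l v) < g (l u, l v) + g (l v, l u)"
    and piv: "pivot_inv n r (48 * 2 ^ 51) A (s ''out'')" "\<forall>u<n. s ''out'' u \<noteq> 0"
    and mw: "mw_inv n (bad_triples n r) 51 {} X A k0"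
    and valid: "valid_clustering {..<n} F H C0"
  shows "is_approximation 16 {..<n} E F H (output_clustering n s)"
proof -
  let ?O = "output_clustering n s"
  note ln = mergedD(1)[OF l]
  have lF: "l u = l v" if "u < n" "v < n" "{u, v} \<in> F" for u v
    by (rule mergedD(2)[OF l]) (use that in auto)
  have ltn: "u < n \<and> v < n" if "{u, v} \<in> F \<union> H" for u v
    using that sub by (auto simp: nsets_def)
  have g_le: "g q \<le> e q" for q
    by (rule cut[unfolded cut_inv_def, THEN conjunct1, THEN spec])
  have e_le: "e (x, y) \<le> c (x, y)" for x y
    unfolding e c count_if_def by (rule card_mono) auto
  have c_sym: "c (x, y) = c (y, x)" for x y
  proof -
    have "bij_betw prod.swap {q \<in> pairs n. l (fst q) = x \<and> l (snd q) = y} {q \<in> pairs n. l (fst q) = y \<and> l (snd q) = x}"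
      by (rule bij_betw_byWitness[where f' = prod.swap]) auto
    then show ?thesis unfolding c count_if_def by (rule bij_betw_same_card)
  qed
  have h_intro: "h (l u, l v) \<noteq> 0" if "u < n" "v < n" "{u, v} \<in> H" for u v
    unfolding h using that by (auto intro!: bexI[of _ "(u, v)"])
  have h_sep: "\<not> same C u v"
    if C: "valid_clustering {..<n} F H C" and uv: "u < n" "v < n" "h (l u, l v) \<noteq> 0" for C u v
  proof
    assume suv: "same C u v"
    have part: "partition_on {..<n} C" using C by (simp add: valid_clustering_def)
    from uv(3) obtain u' v' where uv': "u' < n" "v' < n" "l u' = l u" "l v' = l v" "{u', v'} \<in> H"
      unfolding h by (auto split: if_splits)
    have eq: "same C i j" if "l i = l j" "i < n" "j < n" for i j
      by (rule mergedD(3)[OF l friendly_same[OF sub(2) C] that(2,3,1)])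
    have "same C u' v'"
      using same_equiv(3)[OF part same_equiv(3)[OF part eq[OF uv'(3,1) uv(1)] suv] eq[OF _ uv(2) uv'(2)]] uv'(4)
      by simp
    then show False using C uv'(5) unfolding valid_clustering_def same_def by blast
  qed
  have valid_O: "valid_clustering {..<n} F H ?O"
    unfolding valid_clustering_def
  proof (intro conjI allI impI)
    show "partition_on {..<n} ?O" by (rule partition_output)
    fix u v
    show "\<not> (\<exists>X\<in>?O. \<exists>Y\<in>?O. X \<noteq> Y \<and> u \<in> X \<and> v \<in> Y)" if uv: "{u, v} \<in> F"
    proof -
      have lt: "u < n" "v < n" using ltn uv by auto
      \<comment> \<open>The rounded graph depends on labels only, so friendly vertices have equal
        neighbourhoods.\<close>
      have "r p u = r p v" for p using lF[OF lt uv] by (simp add: r)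
      then have "s ''out'' u = s ''out'' v" by (rule pivot_invD(2)[OF piv(1) lt])
      then show ?thesis by (auto simp: output_clustering_def)
    qed
    show "\<not> (\<exists>X\<in>?O. u \<in> X \<and> v \<in> X)" if uv: "{u, v} \<in> H"
    proof
      assume "\<exists>X\<in>?O. u \<in> X \<and> v \<in> X"
      then have same_out: "s ''out'' u = s ''out'' v" by (auto simp: output_clustering_def)
      have lt: "u < n" "v < n" using ltn uv by auto
      obtain p where p: "s ''out'' u = Suc p" using piv(2) lt(1) by (cases "s ''out'' u") auto
      have pu: "p < n" "r p u" using pivot_invD(1)[OF piv(1) lt(1) p] by auto
      have pv: "r p v" using pivot_invD(1)[OF piv(1) lt(2)] p same_out by simp
      have h1: "h (l u, l v) \<noteq> 0" by (rule h_intro[OF lt uv])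
      have h2: "h (l v, l u) \<noteq> 0" using h_intro[OF lt(2,1)] uv by (simp add: insert_commute)
      \<comment> \<open>Feasibility enters the validity of the output here: a hostile pair inside
        one component would contradict \<open>C0\<close>.\<close>
      have "l u \<noteq> l v"
      proof
        assume eq: "l u = l v"
        have "h (l u, l u) \<noteq> 0" using h1 eq by simp
        then have "\<not> same C0 u u" by (rule h_sep[OF valid lt(1) lt(1)])
        then show False
          using same_equiv(1)[of "{..<n}" C0 u] valid lt(1) by (simp add: valid_clustering_def)
      qed
      show False
      proof (cases "l p = l u \<or> l p = l v")
        case True
        then show False using pu(2) pv h1 h2 \<open>l u \<noteq> l v\<close> r[of p u] r[of p v] by auto
      next
        case False
        then have 1: "c (l p, l u) < g (l p, l u) + g (l u, l p)" and 2: "c (l p, l v) < g (l p, l v) + g (l v, l p)"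
          using pu(2) pv r[of p u] r[of p v] by auto
        \<comment> \<open>One of the two blocks at \<open>l p\<close> has no survivor in one
          orientation. The other orientation would then have to exceed the block size alone, which
          \<open>g_le\<close> and \<open>e_le\<close> forbid.\<close>
        have "(l u, l p, l v) \<in> triples" using ln lt pu(1) by simp
        then have "g (l u, l p) = 0 \<or> g (l p, l v) = 0"
          using cut[unfolded cut_inv_def, THEN conjunct2, THEN conjunct1, THEN spec, THEN spec, THEN spec] h1 by simp
        then show False
          using 1 2 g_le[of "(l p, l u)"] e_le[of "l p" "l u"] g_le[of "(l v, l p)"] e_le[of "l v" "l p"]
            c_sym[of "l v" "l p"] by auto
      qed
    qed
  qed
  have cost: "clustering_cost E ?O \<le> 16 * clustering_cost E C" if C: "valid_clustering {..<n} F H C" for C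
  proof -
    have part: "partition_on {..<n} C" using C by (simp add: valid_clustering_def)
    note eq = same_equiv[OF part]
    have lC: "same C i j" if "l i = l j" "i < n" "j < n" for i j
      by (rule mergedD(3)[OF l friendly_same[OF sub(2) C] that(2,3,1)])
    \<comment> \<open>The disjunct \<open>x = y\<close> covers labels carried by no vertex, since
      \<open>rounding_cost\<close> asks for reflexivity on all labels.\<close>
    define k where "k = (\<lambda>x y. x = y \<or> (\<exists>u<n. \<exists>v<n. l u = x \<and> l v = y \<and> same C u v))"
    have k_iff: "same C u v \<longleftrightarrow> k (l u) (l v)" if uv: "u < n" "v < n" for u v
    proof
      show "same C u v \<Longrightarrow> k (l u) (l v)" using uv by (auto simp: k_def)
      assume "k (l u) (l v)"
      then consider "l u = l v" | u' v' where "u' < n" "v' < n" "l u' = l u" "l v' = l v" "same C u' v'"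
        by (auto simp: k_def)
      then show "same C u v"
      proof cases
        case 1
        then show ?thesis using lC[of u v] uv by simp
      next
        case 2
        have "same C u u'" using lC[of u u'] 2 uv by simp
        moreover have "same C v' v" using lC[of v' v] 2 uv by simp
        ultimately show ?thesis using eq(3)[OF _ eq(3)[OF 2(5)]] by simp
      qed
    qed
    have k_sym: "k x y = k y x" for x y
      using eq(2) by (auto simp: k_def)
    let ?E = "\<lambda>u v. {u, v} \<in> E"
    let ?E' = "\<lambda>u v. u = v \<or> {u, v} \<in> E"
    let ?e = "\<lambda>(x, y). card {(u, v) \<in> block n l x y. ?E u v}"
    have e_eq: "e = ?e"
    proof
      fix q :: "nat \<times> nat"
      obtain x y where q: "q = (x, y)" by (cases q)
      have "{q \<in> pairs n. l (fst q) = x \<and> l (snd q) = y \<and> {fst q, snd q} \<in> E} = {(u, v) \<in> block n l x y. ?E u v}"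
        by (auto simp: block_def)
      then show "e q = ?e q" by (simp add: q e count_if_def)
    qed
    have c_eq: "c (x, y) = card (block n l x y)" for x y
    proof -
      have "{q \<in> pairs n. l (fst q) = x \<and> l (snd q) = y} = block n l x y" by (auto simp: block_def)
      then show ?thesis by (simp add: c count_if_def)
    qed
    have sepk: "\<not> (k x y \<and> k y z)" if xyz: "x < n" "y < n" "z < n" "h (x, z) \<noteq> 0" for x y z
    proof
      assume kk: "k x y \<and> k y z"
      from xyz(4) obtain u w where uw: "u < n" "w < n" "l u = x" "l w = z"
        unfolding h by (auto split: if_splits)
      have "\<not> same C u w" using h_sep[OF C uw(1,2)] xyz(4) uw by simp
      then have nk: "\<not> k x z" using k_iff[OF uw(1,2)] uw by simp
      \<comment> \<open>An equality here would turn one half of \<open>kk\<close> into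
        \<open>k x z\<close>. Hence both relations are witnessed by vertices, and in particular
        \<open>y\<close> is the label of some vertex.\<close>
      then have "x \<noteq> y" "y \<noteq> z" using kk by auto
      then obtain u1 v1 v2 w2 where *: "u1 < n" "v1 < n" "l u1 = x" "l v1 = y" "same C u1 v1"
        "v2 < n" "w2 < n" "l v2 = y" "l w2 = z" "same C v2 w2"
        using kk unfolding k_def by auto
      have "same C v1 v2" using lC[of v1 v2] * by simp
      from eq(3)[OF eq(3)[OF *(5) this] *(10)] have "same C u1 w2" .
      then have "k x z" using k_iff[of u1 w2] * by simp
      then show False using nk by simp
    qed
    have pot: "(\<Sum>q\<in>pairs n. (if k (fst q) (snd q) then 1 else - 1) * (int (e q) - int (g q))) \<le> 0"
      by (rule cut[unfolded cut_inv_def, THEN conjunct2, THEN conjunct2, THEN spec, THEN mp])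
        (use sepk in blast)
    have 1: "2 * mismatch n ?E' r + 13 * mismatch n r (same C) \<le> 32 * mismatch n ?E' (same C)"
    proof (rule rounding_cost[where l = l and h = "\<lambda>x y. h (x, y) \<noteq> 0" and g = g and k = k])
      show "{u, v} \<in> E \<longleftrightarrow> {v, u} \<in> E" for u v by (simp add: insert_commute)
      show "r u v \<longleftrightarrow> l u = l v \<or> \<not> h (l u, l v) \<noteq> 0 \<and> card (block n l (l u) (l v)) < g (l u, l v) + g (l v, l u)" for u v
        by (simp add: r c_eq)
      show "k x x" for x by (simp add: k_def)
      show "g q \<le> ?e q" for q using g_le[of q] unfolding e_eq .
      show "(\<Sum>q\<in>pairs n. (if k (fst q) (snd q) then 1 else - 1) * (int (?e q) - int (g q))) \<le> 0"
        using pot unfolding e_eq .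
    qed (use ln k_iff k_sym h_sep[OF C] in auto)
    let ?M = "{(u, v) \<in> pairs n. r u v \<noteq> same C u v}"
    have cov: "covers ?M (bad_triples n r)"
      unfolding covers_def
    proof (intro allI impI)
      fix p v w assume bad: "(p, v, w) \<in> bad_triples n r"
      then have lt: "p < n" "v < n" "w < n" by (auto simp: bad_triples_def)
      show "(p, v) \<in> ?M \<or> (v, w) \<in> ?M \<or> (w, p) \<in> ?M"
      proof (rule ccontr)
        assume "\<not> ?thesis"
        then have "r p v = same C p v" "r v w = same C v w" "r w p = same C w p" using lt by auto
        moreover have "r p v \<and> r v w \<and> \<not> r w p \<or> r v w \<and> r w p \<and> \<not> r p v \<or> r w p \<and> r p v \<and> \<not> r v w"
          using bad by (auto simp: bad_triples_def of_bool_def split: if_splits)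
        moreover have "same C x y \<Longrightarrow> same C y z \<Longrightarrow> same C z x" for x y z
          by (rule eq(2)[OF eq(3)])
        ultimately show False by metis
      qed
    qed
    have "48 * 2 ^ 51 * mismatch n r (same ?O) \<le> 3 * sum A (pairs n)"
    proof -
      have "mismatch n r (same ?O) = card {(u, v) \<in> pairs n. r u v \<noteq> (s ''out'' u = s ''out'' v)}"
        unfolding mismatch_def by (rule arg_cong[where f = card]) (auto simp: same_output)
      then show ?thesis using pivot_inv_final[OF piv(1)] piv(2) by simp
    qed
    also have "\<dots> \<le> 3 * (2 ^ Suc 51 * (Suc 51 * card ?M))"
      by (rule mult_le_mono2, rule mw_inv.final[OF mw _ cov]) auto
    \<comment> \<open>The constants cancel to 3 * 2 * 52 / 48 = 13 / 2, which is 3 times the cover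
      ratio 13 / 6.\<close>
    finally have 2: "2 * mismatch n r (same ?O) \<le> 13 * mismatch n r (same C)"
      by (simp add: mismatch_def)
    have "mismatch n ?E' (same ?O) \<le> mismatch n ?E' r + mismatch n r (same ?O)"
      by (rule mismatch_triangle)
    then have "2 * mismatch n ?E' (same ?O) \<le> 32 * mismatch n ?E' (same C)"
      using 1 2 by linarith
    then show ?thesis
      unfolding clustering_cost_eq[OF sub(1) part, symmetric]
        clustering_cost_eq[OF sub(1) partition_output, symmetric] by simp
  qed
  from opt_cost_attained[OF _ valid, of E] obtain C where
    C: "valid_clustering {..<n} F H C" "clustering_cost E C = opt_cost {..<n} E F H" by auto
  have "clustering_cost E ?O \<le> 16 * opt_cost {..<n} E F H" using cost[OF C(1)] C(2) by simp
  then have "real (clustering_cost E ?O) \<le> 16 * real (opt_cost {..<n} E F H)"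
    by (metis of_nat_le_iff of_nat_mult of_nat_numeral)
  then show ?thesis
    using valid_O by (simp add: is_approximation_def)
qed

end

section \<open>The complete program\<close>

definition clustering_program :: com where
  "clustering_program = (init_labels ;; merge_friends ;; count_blocks ;; cut_hostile ;; round_blocks ;;
     cover_weights ;; score_pivots ;; pivot_clusters)"

lemma wvars_blocks:
  "wvars init_labels = {''u'', ''l''}"
  "wvars merge_friends = {''u'', ''v'', ''w'', ''x'', ''y'', ''l''}"
  "wvars count_blocks = {''u'', ''v'', ''x'', ''y'', ''c'', ''g'', ''h''}"
  "wvars cut_hostile = {''u'', ''v'', ''w'', ''m'', ''g''}"
  "wvars round_blocks = {''u'', ''v'', ''x'', ''y'', ''a''}"
  "wvars score_pivots = {''S'', ''u'', ''v'', ''w'', ''P'', ''Q''}"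
  by (auto simp: init_labels_def merge_friends_def relabel_def count_blocks_def cut_hostile_def
      round_blocks_def score_pivots_def)

lemma wvars_cover_weights: "wvars cover_weights \<subseteq> {''t'', ''u'', ''v'', ''w'', ''X'', ''A''}"
proof -
  have "wvars phase \<subseteq> {''t'', ''u'', ''v'', ''w'', ''X'', ''A''}"
    by (auto simp: phase_def raise_weights_def add_weights_def)
  then show ?thesis
    using wvars_repeat[of 51 phase] by (auto simp: cover_weights_def simp del: repeat.simps)
qed

context instance_ram
begin

lemma ok_input: "ok (input_state n E F H)"
proof -
  have "1 \<le> N" using square_le(2)[of 1] by simp
  then show ?thesis
    using n_le by (auto simp: ok_def bounded_by_def input_state_def adjacency_def)
qed

text \<open>Feasibility is a premise inside the postcondition only, because halting within the time
  bound is claimed for infeasible inputs too.\<close>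

lemma runs_program:
  assumes sub: "E \<subseteq> [{..<n}]\<^bsup>2\<^esup>" "F \<subseteq> [{..<n}]\<^bsup>2\<^esup>" "H \<subseteq> [{..<n}]\<^bsup>2\<^esup>"
  shows "runs (input_state n E F H) clustering_program (\<lambda>s. (\<exists>C. valid_clustering {..<n} F H C) \<longrightarrow>
    is_approximation 16 {..<n} E F H (output_clustering n s))"
    (is "runs ?s0 _ ?Q")
  unfolding clustering_program_def
proof (rule runs_Seq, rule runs_conseq[OF runs_init_labels[OF ok_input]])
  fix s1
  assume ok1: "ok s1" and fr1: "\<And>x. x \<notin> wvars init_labels \<Longrightarrow> s1 x = ?s0 x" and l1: "\<forall>i<n. s1 ''l'' i = i"
  have F1: "s1 ''F'' = adjacency n F" and s1: "s1 ''E'' = adjacency n E" "s1 ''H'' = adjacency n H"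
    "s1 ''c'' = (\<lambda>i. 0)" "s1 ''g'' = (\<lambda>i. 0)" "s1 ''h'' = (\<lambda>i. 0)" "s1 ''X'' = (\<lambda>i. 0)"
    "s1 ''A'' = (\<lambda>i. 0)" "s1 ''P'' = (\<lambda>i. 0)" "s1 ''Q'' = (\<lambda>i. 0)" "s1 ''out'' = (\<lambda>i. 0)"
    "s1 ''p'' = (\<lambda>i. 0)"
    by (simp_all add: fr1 wvars_blocks input_state_def)
  show "runs s1 (merge_friends ;; count_blocks ;; cut_hostile ;; round_blocks ;;
     cover_weights ;; score_pivots ;; pivot_clusters) ?Q"
  proof (rule runs_Seq, rule runs_conseq[OF runs_merge_friends[OF ok1 l1 F1]])
    fix s2
    assume ok2: "ok s2" and fr2: "\<And>x. x \<notin> wvars merge_friends \<Longrightarrow> s2 x = s1 x"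
      and merged: "merged n F (pairs n) (s2 ''l'')"
    note ln = mergedD(1)[OF merged]
    have s2: "s2 ''E'' = adjacency n E" "s2 ''H'' = adjacency n H" "s2 ''c'' = (\<lambda>i. 0)"
      "s2 ''g'' = (\<lambda>i. 0)" "s2 ''h'' = (\<lambda>i. 0)"
      by (simp_all add: fr2 s1 wvars_blocks)
    show "runs s2 (count_blocks ;; cut_hostile ;; round_blocks ;; cover_weights ;; score_pivots ;; pivot_clusters) ?Q"
    proof (rule runs_Seq, rule runs_conseq[OF runs_count_blocks[OF ok2 ln s2]])
      fix s3
      assume ok3: "ok s3" and fr3: "\<And>x. x \<notin> wvars count_blocks \<Longrightarrow> s3 x = s2 x"
        and counted: "counted (s2 ''l'') (pairs n) s3"
      show "runs s3 (cut_hostile ;; round_blocks ;; cover_weights ;; score_pivots ;; pivot_clusters) ?Q"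
      proof (rule runs_Seq, rule runs_conseq[OF runs_cut_hostile[OF ok3]])
        fix s4
        assume ok4: "ok s4" and fr4: "\<And>x. x \<notin> wvars cut_hostile \<Longrightarrow> s4 x = s3 x"
          and cut: "cut_inv n (mat (s3 ''h'')) (mat (s3 ''g'')) triples (mat (s4 ''g''))"
        define l where "l = s2 ''l''"
        define r where "r = rounded s4"
        have s4: "s4 ''l'' = l" "s4 ''c'' = s3 ''c''" "s4 ''h'' = s3 ''h''"
          by (simp_all add: fr3 fr4 wvars_blocks l_def)
        have ln4: "\<And>u. u < n \<Longrightarrow> s4 ''l'' u < n" using ln unfolding s4 l_def .
        have h: "mat (s3 ''h'') (x, y) = of_bool (\<exists>q\<in>pairs n. l (fst q) = x \<and> l (snd q) = y \<and> {fst q, snd q} \<in> H)"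
          and e: "mat (s3 ''g'') (x, y) = count_if (pairs n) (\<lambda>q. l (fst q) = x \<and> l (snd q) = y \<and> {fst q, snd q} \<in> E)"
          and c: "mat (s3 ''c'') (x, y) = count_if (pairs n) (\<lambda>q. l (fst q) = x \<and> l (snd q) = y)" for x y
          using counted[unfolded counted_def, THEN spec[of _ x], THEN spec[of _ y]] unfolding l_def
          by simp_all
        have r_iff: "r u v \<longleftrightarrow> l u = l v \<or> mat (s3 ''h'') (l u, l v) = 0 \<and>
            mat (s3 ''c'') (l u, l v) < mat (s4 ''g'') (l u, l v) + mat (s4 ''g'') (l v, l u)" for u v
          unfolding r_def rounded_def s4 ..
        have refl: "r u u" for u by (simp add: r_iff)
        have sym: "r u v = r v u" for u v
        proof -
          have "mat (s3 ''h'') (x, y) = mat (s3 ''h'') (y, x)" for x y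
          proof -
            have "\<exists>q\<in>pairs n. l (fst q) = y \<and> l (snd q) = x \<and> {fst q, snd q} \<in> H"
              if "\<exists>q\<in>pairs n. l (fst q) = x \<and> l (snd q) = y \<and> {fst q, snd q} \<in> H" for x y
            proof -
              from that obtain q where "q \<in> pairs n" "l (fst q) = x" "l (snd q) = y" "{fst q, snd q} \<in> H"
                by blast
              then show ?thesis
                by (intro bexI[of _ "prod.swap q"]) (auto simp: insert_commute)
            qed
            then show ?thesis unfolding h by (intro arg_cong[where f = of_bool] iffI)
          qed
          moreover have "mat (s3 ''c'') (x, y) = mat (s3 ''c'') (y, x)" for x y :: nat
          proof -
            have "bij_betw prod.swap {q \<in> pairs n. l (fst q) = x \<and> l (snd q) = y}
                {q \<in> pairs n. l (fst q) = y \<and> l (snd q) = x}"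
              by (rule bij_betw_byWitness[where f' = prod.swap]) auto
            then show ?thesis unfolding c count_if_def by (rule bij_betw_same_card)
          qed
          ultimately have "mat (s3 ''h'') (l u, l v) = mat (s3 ''h'') (l v, l u)"
            "mat (s3 ''c'') (l u, l v) = mat (s3 ''c'') (l v, l u)"
            by blast+
          then show ?thesis
            unfolding r_iff[of u v] r_iff[of v u] by auto
        qed
        show "runs s4 (round_blocks ;; cover_weights ;; score_pivots ;; pivot_clusters) ?Q"
        proof (rule runs_Seq, rule runs_conseq[OF runs_round_blocks[OF ok4 ln4]])
          fix s5
          assume ok5: "ok s5" and fr5: "\<And>x. x \<notin> wvars round_blocks \<Longrightarrow> s5 x = s4 x"
            and "\<forall>u<n. \<forall>v<n. mat (s5 ''a'') (u, v) = of_bool (rounded s4 u v)"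
          then have rel5: "relation_at r s5" by (simp add: relation_at_def r_def)
          have XA: "s5 ''X'' = (\<lambda>i. 0)" "s5 ''A'' = (\<lambda>i. 0)"
            and s5: "s5 ''P'' = (\<lambda>i. 0)" "s5 ''Q'' = (\<lambda>i. 0)" "s5 ''out'' = (\<lambda>i. 0)" "s5 ''p'' = (\<lambda>i. 0)"
            by (simp_all add: fr2 fr3 fr4 fr5 s1 wvars_blocks)
          show "runs s5 (cover_weights ;; score_pivots ;; pivot_clusters) ?Q"
          proof (rule runs_Seq, rule runs_conseq[OF runs_cover_weights[OF ok5 rel5 XA sym refl]])
            fix s6
            assume ok6: "ok s6" and fr6: "\<And>x. x \<notin> wvars cover_weights \<Longrightarrow> s6 x = s5 x"
              and inv: "phase_inv r 51 s6"
            have not_written: "x \<notin> wvars cover_weights" if "x \<notin> {''t'', ''u'', ''v'', ''w'', ''X'', ''A''}" for x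
              using wvars_cover_weights that by blast
            have PQ: "s6 ''P'' = (\<lambda>i. 0)" "s6 ''Q'' = (\<lambda>i. 0)"
              and s6: "s6 ''out'' = (\<lambda>i. 0)" "s6 ''p'' = (\<lambda>i. 0)"
              by (simp_all add: fr6 not_written s5)
            define A where "A = mat (s6 ''A'')"
            obtain k where mw: "mw_inv n (bad_triples n r) 51 {} (mat (s6 ''X'')) A k" and rel6: "relation_at r s6"
              using inv unfolding phase_inv_def A_def by blast
            show "runs s6 (score_pivots ;; pivot_clusters) ?Q"
            proof (rule runs_Seq, rule runs_conseq[OF runs_score_pivots[OF ok6 inv PQ]])
              fix s7
              assume ok7: "ok s7" and fr7: "\<And>x. x \<notin> wvars score_pivots \<Longrightarrow> s7 x = s6 x"
                and S: "s7 ''S'' 0 = 48 * 2 ^ 51 \<and> score r (48 * 2 ^ 51) (mat (s6 ''A'')) {..<n} s7"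
              have s7: "s7 ''out'' = (\<lambda>i. 0)" "s7 ''p'' = (\<lambda>i. 0)" "s7 ''A'' = s6 ''A''" "s7 ''a'' = s6 ''a''"
                by (simp_all add: fr7 s6 wvars_blocks)
              have rel7: "relation_at r s7" using rel6 s7(4) by (simp add: relation_at_def)
              have A7: "A = mat (s7 ''A'')" by (simp add: A_def s7)
              have "(51 - 3) * 2 ^ 51 \<le> A (p, v) + A (v, w) + A (w, p)"
                if "(p, v, w) \<in> bad_triples n r" for p v w
                by (rule mw_inv.fractional_cover[OF mw that])
              then have cov: "48 * 2 ^ 51 \<le> A (p, v) + A (v, w) + A (w, p)"
                if "(p, v, w) \<in> bad_triples n r" for p v w
                using that by simp
              have "runs s7 pivot_clusters
                  (\<lambda>s'. pivot_inv n r (48 * 2 ^ 51) A (s' ''out'') \<and> (\<forall>u<n. s' ''out'' u \<noteq> 0))"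
                by (rule runs_pivot_clusters[OF ok7 rel7 A7 sym refl _ _ cov s7(1,2)])
                  (use S in \<open>simp_all add: A_def\<close>)
              then show "runs s7 pivot_clusters ?Q"
              proof (rule runs_conseq)
                fix s8
                assume out: "pivot_inv n r (48 * 2 ^ 51) A (s8 ''out'') \<and> (\<forall>u<n. s8 ''out'' u \<noteq> 0)"
                show "?Q s8"
                proof
                  assume "\<exists>C. valid_clustering {..<n} F H C"
                  then obtain C0 where C0: "valid_clustering {..<n} F H C0" ..
                  show "is_approximation 16 {..<n} E F H (output_clustering n s8)"
                    by (rule output_approximates[where l = l and h = "mat (s3 ''h'')" and e = "mat (s3 ''g'')"
                          and c = "mat (s3 ''c'')" and g = "mat (s4 ''g'')" and r = r and A = A and s = s8 and X = "mat (s6 ''X'')",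
                          OF sub merged[folded l_def] h e c cut r_iff
                          conjunct1[OF out] conjunct2[OF out] mw C0])
                qed
              qed
            qed
          qed
        qed
      qed
    qed
  qed
qed

end

section \<open>Running time\<close>

lemma steps_For [simp]: "steps n (For i c) = n * (2 + steps n c) + 2"
  by (simp add: For_def)

lemma steps_repeat: "steps n (repeat k c) = k * steps n c + 1"
  by (induction k) auto

text \<open>The 51 phases dominate with a leading term of 7 n^3 each, from the triple loop of
  \<open>raise_weights\<close>; 10000 leaves room for all other terms.\<close>

lemma steps_program: "steps n clustering_program \<le> 10000 * (n + 1) ^ 3"
  by (simp add: clustering_program_def init_labels_def merge_friends_def relabel_def count_blocks_def
      cut_hostile_def round_blocks_def cover_weights_def phase_def raise_weights_def add_weights_def
      score_pivots_def pivot_clusters_def choose_vertex_def retract_def search_def steps_repeat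
      power3_eq_cube algebra_simps del: repeat.simps)

definition value_bound :: "nat \<Rightarrow> nat" where
  "value_bound n = 2 ^ 70 * (n + 1) ^ 2"

definition time_bound :: "nat \<Rightarrow> nat" where
  "time_bound n = 10000 * (n + 1) ^ 3 * (max_weight * len (value_bound n))"

lemma len_value_bound: "len (value_bound n) \<le> 70 + 2 * len (n + 1)"
proof (rule len_le)
  have "(n + 1) ^ 2 < (2 ^ len (n + 1)) ^ 2"
    by (rule power_strict_mono) (use less_two_power_len[of "n + 1"] in auto)
  then have "2 ^ 70 * (n + 1) ^ 2 < (2::nat) ^ 70 * (2 ^ len (n + 1)) ^ 2"
    by (intro mult_strict_left_mono) auto
  also have "(2::nat) ^ 70 * (2 ^ len (n + 1)) ^ 2 = 2 ^ (70 + 2 * len (n + 1))"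
    by (simp only: power_add power_mult[symmetric] mult.commute[of 2])
  finally show "value_bound n < 2 ^ (70 + 2 * len (n + 1))"
    by (simp only: value_bound_def)
qed simp

lemma half_le_ln_2: "1 / 2 \<le> ln (2 :: real)"
  using exp_half_le2 by (subst ln_ge_iff) simp_all

lemma len_Suc_le:
  assumes "2 \<le> n"
  shows "real (len (n + 1)) \<le> 6 * ln (real n)"
proof -
  have "len (n + 1) = nat \<lfloor>log 2 (real (n + 1))\<rfloor> + 1"
    by (simp add: len_def floorlog_def)
  then have "real (len (n + 1)) \<le> log 2 (real (n + 1)) + 1"
    by simp
  also have "log 2 (real (n + 1)) \<le> log 2 (real n * 2)"
    using assms by (intro log_mono) auto
  also have "\<dots> = log 2 (real n) + 1"
    using assms by (simp add: log_mult)
  also have "log 2 (real n) + 1 + 1 \<le> 3 * log 2 (real n)"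
  proof -
    have "log 2 2 \<le> log 2 (real n)" using assms by (intro log_mono) auto
    then show ?thesis by simp
  qed
  also have "\<dots> \<le> 6 * ln (real n)"
  proof -
    note half_le_ln_2
    moreover have "0 \<le> ln (real n)" using assms by simp
    ultimately have "ln (real n) * 1 \<le> ln (real n) * (2 * ln 2)" by (intro mult_left_mono) auto
    then show ?thesis by (simp add: log_def field_simps)
  qed
  finally show ?thesis by simp
qed

lemma time_bound_soft_O: "(\<lambda>n. real (time_bound n)) \<in> soft_O (\<lambda>n. real n ^ 3)"
  unfolding soft_O_def
\<comment> \<open>A single logarithmic factor suffices, hence the exponent 1. In the constant, 10000
  bounds the steps, 8 comes from n + 1 \<le> 2 n cubed, 500 is \<open>max_weight\<close>, and 82 =
  70 + 12 collects the constant and the logarithmic part of the word length.\<close>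
proof (intro CollectI exI[of _ 1] bigoI[where c = "10000 * 8 * 500 * 82"])
  show "\<forall>\<^sub>F n in at_top. norm (real (time_bound n)) \<le>
    10000 * 8 * 500 * 82 * norm (real n ^ 3 * ln (real n ^ 3) ^ 1)"
    using eventually_ge_at_top[of 2]
  proof eventually_elim
    case (elim n)
    have ln: "1 / 2 \<le> ln (real n)"
    proof -
      have "ln 2 \<le> ln (real n)" using elim by simp
      then show ?thesis using half_le_ln_2 by linarith
    qed
    have "real (n + 1) ^ 3 \<le> (2 * real n) ^ 3" using elim by (intro power_mono) auto
    then have 1: "real (n + 1) ^ 3 \<le> 8 * real n ^ 3" by (simp add: power_mult_distrib)
    have "real (len (value_bound n)) \<le> 70 + 2 * real (len (n + 1))"
      using len_value_bound[of n] by linarith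
    also have "\<dots> \<le> 70 + 12 * ln (real n)" using len_Suc_le[OF elim] by simp
    also have "\<dots> \<le> 82 * (3 * ln (real n))" using ln by simp
    finally have 2: "real (len (value_bound n)) \<le> 82 * ln (real n ^ 3)"
      using elim by (simp add: ln_realpow)
    have "real (time_bound n) = 10000 * real (n + 1) ^ 3 * (500 * real (len (value_bound n)))"
      by (simp add: time_bound_def max_weight_def)
    also have "\<dots> \<le> 10000 * (8 * real n ^ 3) * (500 * (82 * ln (real n ^ 3)))"
      using 1 2 by (intro mult_mono) auto
    finally have "real (time_bound n) \<le> 10000 * 8 * 500 * 82 * (real n ^ 3 * ln (real n ^ 3) ^ 1)"
      by simp
    then show ?case
      by simp
  qed
qed

theorem theorem1:
  shows "\<exists>(prog :: com) (T :: nat \<Rightarrow> nat).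
    (\<lambda>n. real (T n)) \<in> soft_O (\<lambda>n. real n ^ 3) \<and>
    (\<forall>(n :: nat) (E :: nat set set) (F :: nat set set) (H :: nat set set).
       E \<subseteq> [{..<n}]\<^bsup>2\<^esup> \<and> F \<subseteq> [{..<n}]\<^bsup>2\<^esup> \<and> H \<subseteq> [{..<n}]\<^bsup>2\<^esup> \<longrightarrow>
       (\<exists>t s. exec prog (input_state n E F H) t s \<and> t \<le> T n \<and>
          ((\<exists>C. valid_clustering {..<n} F H C) \<longrightarrow>
             is_approximation 16 {..<n} E F H (output_clustering n s))))"
proof (intro exI[of _ clustering_program] exI[of _ time_bound] conjI allI impI time_bound_soft_O)
  fix n :: nat and E F H :: "nat set set"
  assume sub: "E \<subseteq> [{..<n}]\<^bsup>2\<^esup> \<and> F \<subseteq> [{..<n}]\<^bsup>2\<^esup> \<and> H \<subseteq> [{..<n}]\<^bsup>2\<^esup>"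
  have "1 * n \<le> 2 ^ 70 * (n + 1) ^ 2"
    by (rule mult_le_mono) (auto simp: power2_eq_square)
  then interpret instance_ram n "value_bound n" E F H
    by unfold_locales (simp_all add: value_bound_def)
  from runs_program obtain t s where
    "exec clustering_program (input_state n E F H) t s"
    "t \<le> steps n clustering_program * (max_weight * len (value_bound n))"
    "(\<exists>C. valid_clustering {..<n} F H C) \<longrightarrow> is_approximation 16 {..<n} E F H (output_clustering n s)"
    using sub unfolding runs_def by blast
  moreover have "steps n clustering_program * (max_weight * len (value_bound n)) \<le> time_bound n"
    unfolding time_bound_def by (rule mult_le_mono1[OF steps_program])
  ultimately show "\<exists>t s. exec clustering_program (input_state n E F H) t s \<and> t \<le> time_bound n \<and>
      ((\<exists>C. valid_clustering {..<n} F H C) \<longrightarrow>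
        is_approximation 16 {..<n} E F H (output_clustering n s))"
    using order_trans by blast
qed

end
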